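(* Let $n\ge 3$ and let $M^n$ be a compact, connected, orientable smooth $n$-dimensional manifold without boundary. If $\alpha_k(M)<k-\left[\frac n2\right]$ for some integer $k\in\{0,\dots,n\}$, then $M$ is homeomorphic to the sphere $S^n$.
   Context: $[r]$ denotes the integer part of $r$. $\dim_H$ denotes Hausdorff dimension: $\dim_H(A)=\inf\{d\ge 0: H_d(A)=0\}$, where $H_d$ is $d$-dimensional Hausdorff measure. For a smooth immersion $x:M^n\to\mathbb{R}^{n+1}$ of the oriented manifold $M$, let $G:M\to S^n$ be its Gauss map (unit normal), let $C=\{p\in M:\det D_pG=0\}$ be the set of critical points of $G$, and let $S=G(C)$ be the set of critical values of $G$. Put $\dim_H(x):=\dim_H(S)$ and $\mathrm{rank}(x):=\min_{p\in M}\mathrm{rank}(D_pG)$. For $k=0,\dots,n$ let $\mathcal{R}(k)$ be the set of immersions $x:M\to\mathbb{R}^{n+1}$ with $\mathrm{rank}(x)\ge k$, and define $$\alpha_k(M)=\inf_{x\in\mathcal{R}(k)}\dim_H(x),$$ with the convention $\alpha_k(M)=n-1$ if $\mathcal{R}(k)=\emptyset$. *)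

theory Defs
  imports "HOL-Analysis.Analysis"
begin

section \<open>Hausdorff measure and Hausdorff dimension\<close>

text \<open>
  The weight of a covering set is its diameter to the power \<open>d\<close>. Two conventions have to be fixed by
  hand: \<^term>\<open>0 powr 0 = (0::real)\<close> in the library, whereas the 0-dimensional weight of a nonempty set
  is 1 (so that the 0-dimensional measure is counting measure), and the empty set has weight 0.
  The dimension-dependent normalising constant that some authors include is omitted; it does not
  affect which sets have measure zero.
\<close>

definition hausdorff_weight :: "real \<Rightarrow> 'a::metric_space set \<Rightarrow> real" where
  "hausdorff_weight d U = (if U = {} then 0 else if d = 0 then 1 else diameter U powr d)"

text \<open>Boundedness is required explicitly since \<^const>\<open>diameter\<close> is 0 on unbounded sets.\<close>

definition hausdorff_premeasure :: "real \<Rightarrow> real \<Rightarrow> 'a::metric_space set \<Rightarrow> ennreal" where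
  "hausdorff_premeasure \<delta> d S =
     (INF U \<in> {U :: nat \<Rightarrow> 'a set. S \<subseteq> (\<Union>i. U i) \<and> (\<forall>i. bounded (U i) \<and> diameter (U i) \<le> \<delta>)}.
        \<Sum>i. ennreal (hausdorff_weight d (U i)))"

definition hausdorff_measure :: "real \<Rightarrow> 'a::metric_space set \<Rightarrow> ennreal" where
  "hausdorff_measure d S = (SUP \<delta> \<in> {0<..}. hausdorff_premeasure \<delta> d S)"

text \<open>
  The set below is bounded below by 0, and it is nonempty for every subset of a Euclidean space,
  so the real-valued infimum is meaningful there.
\<close>

definition hausdorff_dim :: "'a::euclidean_space set \<Rightarrow> real" where
  "hausdorff_dim S = Inf {d. 0 \<le> d \<and> hausdorff_measure d S = 0}"


section \<open>Smooth manifolds\<close>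

text \<open>Iterated directional derivatives avoid a change of type; only used on open sets.\<close>

fun C_k_on :: "nat \<Rightarrow> 'a set \<Rightarrow> ('a::euclidean_space \<Rightarrow> 'b::real_normed_vector) \<Rightarrow> bool" where
  "C_k_on 0 S f \<longleftrightarrow> continuous_on S f"
| "C_k_on (Suc k) S f \<longleftrightarrow>
     (\<forall>x\<in>S. f differentiable (at x)) \<and>
     (\<forall>v. C_k_on k S (\<lambda>x. frechet_derivative f (at x) v))"

definition smooth_on :: "'a set \<Rightarrow> ('a::euclidean_space \<Rightarrow> 'b::real_normed_vector) \<Rightarrow> bool" where
  "smooth_on S f \<longleftrightarrow> (\<forall>k. C_k_on k S f)"

text \<open>
  A chart is a pair of an open domain and a coordinate map. A topological space \<open>M\<close> is given by
  its topology; the smooth structure is the one generated by an atlas \<open>A\<close>, which need not be maximal.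
  Charts map onto open subsets of the whole of \<open>real^'n\<close>, hence there is no boundary.
\<close>

definition chart :: "'a topology \<Rightarrow> 'a set \<times> ('a \<Rightarrow> real^'n) \<Rightarrow> bool" where
  "chart M c \<longleftrightarrow> openin M (fst c) \<and> open (snd c ` fst c) \<and>
     homeomorphic_map (subtopology M (fst c)) (top_of_set (snd c ` fst c)) (snd c)"

definition chart_inv :: "'a set \<times> ('a \<Rightarrow> real^'n) \<Rightarrow> real^'n \<Rightarrow> 'a" where
  "chart_inv c = inv_into (fst c) (snd c)"

definition smooth_atlas :: "'a topology \<Rightarrow> ('a set \<times> ('a \<Rightarrow> real^'n)) set \<Rightarrow> bool" where
  "smooth_atlas M A \<longleftrightarrow>
     (\<forall>c\<in>A. chart M c) \<and> (\<Union>c\<in>A. fst c) = topspace M \<and>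
     (\<forall>c\<in>A. \<forall>c'\<in>A. smooth_on (snd c ` (fst c \<inter> fst c')) (snd c' \<circ> chart_inv c))"

definition smooth_manifold :: "'a topology \<Rightarrow> ('a set \<times> ('a \<Rightarrow> real^'n)) set \<Rightarrow> bool" where
  "smooth_manifold M A \<longleftrightarrow> Hausdorff_space M \<and> second_countable M \<and> smooth_atlas M A"

text \<open>
  An orientation of the smooth manifold \<open>(M, A)\<close> is given by an atlas \<open>B\<close> of the same smooth
  structure all of whose transition maps have positive Jacobian determinant.
\<close>

definition orientation ::
  "'a topology \<Rightarrow> ('a set \<times> ('a \<Rightarrow> real^'n)) set \<Rightarrow> ('a set \<times> ('a \<Rightarrow> real^'n)) set \<Rightarrow> bool" where
  "orientation M A B \<longleftrightarrow>
     smooth_atlas M B \<and> smooth_atlas M (A \<union> B) \<and>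
     (\<forall>c\<in>B. \<forall>c'\<in>B. \<forall>y \<in> snd c ` (fst c \<inter> fst c').
        0 < det (matrix (frechet_derivative (snd c' \<circ> chart_inv c) (at y))))"

definition orientable :: "'a topology \<Rightarrow> ('a set \<times> ('a \<Rightarrow> real^'n)) set \<Rightarrow> bool" where
  "orientable M A \<longleftrightarrow> (\<exists>B. orientation M A B)"

text \<open>
  The differential at \<open>p\<close> of a map into a Euclidean space; the tangent space at \<open>p\<close> is identified
  with \<open>real^'n\<close> by a chart of the atlas around \<open>p\<close>, chosen once for each point.
\<close>

definition chart_at ::
  "('a set \<times> ('a \<Rightarrow> real^'n)) set \<Rightarrow> 'a \<Rightarrow> 'a set \<times> ('a \<Rightarrow> real^'n)" where
  "chart_at A p = (SOME c. c \<in> A \<and> p \<in> fst c)"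

definition differential ::
  "('a set \<times> ('a \<Rightarrow> real^'n)) set \<Rightarrow> ('a \<Rightarrow> real^'m) \<Rightarrow> 'a \<Rightarrow> real^'n \<Rightarrow> real^'m" where
  "differential A f p =
     frechet_derivative (f \<circ> chart_inv (chart_at A p)) (at (snd (chart_at A p) p))"


section \<open>Immersed hypersurfaces and their Gauss maps\<close>

text \<open>
  With \<open>n = CARD('n)\<close>, Euclidean \<open>(n+1)\<close>-space is \<open>real^('n option)\<close>.
\<close>

definition smooth_immersion ::
  "'a topology \<Rightarrow> ('a set \<times> ('a \<Rightarrow> real^'n::finite)) set \<Rightarrow> ('a \<Rightarrow> real^('n option)) \<Rightarrow> bool" where
  "smooth_immersion M A x \<longleftrightarrow>
     (\<forall>c\<in>A. smooth_on (snd c ` fst c) (x \<circ> chart_inv c)) \<and>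
     (\<forall>p\<in>topspace M. inj (differential A x p))"

text \<open>
  The Gauss map with respect to an orientation \<open>B\<close>: the unit normal \<open>N\<close> for which the matrix with
  columns the coordinate tangent vectors (at the indices \<open>Some j\<close>) and \<open>N\<close> (at the index \<open>None\<close>) has
  positive determinant. The sign of this determinant does not depend on an ordering of \<open>'n\<close>, since
  rows and columns are indexed by the same type, nor on the oriented chart chosen at \<open>p\<close>.
\<close>

definition gauss_map ::
  "('a set \<times> ('a \<Rightarrow> real^'n::finite)) set \<Rightarrow> ('a \<Rightarrow> real^('n option)) \<Rightarrow> 'a \<Rightarrow> real^('n option)" where
  "gauss_map B x p = (THE N. norm N = 1 \<and> (\<forall>v. differential B x p v \<bullet> N = 0) \<and>
     0 < det (\<chi> i j. case j of Some k \<Rightarrow> differential B x p (axis k 1) $ i | None \<Rightarrow> N $ i))"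

text \<open>
  The tangent space of the sphere at \<open>G p\<close> and the image of the tangent space of \<open>M\<close> at \<open>p\<close> under
  the differential of \<open>x\<close> are both the orthogonal complement of \<open>G p\<close>, so the differential of \<open>G\<close> is
  an endomorphism of the tangent space. This is its matrix in the basis of coordinate tangent
  vectors; the determinant is that of the endomorphism.
\<close>

definition gauss_differential_matrix ::
  "('a set \<times> ('a \<Rightarrow> real^'n::finite)) set \<Rightarrow> ('a \<Rightarrow> real^('n option)) \<Rightarrow> 'a \<Rightarrow> real^'n^'n" where
  "gauss_differential_matrix B x p = (THE W. \<forall>j.
     differential B (gauss_map B x) p (axis j 1) =
       (\<Sum>i\<in>UNIV. W $ i $ j *\<^sub>R differential B x p (axis i 1)))"

definition gauss_critical_points ::
  "'a topology \<Rightarrow> ('a set \<times> ('a \<Rightarrow> real^'n::finite)) set \<Rightarrow> ('a \<Rightarrow> real^('n option)) \<Rightarrow> 'a set" where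
  "gauss_critical_points M B x = {p \<in> topspace M. det (gauss_differential_matrix B x p) = 0}"

definition immersion_dim ::
  "'a topology \<Rightarrow> ('a set \<times> ('a \<Rightarrow> real^'n::finite)) set \<Rightarrow> ('a \<Rightarrow> real^('n option)) \<Rightarrow> real" where
  "immersion_dim M B x = hausdorff_dim (gauss_map B x ` gauss_critical_points M B x)"

definition immersion_rank ::
  "'a topology \<Rightarrow> ('a set \<times> ('a \<Rightarrow> real^'n::finite)) set \<Rightarrow> ('a \<Rightarrow> real^('n option)) \<Rightarrow> nat" where
  "immersion_rank M B x =
     Min ((\<lambda>p. rank (matrix (differential B (gauss_map B x) p))) ` topspace M)"

definition immersions_rank_ge ::
  "'a topology \<Rightarrow> ('a set \<times> ('a \<Rightarrow> real^'n::finite)) set \<Rightarrow> ('a set \<times> ('a \<Rightarrow> real^'n)) set \<Rightarrow> nat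
     \<Rightarrow> ('a \<Rightarrow> real^('n option)) set" where
  "immersions_rank_ge M A B k = {x. smooth_immersion M A x \<and> k \<le> immersion_rank M B x}"

text \<open>
  Reversing the orientation of a connected \<open>M\<close> replaces each Gauss map by its negative, so the
  value does not depend on the orientation \<open>B\<close>.
\<close>

definition alpha ::
  "'a topology \<Rightarrow> ('a set \<times> ('a \<Rightarrow> real^'n::finite)) set \<Rightarrow> ('a set \<times> ('a \<Rightarrow> real^'n)) set \<Rightarrow> nat
     \<Rightarrow> real" where
  "alpha M A B k =
     (if immersions_rank_ge M A B k = {} then real CARD('n) - 1
      else (INF x \<in> immersions_rank_ge M A B k. immersion_dim M B x))"

end

theory Submission
  imports Defs
begin

text \<open>
  The proof is elementary: an immersion that makes \<open>\<alpha>\<^sub>k(M)\<close> small is shown to be convex, and a convex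
  hypersurface is projected radially onto the sphere.

  Let \<open>x\<close> be an immersion whose Gauss map \<open>G\<close> has rank at least \<open>k\<close> everywhere and whose set of critical
  values has dimension less than \<open>k - [n/2]\<close>, hence less than \<open>k - 1\<close>. Let \<open>S\<close> be the union of this set
  with its image under the antipodal map, and let \<open>L\<close> be its preimage under \<open>G\<close>. Near any point, \<open>k\<close>
  coordinates of \<open>G\<close> can be completed to coordinates of \<open>M\<close>, in which \<open>L\<close> lies in a cylinder over a
  subset of \<open>\<real>\<^sup>k\<close> of dimension less than \<open>k - 1\<close>. Such a set contains no open set and does not
  separate a ball, since a generic parallel translate of a segment misses it (\<open>ball_minus_cylinder\<close>,
  \<open>preimage_null_set_nonseparating\<close>). So \<open>M - L\<close> is connected and dense (\<open>L_nonseparating\<close>).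

  On \<open>M - L\<close> the second fundamental form is nondegenerate. At a point of \<open>M\<close> farthest from the origin it
  is definite, and being definite of a given sign is an open condition that can be lost only where the
  form degenerates; so, for a suitable sign of the normal, the form is positive definite on all of
  \<open>M - L\<close> (\<open>D_everywhere\<close>).

  Now let \<open>p\<close> be a point of \<open>M - L\<close> and \<open>v = G(p)\<close>. The critical points of the height \<open>x \<bullet> v\<close> are those
  where \<open>G\<close> is \<open>v\<close> or \<open>- v\<close>; as \<open>S\<close> is symmetric, none of them is in \<open>L\<close>. By definiteness they are strict
  local maxima where \<open>G = v\<close> and strict local minima where \<open>G = - v\<close>. A function on a compact
  connected manifold of dimension at least two with two peaks would have a pass between them, that is, a
  critical point of another kind (\<open>unique_peak\<close>). So \<open>p\<close> is the only maximum of the height, and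
  \<open>x(M)\<close> lies strictly on one side of its tangent hyperplane at \<open>p\<close> (\<open>strictly_supporting\<close>). By
  density \<open>x(M)\<close> lies weakly on one side of every tangent hyperplane.

  Finally the convex hull of \<open>x(M)\<close> has an interior point, and the projection of \<open>M\<close> from this point to
  the unit sphere is open because the position vector is transversal to the hypersurface. It is
  injective: if two points had the same image then, by openness, there would be such a pair of which one
  point is not in \<open>L\<close>, in contradiction to strict support there. Its image is open and compact, hence the
  whole sphere (\<open>homeomorphic_sphere_if_definite\<close>).
\<close>


section \<open>Calculus of maps with continuous iterated derivatives\<close>

lemma has_derivative_frechet:
  "f differentiable (at x) \<Longrightarrow> (f has_derivative frechet_derivative f (at x)) (at x)"
  by (simp add: frechet_derivative_works)

lemma frechet_derivative_eqI:
  "(f has_derivative f') (at x) \<Longrightarrow> frechet_derivative f (at x) = f'"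
  by (metis frechet_derivative_at)

lemma linear_frechet:
  "f differentiable (at x) \<Longrightarrow> linear (frechet_derivative f (at x))"
  using has_derivative_frechet has_derivative_linear by blast

lemma C_k_on_subset: "C_k_on k S f \<Longrightarrow> T \<subseteq> S \<Longrightarrow> C_k_on k T f"
  by (induction k arbitrary: f) (auto intro: continuous_on_subset)

lemma C_k_on_imp_continuous_on: "C_k_on k S f \<Longrightarrow> continuous_on S f"
  by (cases k) (auto intro!: continuous_at_imp_continuous_on differentiable_imp_continuous_within)

lemma C_k_on_SucD: "C_k_on (Suc k) S f \<Longrightarrow> C_k_on k S f"
proof (induction k arbitrary: f)
  case 0
  then show ?case using C_k_on_imp_continuous_on by (metis C_k_on.simps(1))
next
  case (Suc k)
  then show ?case by (metis C_k_on.simps(2))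
qed

lemma C_k_on_cong:
  assumes "open S" "\<And>x. x \<in> S \<Longrightarrow> f x = g x" "C_k_on k S f"
  shows "C_k_on k S g"
  using assms(2,3)
proof (induction k arbitrary: f g)
  case 0
  then show ?case by (simp cong: continuous_on_cong)
next
  case (Suc k)
  have d: "(g has_derivative frechet_derivative f (at x)) (at x)" if "x \<in> S" for x
    using Suc.prems that \<open>open S\<close>
    by (intro has_derivative_transform_within_open[OF has_derivative_frechet \<open>open S\<close> that]) auto
  have e: "frechet_derivative g (at x) = frechet_derivative f (at x)" if "x \<in> S" for x
    using frechet_derivative_eqI[OF d[OF that]] .
  show ?case
    using Suc.IH[of "\<lambda>x. frechet_derivative f (at x) v" "\<lambda>x. frechet_derivative g (at x) v" for v]
      Suc.prems d e by (auto simp: differentiable_def)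
qed

text \<open>The step of an induction on the order: a formula for the derivative on an open set.\<close>

lemma C_k_on_SucI:
  assumes "open S" "\<And>x. x \<in> S \<Longrightarrow> (f has_derivative f' x) (at x)"
    "\<And>v. C_k_on k S (\<lambda>x. f' x v)"
  shows "C_k_on (Suc k) S f"
proof -
  have "C_k_on k S (\<lambda>x. frechet_derivative f (at x) v)" for v
    by (rule C_k_on_cong[OF assms(1) _ assms(3)]) (simp add: frechet_derivative_eqI[OF assms(2)])
  then show ?thesis using assms(2) by (auto simp: differentiable_def)
qed

lemma C_k_on_const: "C_k_on k S (\<lambda>x. c)"
  by (induction k arbitrary: c) (simp_all add: frechet_derivative_const)

lemma C_k_on_bounded_linear:
  assumes L: "bounded_linear L" and "open S" "C_k_on k S f"
  shows "C_k_on k S (\<lambda>x. L (f x))"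
  using assms(3)
proof (induction k arbitrary: f)
  case 0
  then show ?case by (simp add: bounded_linear.continuous_on[OF L])
next
  case (Suc k)
  show ?case
  proof (rule C_k_on_SucI[OF \<open>open S\<close>])
    show "((\<lambda>x. L (f x)) has_derivative (\<lambda>v. L (frechet_derivative f (at x) v))) (at x)" if "x \<in> S" for x
      using Suc.prems that by (intro bounded_linear.has_derivative[OF L] has_derivative_frechet) auto
  qed (use Suc in auto)
qed

lemma C_k_on_add:
  assumes "open S" "C_k_on k S f" "C_k_on k S g"
  shows "C_k_on k S (\<lambda>x. f x + g x)"
  using assms(2,3)
proof (induction k arbitrary: f g)
  case (Suc k)
  show ?case
  proof (rule C_k_on_SucI[OF \<open>open S\<close>])
    show "((\<lambda>x. f x + g x) has_derivative (\<lambda>v. frechet_derivative f (at x) v + frechet_derivative g (at x) v)) (at x)"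
      if "x \<in> S" for x
      using Suc.prems that by (intro has_derivative_add has_derivative_frechet) auto
  qed (use Suc in auto)
qed (auto intro: continuous_intros)

lemma C_k_on_sum:
  assumes "open S" "\<And>i. i \<in> I \<Longrightarrow> C_k_on k S (f i)"
  shows "C_k_on k S (\<lambda>x. \<Sum>i\<in>I. f i x)"
  using assms(2)
proof (induction I rule: infinite_finite_induct)
  case (insert i I)
  have "C_k_on k S (\<lambda>x. f i x + (\<Sum>i\<in>I. f i x))"
    using insert by (intro C_k_on_add[OF \<open>open S\<close>]) auto
  then show ?case using insert by simp
qed (simp_all add: C_k_on_const)

lemma C_k_on_bilinear:
  fixes B :: "'b::real_normed_vector \<Rightarrow> 'c::real_normed_vector \<Rightarrow> 'd::real_normed_vector"
  assumes B: "bounded_bilinear B" and "open S" "C_k_on k S f" "C_k_on k S g"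
  shows "C_k_on k S (\<lambda>x. B (f x) (g x))"
  using assms(3,4)
proof (induction k arbitrary: f g)
  case 0
  then show ?case using bounded_bilinear.continuous_on[OF B] by auto
next
  case (Suc k)
  show ?case
  proof (rule C_k_on_SucI[OF \<open>open S\<close>])
    show "((\<lambda>x. B (f x) (g x)) has_derivative (\<lambda>v. B (f x) (frechet_derivative g (at x) v) +
            B (frechet_derivative f (at x) v) (g x))) (at x)" if "x \<in> S" for x
      using Suc.prems that by (intro bounded_bilinear.FDERIV[OF B] has_derivative_frechet) auto
    show "C_k_on k S (\<lambda>x. B (f x) (frechet_derivative g (at x) v) +
            B (frechet_derivative f (at x) v) (g x))" for v
      using Suc.prems C_k_on_SucD[OF Suc.prems(1)] C_k_on_SucD[OF Suc.prems(2)]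
      by (intro C_k_on_add[OF \<open>open S\<close>] Suc.IH) simp_all
  qed
qed

lemma C_k_on_prod:
  fixes f :: "'i \<Rightarrow> 'a::euclidean_space \<Rightarrow> real"
  assumes "open S" "\<And>i. i \<in> I \<Longrightarrow> C_k_on k S (f i)"
  shows "C_k_on k S (\<lambda>x. \<Prod>i\<in>I. f i x)"
  using assms(2)
proof (induction I rule: infinite_finite_induct)
  case (insert i I)
  have "C_k_on k S (\<lambda>x. f i x * (\<Prod>i\<in>I. f i x))"
    using insert by (intro C_k_on_bilinear[OF bounded_bilinear_mult \<open>open S\<close>]) auto
  then show ?case using insert by simp
qed (simp_all add: C_k_on_const)

lemma C_k_on_vec:
  fixes f :: "'a::euclidean_space \<Rightarrow> real^'m"
  assumes "open S" "\<And>i. C_k_on k S (\<lambda>x. f x $ i)"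
  shows "C_k_on k S f"
proof -
  have "C_k_on k S (\<lambda>x. \<Sum>i\<in>UNIV. f x $ i *\<^sub>R axis i (1::real))"
    by (intro C_k_on_sum assms C_k_on_bilinear[OF bounded_bilinear_scaleR] C_k_on_const)
  moreover have "(\<Sum>i\<in>UNIV. f x $ i *\<^sub>R axis i (1::real)) = f x" for x
    using basis_expansion[of "f x"] by (simp add: scalar_mult_eq_scaleR)
  ultimately show ?thesis by simp
qed

lemma linear_Basis_expansion:
  assumes "linear L"
  shows "L v = (\<Sum>b\<in>Basis. (v \<bullet> b) *\<^sub>R L b)"
  by (metis (no_types, lifting) assms euclidean_representation linear_scale linear_sum sum.cong)

text \<open>Expanding the inner derivative in the basis writes the derivative of a composition as a sum of
  products of maps of lower order, so that the induction on the order closes.\<close>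

lemma C_k_on_compose:
  fixes g :: "'a::euclidean_space \<Rightarrow> 'b::euclidean_space" and f :: "'b \<Rightarrow> 'c::real_normed_vector"
  assumes "open S" "g ` S \<subseteq> T" "C_k_on k S g" "C_k_on k T f"
  shows "C_k_on k S (\<lambda>x. f (g x))"
  using assms(3,4)
proof (induction k arbitrary: f)
  case 0
  then show ?case using assms(2) by (auto intro: continuous_on_compose2)
next
  case (Suc k)
  have d: "((\<lambda>x. f (g x)) has_derivative
     (\<lambda>v. \<Sum>b\<in>Basis. (frechet_derivative g (at x) v \<bullet> b) *\<^sub>R frechet_derivative f (at (g x)) b)) (at x)"
    if "x \<in> S" for x
  proof -
    have g: "g differentiable (at x)" and f: "f differentiable (at (g x))"
      using Suc.prems that assms(2) by auto
    have "((\<lambda>x. f (g x)) has_derivative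
     (\<lambda>v. frechet_derivative f (at (g x)) (frechet_derivative g (at x) v))) (at x)"
      using has_derivative_compose[OF has_derivative_frechet[OF g] has_derivative_frechet[OF f]] .
    then show ?thesis
      by (subst (asm) linear_Basis_expansion[OF linear_frechet[OF f]])
  qed
  show ?case
  proof (rule C_k_on_SucI[OF \<open>open S\<close> d])
    fix v
    show "C_k_on k S (\<lambda>x. \<Sum>b\<in>Basis. (frechet_derivative g (at x) v \<bullet> b) *\<^sub>R frechet_derivative f (at (g x)) b)"
    proof (intro C_k_on_sum[OF \<open>open S\<close>] C_k_on_bilinear[OF bounded_bilinear_scaleR \<open>open S\<close>])
      fix b :: 'b
      show "C_k_on k S (\<lambda>x. frechet_derivative g (at x) v \<bullet> b)"
        using Suc.prems by (intro C_k_on_bounded_linear[OF bounded_linear_inner_left \<open>open S\<close>]) auto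
      show "C_k_on k S (\<lambda>x. frechet_derivative f (at (g x)) b)"
        using Suc.prems by (intro Suc.IH C_k_on_SucD[OF Suc.prems(1)]) auto
    qed
  qed auto
qed

lemma C_k_on_powr:
  "C_k_on k {0<..} (\<lambda>t::real. c * t powr a)"
proof (induction k arbitrary: c a)
  case 0
  then show ?case by (auto intro!: continuous_intros)
next
  case (Suc k)
  show ?case
  proof (rule C_k_on_SucI)
    show "((\<lambda>t. c * t powr a) has_derivative (\<lambda>v. (c * a * v) * t powr (a - 1))) (at t)"
      if "t \<in> {0<..}" for t :: real
      using that by (auto intro!: derivative_eq_intros simp: powr_diff algebra_simps)
  qed (use Suc in auto)
qed

text \<open>The norm is the square root of a smooth function that is positive away from the zeros.\<close>

lemma C_k_on_normalize:
  fixes f :: "'a::euclidean_space \<Rightarrow> 'b::euclidean_space"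
  assumes "open S" "C_k_on k S f" "\<And>x. x \<in> S \<Longrightarrow> f x \<noteq> 0"
  shows "C_k_on k S (\<lambda>x. f x /\<^sub>R norm (f x))"
proof (rule C_k_on_cong[OF \<open>open S\<close>])
  show "(1 * (f x \<bullet> f x) powr (-1/2)) *\<^sub>R f x = f x /\<^sub>R norm (f x)" if "x \<in> S" for x
    using assms(3)[OF that]
    by (simp add: powr_minus norm_eq_sqrt_inner powr_half_sqrt)
  have "C_k_on k S (\<lambda>x. 1 * (f x \<bullet> f x) powr (-1/2))"
    by (rule C_k_on_compose[OF \<open>open S\<close> _ C_k_on_bilinear[OF bounded_bilinear_inner \<open>open S\<close>] C_k_on_powr])
      (use assms in auto)
  then show "C_k_on k S (\<lambda>x. (1 * (f x \<bullet> f x) powr (-1/2)) *\<^sub>R f x)"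
    by (intro C_k_on_bilinear[OF bounded_bilinear_scaleR \<open>open S\<close>] assms)
qed

lemma C_k_on_det:
  fixes a :: "'a::euclidean_space \<Rightarrow> real^'m^'m"
  assumes "open S" "\<And>i j. C_k_on k S (\<lambda>x. a x $ i $ j)"
  shows "C_k_on k S (\<lambda>x. det (a x))"
  unfolding det_def
  by (intro C_k_on_sum C_k_on_bilinear[OF bounded_bilinear_mult] C_k_on_prod assms C_k_on_const)

text \<open>The mixed second difference over a small square is the square of the side times a value of
  the mixed derivative, in either order of differentiation.\<close>

lemma mixed_difference_real:
  fixes f :: "'a::euclidean_space \<Rightarrow> real"
  assumes S: "C_k_on 2 S f" and h: "0 < h"
    and sq: "\<And>s t. 0 \<le> s \<Longrightarrow> s \<le> h \<Longrightarrow> 0 \<le> t \<Longrightarrow> t \<le> h \<Longrightarrow> x + s *\<^sub>R v + t *\<^sub>R w \<in> S"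
  shows "\<exists>s\<in>{0..h}. \<exists>t\<in>{0..h}. f (x + h *\<^sub>R v + h *\<^sub>R w) - f (x + h *\<^sub>R v) - f (x + h *\<^sub>R w) + f x
    = h^2 * frechet_derivative (\<lambda>y. frechet_derivative f (at y) v) (at (x + s *\<^sub>R v + t *\<^sub>R w)) w"
proof -
  let ?D = "\<lambda>y. frechet_derivative f (at y)"
  have df: "f differentiable (at y)" "(\<lambda>y. ?D y v) differentiable (at y)" if "y \<in> S" for y
    using S that by (auto simp: numeral_2_eq_2)
  define g where "g s = f (x + s *\<^sub>R v + h *\<^sub>R w) - f (x + s *\<^sub>R v + 0 *\<^sub>R w)" for s
  have line: "((\<lambda>s. f (x + s *\<^sub>R v + t *\<^sub>R w)) has_real_derivative ?D (x + s *\<^sub>R v + t *\<^sub>R w) v) (at s)"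
    if "0 \<le> s" "s \<le> h" "0 \<le> t" "t \<le> h" for s t
  proof -
    have "((\<lambda>s. f (x + s *\<^sub>R v + t *\<^sub>R w)) has_derivative (\<lambda>r. ?D (x + s *\<^sub>R v + t *\<^sub>R w) (r *\<^sub>R v))) (at s)"
      by (rule has_derivative_compose[where f="\<lambda>s. x + s *\<^sub>R v + t *\<^sub>R w", OF _ has_derivative_frechet[OF df(1)[OF sq[OF that]]]])
        (auto intro!: derivative_eq_intros)
    moreover have "?D (x + s *\<^sub>R v + t *\<^sub>R w) (r *\<^sub>R v) = ?D (x + s *\<^sub>R v + t *\<^sub>R w) v * r" for r
      using linear_scale[OF linear_frechet[OF df(1)[OF sq[OF that]]]] by simp
    ultimately show ?thesis by (simp add: has_field_derivative_def)
  qed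
  have "\<exists>s. 0 < s \<and> s < h \<and> g h - g 0 = (h - 0) * (?D (x + s *\<^sub>R v + h *\<^sub>R w) v - ?D (x + s *\<^sub>R v + 0 *\<^sub>R w) v)"
    unfolding g_def using h by (intro MVT2 DERIV_diff line) auto
  then obtain s where s: "0 < s" "s < h"
    "g h - g 0 = h * (?D (x + s *\<^sub>R v + h *\<^sub>R w) v - ?D (x + s *\<^sub>R v + 0 *\<^sub>R w) v)" by auto
  let ?E = "\<lambda>y. frechet_derivative (\<lambda>y. ?D y v) (at y)"
  have line2: "((\<lambda>t. ?D (x + s *\<^sub>R v + t *\<^sub>R w) v) has_real_derivative ?E (x + s *\<^sub>R v + t *\<^sub>R w) w) (at t)"
    if "0 \<le> t" "t \<le> h" for t
  proof -
    have i: "x + s *\<^sub>R v + t *\<^sub>R w \<in> S" using sq that s by auto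
    have "((\<lambda>t. ?D (x + s *\<^sub>R v + t *\<^sub>R w) v) has_derivative (\<lambda>r. ?E (x + s *\<^sub>R v + t *\<^sub>R w) (r *\<^sub>R w))) (at t)"
      by (rule has_derivative_compose[where f="\<lambda>t. x + s *\<^sub>R v + t *\<^sub>R w", OF _ has_derivative_frechet[OF df(2)[OF i]]])
        (auto intro!: derivative_eq_intros)
    moreover have "?E (x + s *\<^sub>R v + t *\<^sub>R w) (r *\<^sub>R w) = ?E (x + s *\<^sub>R v + t *\<^sub>R w) w * r" for r
      using linear_scale[OF linear_frechet[OF df(2)[OF i]]] by simp
    ultimately show ?thesis by (simp add: has_field_derivative_def)
  qed
  have "\<exists>t. 0 < t \<and> t < h \<and> ?D (x + s *\<^sub>R v + h *\<^sub>R w) v - ?D (x + s *\<^sub>R v + 0 *\<^sub>R w) v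
     = (h - 0) * ?E (x + s *\<^sub>R v + t *\<^sub>R w) w"
    using h by (intro MVT2 line2) auto
  then obtain t where t: "0 < t" "t < h" "?D (x + s *\<^sub>R v + h *\<^sub>R w) v - ?D (x + s *\<^sub>R v + 0 *\<^sub>R w) v
     = h * ?E (x + s *\<^sub>R v + t *\<^sub>R w) w" by auto
  have "f (x + h *\<^sub>R v + h *\<^sub>R w) - f (x + h *\<^sub>R v) - f (x + h *\<^sub>R w) + f x
     = h\<^sup>2 * ?E (x + s *\<^sub>R v + t *\<^sub>R w) w"
    using s(3) t(3) unfolding g_def by (simp add: power2_eq_square algebra_simps)
  then show ?thesis using s t by (intro bexI[of _ s] bexI[of _ t]) auto
qed

text \<open>Both mixed derivatives are values of the same second difference quotient up to an arbitrarily small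
  error, since they are continuous.\<close>

lemma second_derivative_symmetric_real:
  fixes f :: "'a::euclidean_space \<Rightarrow> real"
  assumes "open S" and S: "C_k_on 2 S f" and x: "x \<in> S"
  shows "frechet_derivative (\<lambda>y. frechet_derivative f (at y) v) (at x) w =
    frechet_derivative (\<lambda>y. frechet_derivative f (at y) w) (at x) v"
proof (rule ccontr)
  let ?E = "\<lambda>v w y. frechet_derivative (\<lambda>y. frechet_derivative f (at y) v) (at y) w"
  assume ne: "?E v w x \<noteq> ?E w v x"
  define e where "e = \<bar>?E v w x - ?E w v x\<bar> / 2"
  have e: "0 < e" using ne by (simp add: e_def)
  have cont: "continuous_on S (?E v w)" for v w
    using S by (auto simp: numeral_2_eq_2)
  have "\<exists>d>0. ball x d \<subseteq> S \<and> (\<forall>y\<in>ball x d. \<bar>?E v w y - ?E v w x\<bar> < e)" for v w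
  proof -
    have "\<exists>d>0. \<forall>y\<in>S. dist y x < d \<longrightarrow> dist (?E v w y) (?E v w x) < e"
      using cont[of v w] x e unfolding continuous_on_iff by blast
    then obtain d where "d > 0" "\<forall>y\<in>S. dist y x < d \<longrightarrow> dist (?E v w y) (?E v w x) < e" by blast
    moreover obtain d' where "d' > 0" "ball x d' \<subseteq> S" using \<open>open S\<close> x open_contains_ball by blast
    ultimately show ?thesis
      by (intro exI[of _ "min d d'"]) (auto simp: subset_iff dist_commute dist_real_def)
  qed
  then obtain d1 d2 where d: "d1 > 0" "ball x d1 \<subseteq> S" "\<And>y. y \<in> ball x d1 \<Longrightarrow> \<bar>?E v w y - ?E v w x\<bar> < e"
      "d2 > 0" "ball x d2 \<subseteq> S" "\<And>y. y \<in> ball x d2 \<Longrightarrow> \<bar>?E w v y - ?E w v x\<bar> < e" by metis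
  define h where "h = min d1 d2 / (norm v + norm w + 1) / 2"
  have h: "0 < h" using d by (simp add: h_def add_nonneg_pos)
  have h2: "h * (norm v + norm w) < min d1 d2"
  proof -
    have "h * (norm v + norm w) \<le> h * (norm v + norm w + 1)" using h by simp
    also have "\<dots> = min d1 d2 / 2" unfolding h_def
      by (smt (verit, best) norm_ge_zero nonzero_eq_divide_eq divide_divide_eq_left mult.commute)
    also have "\<dots> < min d1 d2" using d by auto
    finally show ?thesis .
  qed
  have sq: "x + s *\<^sub>R a + t *\<^sub>R b \<in> ball x d1 \<inter> ball x d2"
    if "0 \<le> s" "s \<le> h" "0 \<le> t" "t \<le> h" "{a,b} = {v,w}" for s t a b
  proof -
    have "norm (s *\<^sub>R a + t *\<^sub>R b) \<le> s * norm a + t * norm b"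
      using that norm_triangle_ineq[of "s *\<^sub>R a" "t *\<^sub>R b"] by simp
    also have "\<dots> \<le> h * norm a + h * norm b"
      using that by (intro add_mono mult_right_mono) auto
    also have "\<dots> = h * (norm v + norm w)" using that(5) by (auto simp: doubleton_eq_iff algebra_simps)
    finally have "norm (s *\<^sub>R a + t *\<^sub>R b) < min d1 d2" using h2 by simp
    moreover have "dist x (x + s *\<^sub>R a + t *\<^sub>R b) = norm (s *\<^sub>R a + t *\<^sub>R b)"
      by (simp add: dist_norm norm_minus_commute algebra_simps)
    ultimately show ?thesis by simp
  qed
  obtain s t where 1: "s \<in> {0..h}" "t \<in> {0..h}" "f (x + h *\<^sub>R v + h *\<^sub>R w) - f (x + h *\<^sub>R v) - f (x + h *\<^sub>R w) + f x
    = h^2 * ?E v w (x + s *\<^sub>R v + t *\<^sub>R w)"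
  proof -
    have "x + s *\<^sub>R v + t *\<^sub>R w \<in> S" if "0 \<le> s" "s \<le> h" "0 \<le> t" "t \<le> h" for s t
      using sq[OF that, of v w] d(2) by auto
    from mixed_difference_real[OF S h this] that show ?thesis by blast
  qed
  obtain s' t' where 2: "s' \<in> {0..h}" "t' \<in> {0..h}" "f (x + h *\<^sub>R w + h *\<^sub>R v) - f (x + h *\<^sub>R w) - f (x + h *\<^sub>R v) + f x
    = h^2 * ?E w v (x + s' *\<^sub>R w + t' *\<^sub>R v)"
  proof -
    have "x + s *\<^sub>R w + t *\<^sub>R v \<in> S" if "0 \<le> s" "s \<le> h" "0 \<le> t" "t \<le> h" for s t
      using sq[OF that, of w v] d(2) by (auto simp: insert_commute)
    from mixed_difference_real[OF S h this] that show ?thesis by blast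
  qed
  have "f (x + h *\<^sub>R w + h *\<^sub>R v) - f (x + h *\<^sub>R w) - f (x + h *\<^sub>R v) + f x =
     f (x + h *\<^sub>R v + h *\<^sub>R w) - f (x + h *\<^sub>R v) - f (x + h *\<^sub>R w) + f x" by (simp add: algebra_simps)
  then have "h^2 * ?E v w (x + s *\<^sub>R v + t *\<^sub>R w) = h^2 * ?E w v (x + s' *\<^sub>R w + t' *\<^sub>R v)"
    using 1(3) 2(3) by linarith
  then have "?E v w (x + s *\<^sub>R v + t *\<^sub>R w) = ?E w v (x + s' *\<^sub>R w + t' *\<^sub>R v)" using h by simp
  moreover have "\<bar>?E v w (x + s *\<^sub>R v + t *\<^sub>R w) - ?E v w x\<bar> < e" using d(3) sq 1 by auto
  moreover have "\<bar>?E w v (x + s' *\<^sub>R w + t' *\<^sub>R v) - ?E w v x\<bar> < e"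
    using d(6) sq[of s' t' w v] 2 by (auto simp: insert_commute)
  moreover have False if "a = b" "\<bar>a - p\<bar> < e" "\<bar>b - q\<bar> < e" "e = \<bar>p - q\<bar> / 2" for a b p q :: real
    using that abs_triangle_ineq4[of "a - q" "a - p"] by simp
  ultimately show False using e_def by blast
qed

lemma C_k_on_inner_right:
  fixes f :: "'a::euclidean_space \<Rightarrow> 'b::euclidean_space"
  assumes "open S" "C_k_on k S f"
  shows "C_k_on k S (\<lambda>y. f y \<bullet> n)"
  using C_k_on_bounded_linear[OF bounded_linear_inner_left assms] .

lemma frechet_derivative_inner_right:
  fixes f :: "'a::euclidean_space \<Rightarrow> 'b::euclidean_space"
  assumes "f differentiable (at x)"
  shows "frechet_derivative (\<lambda>y. f y \<bullet> n) (at x) v = frechet_derivative f (at x) v \<bullet> n"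
  using frechet_derivative_eqI[OF has_derivative_inner_left[OF has_derivative_frechet[OF assms], of n]]
  by simp

lemma second_derivative_inner_right:
  fixes f :: "'a::euclidean_space \<Rightarrow> 'b::euclidean_space"
  assumes "open S" and S: "C_k_on 2 S f" and x: "x \<in> S"
  shows "frechet_derivative (\<lambda>y. frechet_derivative (\<lambda>y. f y \<bullet> n) (at y) v) (at x) w
      = frechet_derivative (\<lambda>y. frechet_derivative f (at y) v) (at x) w \<bullet> n"
proof -
  have d: "f differentiable (at y)" "(\<lambda>y. frechet_derivative f (at y) v) differentiable (at y)" if "y \<in> S" for y
    using S that by (auto simp: numeral_2_eq_2)
  have "((\<lambda>y. frechet_derivative (\<lambda>y. f y \<bullet> n) (at y) v) has_derivative
      (\<lambda>w. frechet_derivative (\<lambda>y. frechet_derivative f (at y) v) (at x) w \<bullet> n)) (at x)"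
    by (rule has_derivative_transform_within_open[OF
          has_derivative_inner_left[OF has_derivative_frechet[OF d(2)[OF x]]] \<open>open S\<close> x])
      (simp add: frechet_derivative_inner_right d)
  from frechet_derivative_eqI[OF this] show ?thesis by simp
qed

theorem second_derivative_symmetric:
  fixes f :: "'a::euclidean_space \<Rightarrow> 'b::euclidean_space"
  assumes "open S" and S: "C_k_on 2 S f" and x: "x \<in> S"
  shows "frechet_derivative (\<lambda>y. frechet_derivative f (at y) v) (at x) w =
    frechet_derivative (\<lambda>y. frechet_derivative f (at y) w) (at x) v"
proof (rule euclidean_eqI)
  fix b :: 'b
  show "frechet_derivative (\<lambda>y. frechet_derivative f (at y) v) (at x) w \<bullet> b =
    frechet_derivative (\<lambda>y. frechet_derivative f (at y) w) (at x) v \<bullet> b"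
    using second_derivative_symmetric_real[OF \<open>open S\<close> C_k_on_inner_right[OF \<open>open S\<close> S] x, of b v w]
    by (simp add: second_derivative_inner_right[OF assms])
qed


section \<open>Hausdorff measure and coverings\<close>

lemma ennreal_zero_if_le:
  fixes x :: ennreal
  assumes "\<And>e::real. 0 < e \<Longrightarrow> x \<le> ennreal e"
  shows "x = 0"
proof -
  have "x \<le> 0"
    by (rule ennreal_le_epsilon) (use assms in simp)
  then show ?thesis by simp
qed

text \<open>A grid of \<open>N\<close> cubes to each side has \<open>N ^ n\<close> members of diameter about \<open>1 / N\<close>. The lemma shows
  that the infimum defining the Hausdorff dimension is taken over a nonempty set.\<close>

lemma hausdorff_measure_bounded_eq_0:
  fixes S :: "'a::euclidean_space set"
  assumes "bounded S"
  shows "hausdorff_measure (real DIM('a) + 1) S = 0"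
proof -
  let ?m = "DIM('a)"
  obtain R where R: "R > 0" "\<And>x. x \<in> S \<Longrightarrow> norm x \<le> R" using assms bounded_pos by metis
  have pre: "hausdorff_premeasure \<delta> (real ?m + 1) S \<le> ennreal e" if "\<delta> > 0" "e > 0" for \<delta> e :: real
  proof -
    define c where "c = 2 * R * ?m"
    have c: "c > 0" using R by (simp add: c_def)
    define N where "N = nat \<lceil>max (c / \<delta>) (c ^ (?m + 1) / e)\<rceil>"
    have N1: "c / \<delta> \<le> N" "c ^ (?m + 1) / e \<le> N" unfolding N_def by linarith+
    have N: "N > 0" using N1(1) c that by (metis divide_pos_pos gr0I not_le of_nat_0)
    have cN: "c / N \<le> \<delta>" "c ^ (?m+1) / N \<le> e"
      using N1 N that by (simp_all add: field_simps)
    define I where "I = (Basis :: 'a set) \<rightarrow>\<^sub>E {0..<N}"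
    have finI: "finite I" and cardI: "card I = N ^ ?m"
      unfolding I_def by (auto simp: finite_PiE card_PiE)
    define Q where "Q f = {y::'a. \<forall>b\<in>Basis. -R + 2*R*real (f b)/N \<le> y \<bullet> b \<and> y \<bullet> b \<le> -R + 2*R*(real (f b) + 1)/N}"
      for f :: "'a \<Rightarrow> nat"
    have bd: "norm (x - y) \<le> c / N" if "x \<in> Q f" "y \<in> Q f" for x y f
    proof -
      have "norm (x - y) \<le> (\<Sum>b\<in>Basis. \<bar>(x - y) \<bullet> b\<bar>)" by (rule norm_le_l1)
      also have "\<dots> \<le> (\<Sum>b\<in>(Basis::'a set). 2*R/N)"
      proof (rule sum_mono)
        fix b :: 'a assume b: "b \<in> Basis"
        have "2*R*(real (f b) + 1)/N = 2*R*real (f b)/N + 2*R/N" by (simp add: add_divide_distrib distrib_left)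
        then show "\<bar>(x - y) \<bullet> b\<bar> \<le> 2*R/N"
          using that b unfolding Q_def inner_diff_left by (auto simp: abs_le_iff) force+
      qed
      also have "\<dots> = c / N" by (simp add: c_def)
      finally show ?thesis .
    qed
    have bQ: "bounded (Q f)" "diameter (Q f) \<le> c / N" for f
    proof -
      show "diameter (Q f) \<le> c / N" using c N bd by (intro diameter_le) auto
      show "bounded (Q f)"
      proof (cases "Q f = {}")
        case False
        then obtain z where "z \<in> Q f" by blast
        then show ?thesis using bd unfolding bounded_def dist_norm by blast
      qed auto
    qed
    have cov: "S \<subseteq> (\<Union>f\<in>I. Q f)"
    proof
      fix x assume x: "x \<in> S"
      define g where "g b = min (N - 1) (nat \<lfloor>(x \<bullet> b + R) * N / (2*R)\<rfloor>)" for b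
      have "restrict g Basis \<in> I" using N unfolding I_def g_def by auto
      moreover have "x \<in> Q (restrict g Basis)"
        unfolding Q_def
      proof (intro CollectI ballI)
        fix b :: 'a assume b: "b \<in> Basis"
        have xb: "- R \<le> x \<bullet> b" "x \<bullet> b \<le> R"
          using R(2)[OF x] Basis_le_norm[OF b, of x] by linarith+
        let ?q = "(x \<bullet> b + R) * N / (2*R)"
        have q: "0 \<le> ?q" "?q \<le> N"
        proof -
          show "0 \<le> ?q" using xb R by simp
          have "(x \<bullet> b + R) * N \<le> 2 * R * N" using xb N by (intro mult_right_mono) auto
          then show "?q \<le> N" using R by (simp add: field_simps)
        qed
        have xq: "x \<bullet> b = -R + 2*R* ?q / N" using R N by (simp add: field_simps)
        have "real (g b) \<le> ?q" "?q \<le> real (g b) + 1"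
          using q N unfolding g_def by (auto simp: min_def of_nat_diff) linarith+
        then have "2*R* real (g b)/N \<le> 2*R* ?q/N" "2*R* ?q/N \<le> 2*R* (real (g b)+1)/N"
          using R N by (intro divide_right_mono mult_left_mono; simp)+
        then show "-R + 2*R*real (restrict g Basis b)/N \<le> x \<bullet> b \<and>
            x \<bullet> b \<le> -R + 2*R*(real (restrict g Basis b) + 1)/N"
          using xq b by simp
      qed
      ultimately show "x \<in> (\<Union>f\<in>I. Q f)" by blast
    qed
    obtain h where h: "bij_betw h {0..<N ^ ?m} I"
      using ex_bij_betw_nat_finite[OF finI] cardI by auto
    define U where "U i = (if i < N ^ ?m then Q (h i) else {})" for i
    have SU: "S \<subseteq> (\<Union>i. U i)"
    proof
      fix x assume "x \<in> S"
      then obtain f where f: "f \<in> I" "x \<in> Q f" using cov by blast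
      then obtain i where "i < N ^ ?m" "f = h i" using h by (auto simp: bij_betw_def)
      then show "x \<in> (\<Union>i. U i)" using f by (auto simp: U_def)
    qed
    have U: "U \<in> {U :: nat \<Rightarrow> 'a set. S \<subseteq> (\<Union>i. U i) \<and> (\<forall>i. bounded (U i) \<and> diameter (U i) \<le> \<delta>)}"
      using SU bQ cN(1) that by (auto simp: U_def intro: order_trans)
    have "(\<Sum>i. ennreal (hausdorff_weight (real ?m + 1) (U i)))
       = (\<Sum>i<N ^ ?m. ennreal (hausdorff_weight (real ?m + 1) (U i)))"
      by (rule suminf_finite) (auto simp: U_def hausdorff_weight_def)
    also have "\<dots> \<le> (\<Sum>i<N ^ ?m. ennreal ((c / N) ^ (?m + 1)))"
    proof (intro sum_mono ennreal_leI)
      fix i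
      have "diameter (U i) powr (real ?m + 1) \<le> (c / N) powr (real ?m + 1)"
        using bQ(2) c N by (intro powr_mono2) (auto simp: U_def diameter_ge_0 bQ(1))
      also have "\<dots> = (c / N) ^ (?m + 1)"
        using c N powr_realpow[of "c / N" "?m + 1"] by (simp add: add.commute)
      finally show "hausdorff_weight (real ?m + 1) (U i) \<le> (c / N) ^ (?m + 1)"
        using c N by (auto simp: hausdorff_weight_def)
    qed
    also have "\<dots> = ennreal (real (N ^ ?m) * (c / N) ^ (?m + 1))"
      using c N by (subst sum_ennreal) auto
    also have "real (N ^ ?m) * (c / N) ^ (?m + 1) = c ^ (?m+1) / N"
      using N by (simp add: power_divide field_simps)
    also have "ennreal (c ^ (?m+1) / N) \<le> ennreal e" using cN(2) by (rule ennreal_leI)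
    finally have "(\<Sum>i. ennreal (hausdorff_weight (real ?m + 1) (U i))) \<le> ennreal e" .
    with U show ?thesis unfolding hausdorff_premeasure_def by (intro INF_lower2[where i=U])
  qed
  have "hausdorff_premeasure \<delta> (real ?m + 1) S = 0" if "\<delta> > 0" for \<delta> :: real
    by (rule ennreal_zero_if_le) (use pre[OF that] in auto)
  then show ?thesis unfolding hausdorff_measure_def by simp
qed

lemma hausdorff_dim_lessD:
  fixes S :: "'a::euclidean_space set"
  assumes "bounded S" "hausdorff_dim S < r"
  obtains d where "0 \<le> d" "d < r" "hausdorff_measure d S = 0"
proof -
  have "{d. 0 \<le> d \<and> hausdorff_measure d S = 0} \<noteq> {}"
    using hausdorff_measure_bounded_eq_0[OF assms(1)] by (auto intro!: exI[of _ "real DIM('a) + 1"])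
  from cInf_lessD[OF this assms(2)[unfolded hausdorff_dim_def]] that show ?thesis by blast
qed

lemma hausdorff_dim_nonneg:
  fixes S :: "'a::euclidean_space set"
  assumes "bounded S"
  shows "0 \<le> hausdorff_dim S"
proof (rule ccontr)
  assume "\<not> 0 \<le> hausdorff_dim S"
  then show False using hausdorff_dim_lessD[OF assms, of 0] by force
qed

text \<open>The form in which a null set is used: balls with positive radii (rather than arbitrary, possibly
  degenerate, covering sets) whose \<open>m\<close>-th powers have arbitrarily small sum.\<close>

definition ball_null :: "nat \<Rightarrow> 'a::metric_space set \<Rightarrow> bool" where
  "ball_null m S \<longleftrightarrow> (\<forall>e>0. \<exists>c r. (\<forall>i::nat. 0 < r i \<and> r i \<le> 1) \<and> S \<subseteq> (\<Union>i. cball (c i) (r i)) \<and>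
     (\<forall>N. (\<Sum>i<N. r i ^ m) \<le> (e::real)))"

lemma sum_geometric_half_le: "(\<Sum>i<N. (1/2)^Suc i) \<le> (1::real)"
proof -
  have "(\<Sum>i<N. (1/2)^Suc i) = 1 - (1/2::real)^N" by (induction N) auto
  then show ?thesis by simp
qed

text \<open>Radii of covering balls have to be positive, so covering sets of diameter 0 are enlarged, at the cost
  of a geometric series. For \<open>d = 0\<close> the weights of nonempty sets are 1, and the comparison of the \<open>m\<close>-th
  power of the diameter with the weight still holds, as the diameters are at most 1.\<close>

lemma ball_null_if_hausdorff_null:
  fixes S :: "'a::metric_space set"
  assumes H: "hausdorff_measure d S = 0" and d: "0 \<le> d" "d \<le> real m" and m: "0 < m"
  shows "ball_null m S"
  unfolding ball_null_def
proof (intro allI impI)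
  fix e :: real assume e: "e > 0"
  have "hausdorff_premeasure 1 d S \<le> hausdorff_measure d S"
    unfolding hausdorff_measure_def by (rule SUP_upper) auto
  then have "hausdorff_premeasure 1 d S < ennreal (e/2)" using H e by simp
  then obtain U where U: "S \<subseteq> (\<Union>i::nat. U i)" "\<And>i. bounded (U i)" "\<And>i. diameter (U i) \<le> 1"
    "(\<Sum>i. ennreal (hausdorff_weight d (U i))) < ennreal (e/2)"
    unfolding hausdorff_premeasure_def by (auto simp: INF_less_iff)
  define \<eta> where "\<eta> i = min 1 (e/2) * (1/2)^Suc i" for i :: nat
  have \<eta>: "0 < \<eta> i" "\<eta> i \<le> 1" "\<eta> i \<le> (e/2) * (1/2)^Suc i" for i
  proof -
    show "0 < \<eta> i" using e by (simp add: \<eta>_def)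
    show "\<eta> i \<le> (e/2) * (1/2)^Suc i" unfolding \<eta>_def by (intro mult_right_mono) auto
    have "\<eta> i \<le> 1 * 1" unfolding \<eta>_def using e by (intro mult_mono power_le_one) auto
    then show "\<eta> i \<le> 1" by simp
  qed
  define r where "r i = max (diameter (U i)) (\<eta> i)" for i
  define c where "c i = (SOME x. x \<in> U i)" for i
  have r: "0 < r i" "r i \<le> 1" for i using \<eta> U(3) by (auto simp: r_def less_max_iff_disj)
  have "S \<subseteq> (\<Union>i. cball (c i) (r i))"
  proof
    fix x assume "x \<in> S"
    then obtain i where i: "x \<in> U i" using U(1) by blast
    then have "c i \<in> U i" unfolding c_def by (metis someI_ex)
    then have "dist (c i) x \<le> diameter (U i)" using i by (intro diameter_bounded_bound U(2))
    then show "x \<in> (\<Union>i. cball (c i) (r i))" by (auto simp: r_def intro!: exI[of _ i])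
  qed
  moreover have "(\<Sum>i<N. r i ^ m) \<le> e" for N
  proof -
    have w: "0 \<le> hausdorff_weight d (U i)" "diameter (U i) ^ m \<le> hausdorff_weight d (U i)" for i
    proof -
      show "0 \<le> hausdorff_weight d (U i)" by (simp add: hausdorff_weight_def)
      have D0: "0 \<le> diameter (U i)" using U(2) by (rule diameter_ge_0)
      consider "diameter (U i) = 0" | "diameter (U i) > 0" using D0 by linarith
      then show "diameter (U i) ^ m \<le> hausdorff_weight d (U i)"
      proof cases
        case 1
        then show ?thesis using m by (simp add: hausdorff_weight_def zero_power)
      next
        case 2
        then have "diameter (U i) ^ m = diameter (U i) powr real m" by (simp add: powr_realpow)
        also have "\<dots> \<le> diameter (U i) powr d" by (intro powr_mono') (use 2 U(3) d in auto)
        finally show ?thesis using 2 by (auto simp: hausdorff_weight_def power_le_one U(3))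
      qed
    qed
    have "ennreal (\<Sum>i<N. hausdorff_weight d (U i)) = (\<Sum>i<N. ennreal (hausdorff_weight d (U i)))"
      using w by (simp add: sum_ennreal)
    also have "\<dots> \<le> (\<Sum>i. ennreal (hausdorff_weight d (U i)))"
      by (rule sum_le_suminf) auto
    also have "\<dots> < ennreal (e/2)" by (rule U(4))
    finally have s1: "(\<Sum>i<N. hausdorff_weight d (U i)) \<le> e/2"
      using e w by (subst (asm) ennreal_less_iff) (auto intro: sum_nonneg)
    have "(\<Sum>i<N. r i ^ m) \<le> (\<Sum>i<N. hausdorff_weight d (U i) + (e/2) * (1/2)^Suc i)"
    proof (rule sum_mono)
      fix i
      have "\<eta> i ^ m \<le> \<eta> i ^ 1" using \<eta>[of i] m by (intro power_decreasing) auto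
      then have "\<eta> i ^ m \<le> (e/2) * (1/2)^Suc i" using \<eta>[of i] by simp
      moreover have "0 \<le> (e/2) * (1/2)^Suc i" using e by simp
      ultimately show "r i ^ m \<le> hausdorff_weight d (U i) + (e/2) * (1/2)^Suc i"
        using w[of i] by (cases "diameter (U i) \<le> \<eta> i") (auto simp: r_def max_def)
    qed
    also have "\<dots> = (\<Sum>i<N. hausdorff_weight d (U i)) + (e/2) * (\<Sum>i<N. (1/2)^Suc i)"
      by (simp add: sum.distrib sum_distrib_left)
    also have "\<dots> \<le> e/2 + (e/2) * 1"
      using s1 e sum_geometric_half_le[of N] by (intro add_mono mult_left_mono) auto
    finally show ?thesis by simp
  qed
  ultimately show "\<exists>c r. (\<forall>i::nat. 0 < r i \<and> r i \<le> 1) \<and> S \<subseteq> (\<Union>i. cball (c i) (r i)) \<and>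
     (\<forall>N. (\<Sum>i<N. r i ^ m) \<le> e)" using r by blast
qed

lemma ball_null_isometry:
  fixes f :: "'a::metric_space \<Rightarrow> 'b::metric_space"
  assumes "ball_null m S" "\<And>x y. dist (f x) (f y) = dist x y"
  shows "ball_null m (f ` S)"
  unfolding ball_null_def
proof (intro allI impI)
  fix e :: real assume "e > 0"
  then obtain c r where cr: "\<forall>i::nat. 0 < r i \<and> r i \<le> 1" "S \<subseteq> (\<Union>i. cball (c i) (r i))"
     "\<forall>N. (\<Sum>i<N. r i ^ m) \<le> e" using assms(1) unfolding ball_null_def by meson
  have "f ` S \<subseteq> (\<Union>i. cball (f (c i)) (r i))"
    using cr(2) assms(2) by fastforce
  then show "\<exists>c r. (\<forall>i::nat. 0 < r i \<and> r i \<le> 1) \<and> f ` S \<subseteq> (\<Union>i. cball (c i) (r i)) \<and>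
     (\<forall>N. (\<Sum>i<N. r i ^ m) \<le> e)" using cr by (intro exI[of _ "f \<circ> c"] exI[of _ r]) auto
qed


section \<open>Cylinders over null sets\<close>

text \<open>The cylinder over a set that is null for the \<open>m\<close>-th powers, in \<open>m + 1\<close> of the coordinates, is still
  Lebesgue-null after it is swept out along a direction: a ball of radius \<open>r\<close> sweeps out a tube
  that is covered by about \<open>1 / r\<close> boxes of volume of the order \<open>r ^ (m + 1)\<close>.\<close>

lemma negligible_swept_cylinder:
  fixes \<tau> :: "'b::metric_space \<Rightarrow> real^'n" and w :: "real^'n"
  assumes S: "ball_null m S" and J: "card J = Suc m"
    and lip: "\<And>s s' j. \<bar>\<tau> s $ j - \<tau> s' $ j\<bar> \<le> \<Lambda> * dist s s'"
    and R: "0 < R"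
  shows "negligible {y. (\<forall>i. \<bar>y $ i\<bar> \<le> R) \<and> (\<exists>s\<in>S. \<exists>t\<in>{-1..1}. \<forall>j\<in>J. y $ j = \<tau> s $ j + t * w $ j)}"
    (is "negligible ?Z")
  unfolding negligible_outer_le
proof (intro allI impI)
  fix e :: real assume e: "e > 0"
  define K where "K = \<bar>\<Lambda>\<bar> + norm w + 1"
  have K: "K > 0" unfolding K_def by (smt (verit) norm_ge_zero)
  define C where "C = 3 * (2 * K) ^ Suc m * (2 * R) ^ (CARD('n) - Suc m)"
  have C: "C > 0" using K R by (simp add: C_def)
  obtain c r where r: "\<And>i::nat. 0 < r i" "\<And>i. r i \<le> 1" and cov: "S \<subseteq> (\<Union>i. cball (c i) (r i))"
    and sum: "\<And>N. (\<Sum>i<N. r i ^ m) \<le> e / C"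
    using S e C unfolding ball_null_def by (metis divide_pos_pos)
  \<comment> \<open>the boxes for the \<open>i\<close>-th ball: the direction \<open>w\<close> is sampled at the parameters \<open>- 1 + p r\<^sub>i\<close>\<close>
  define lo where "lo i p = (\<chi> j. if j \<in> J then \<tau> (c i) $ j + (-1 + real p * r i) * w $ j - K * r i else - R)"
    for i and p :: nat
  define hi where "hi i p = (\<chi> j. if j \<in> J then \<tau> (c i) $ j + (-1 + real p * r i) * w $ j + K * r i else R)"
    for i and p :: nat
  define M where "M i = nat \<lfloor>2 / r i\<rfloor>" for i
  define W where "W i = (\<Union>p\<le>M i. cbox (lo i p) (hi i p))" for i
  have Wm: "W i \<in> lmeasurable" for i unfolding W_def by (intro fmeasurable.finite_UN) auto
  have vol: "measure lebesgue (cbox (lo i p) (hi i p)) = (2 * K * r i) ^ Suc m * (2 * R) ^ (CARD('n) - Suc m)" for i p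
  proof -
    have "lo i p $ j \<le> hi i p $ j" for j
      using K R r(1)[of i] by (simp add: lo_def hi_def)
    then have "cbox (lo i p) (hi i p) \<noteq> {}" by (simp add: interval_ne_empty_cart)
    then have "measure lborel (cbox (lo i p) (hi i p)) = (\<Prod>j\<in>UNIV. hi i p $ j - lo i p $ j)"
      by (rule content_cbox_cart)
    also have "\<dots> = (\<Prod>j\<in>UNIV. if j \<in> J then 2 * K * r i else 2 * R)"
      by (intro prod.cong) (auto simp: lo_def hi_def)
    also have "\<dots> = (\<Prod>j\<in>J. 2 * K * r i) * (\<Prod>j\<in>-J. 2 * R)"
      by (subst prod.If_cases) (auto simp: Compl_eq)
    also have "\<dots> = (2 * K * r i) ^ Suc m * (2 * R) ^ (CARD('n) - Suc m)"
      by (simp add: J Compl_eq_Diff_UNIV card_Diff_subset)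
    finally show ?thesis by simp
  qed
  have mW: "measure lebesgue (W i) \<le> C * r i ^ m" for i
  proof -
    have "measure lebesgue (W i) \<le> (\<Sum>p\<le>M i. measure lebesgue (cbox (lo i p) (hi i p)))"
      unfolding W_def by (rule measure_UNION_le) auto
    also have "\<dots> = (M i + 1) * ((2 * K * r i) ^ Suc m * (2 * R) ^ (CARD('n) - Suc m))"
      by (simp only: vol) simp
    also have "\<dots> \<le> (3 / r i) * ((2 * K * r i) ^ Suc m * (2 * R) ^ (CARD('n) - Suc m))"
    proof (rule mult_right_mono)
      have "0 \<le> 2 / r i" using r(1)[of i] by simp
      then have "real (M i) \<le> 2 / r i" unfolding M_def by linarith
      moreover have "1 \<le> 1 / r i" using r[of i] by simp
      moreover have "3 / r i = 2 / r i + 1 / r i" by (simp add: add_divide_distrib[symmetric])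
      ultimately show "real (M i + 1) \<le> 3 / r i" by simp
    qed (use K R r[of i] in simp)
    also have "\<dots> = C * r i ^ m" unfolding C_def using r(1)[of i]
      by (simp add: power_mult_distrib field_simps)
    finally show ?thesis .
  qed
  have mU: "measure lebesgue (\<Union>i\<le>N. W i) \<le> e" for N
  proof -
    have "measure lebesgue (\<Union>i\<le>N. W i) \<le> (\<Sum>i\<le>N. measure lebesgue (W i))"
      by (rule measure_UNION_le) (use Wm in auto)
    also have "\<dots> \<le> (\<Sum>i\<le>N. C * r i ^ m)" by (rule sum_mono) (rule mW)
    also have "\<dots> = C * (\<Sum>i<Suc N. r i ^ m)" by (simp add: sum_distrib_left lessThan_Suc_atMost)
    also have "\<dots> \<le> C * (e / C)" using C sum[of "Suc N"] by (intro mult_left_mono) (auto simp del: sum.lessThan_Suc)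
    finally show ?thesis using C by simp
  qed
  have "?Z \<subseteq> (\<Union>i. W i)"
  proof clarify
    fix y :: "real^'n" and s t
    assume y: "\<forall>i. \<bar>y $ i\<bar> \<le> R" and s: "s \<in> S" and t: "t \<in> {-1..1}"
      and yj: "\<forall>j\<in>J. y $ j = \<tau> s $ j + t * w $ j"
    obtain i where i: "dist (c i) s \<le> r i" using cov s by auto
    define p where "p = nat \<lfloor>(t + 1) / r i\<rfloor>"
    have t0: "0 \<le> (t + 1) / r i" using t r(1)[of i] by simp
    have p: "real p \<le> (t + 1) / r i" "(t + 1) / r i \<le> real p + 1"
      unfolding p_def using t0 by linarith+
    have "(t + 1) / r i \<le> 2 / r i" using t r(1)[of i] by (intro divide_right_mono) auto
    then have pM: "p \<le> M i" unfolding p_def M_def by (intro nat_mono floor_mono)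
    have tp: "\<bar>t - (-1 + real p * r i)\<bar> \<le> r i"
      using p r(1)[of i] by (simp add: field_simps abs_le_iff)
    have "lo i p $ j \<le> y $ j \<and> y $ j \<le> hi i p $ j" for j
    proof (cases "j \<in> J")
      case True
      have "\<bar>\<tau> s $ j - \<tau> (c i) $ j\<bar> \<le> \<bar>\<Lambda>\<bar> * r i"
      proof -
        have "\<bar>\<tau> s $ j - \<tau> (c i) $ j\<bar> \<le> \<Lambda> * dist s (c i)" by (rule lip)
        also have "\<dots> \<le> \<bar>\<Lambda>\<bar> * dist s (c i)" by (intro mult_right_mono) auto
        also have "\<dots> \<le> \<bar>\<Lambda>\<bar> * r i" using i by (intro mult_left_mono) (auto simp: dist_commute)
        finally show ?thesis .
      qed
      moreover have "\<bar>(t - (-1 + real p * r i)) * w $ j\<bar> \<le> r i * norm w"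
        unfolding abs_mult using tp component_le_norm_cart[of w j] r(1)[of i] by (intro mult_mono) auto
      moreover have "y $ j - (\<tau> (c i) $ j + (-1 + real p * r i) * w $ j)
        = (\<tau> s $ j - \<tau> (c i) $ j) + (t - (-1 + real p * r i)) * w $ j"
        using yj True by (simp add: algebra_simps)
      moreover have "K * r i = \<bar>\<Lambda>\<bar> * r i + r i * norm w + r i" by (simp add: K_def algebra_simps)
      ultimately have "\<bar>y $ j - (\<tau> (c i) $ j + (-1 + real p * r i) * w $ j)\<bar> \<le> K * r i"
        using r(1)[of i] by linarith
      then show ?thesis using True by (simp add: lo_def hi_def abs_le_iff)
    next
      case False
      then show ?thesis using y by (simp add: lo_def hi_def abs_le_iff) (smt (verit))
    qed
    then have "y \<in> cbox (lo i p) (hi i p)" by (simp add: mem_box_cart)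
    then show "y \<in> (\<Union>i. W i)" using pM unfolding W_def by blast
  qed
  moreover have "(\<Union>i. W i) \<in> lmeasurable" by (rule fmeasurable_countable_Union[OF Wm mU])
  moreover have "measure lebesgue (\<Union>i. W i) \<le> e" by (rule measure_countable_Union_le[OF Wm mU])
  ultimately show "\<exists>T. ?Z \<subseteq> T \<and> T \<in> lmeasurable \<and> measure lebesgue T \<le> e" by blast
qed

text \<open>A generic parallel translate of a segment avoids such a cylinder, because the translation
  vectors that fail form a null set.\<close>

lemma ball_minus_cylinder:
  fixes \<tau> :: "'b::metric_space \<Rightarrow> real^'n" and y0 :: "real^'n"
  assumes S: "ball_null m S" and J: "card J = Suc m"
    and lip: "\<And>s s' j. \<bar>\<tau> s $ j - \<tau> s' $ j\<bar> \<le> \<Lambda> * dist s s'"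
    and E: "E = {y. \<exists>s\<in>S. \<forall>j\<in>J. y $ j = \<tau> s $ j}" and cl: "closed E" and \<rho>: "0 < \<rho>"
  shows "connected (ball y0 \<rho> - E)" "ball y0 \<rho> \<subseteq> closure (ball y0 \<rho> - E)"
proof -
  have avoid: "\<exists>u\<in>ball a \<eta>. \<forall>t\<in>{0..1}. u + t *\<^sub>R w \<notin> E" if "\<eta> > 0" for a w \<eta>
  proof -
    define R where "R = norm a + \<eta>"
    have R: "R > 0" using that by (simp add: R_def add_nonneg_pos)
    let ?Z = "{y. (\<forall>i. \<bar>y $ i\<bar> \<le> R) \<and> (\<exists>s\<in>S. \<exists>t\<in>{-1..1}. \<forall>j\<in>J. y $ j = \<tau> s $ j + t * w $ j)}"
    have "negligible ?Z" by (rule negligible_swept_cylinder[OF S J lip R])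
    moreover have "\<not> negligible (ball a \<eta>)" using that by (intro open_not_negligible) auto
    ultimately obtain u where u: "u \<in> ball a \<eta>" "u \<notin> ?Z" by (meson negligible_subset subsetI)
    have "norm u \<le> R" using u(1) norm_triangle_ineq2[of u a]
      by (simp add: R_def dist_norm norm_minus_commute)
    then have "\<bar>u $ i\<bar> \<le> R" for i using component_le_norm_cart[of u i] by linarith
    then have no: "\<not> (\<exists>s\<in>S. \<exists>t\<in>{-1..1}. \<forall>j\<in>J. u $ j = \<tau> s $ j + t * w $ j)" using u(2) by blast
    have "u + t *\<^sub>R w \<notin> E" if t: "t \<in> {0..1}" for t
    proof
      assume "u + t *\<^sub>R w \<in> E"
      then obtain s where s: "s \<in> S" "\<forall>j\<in>J. u $ j + t * w $ j = \<tau> s $ j" unfolding E by auto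
      then have "\<forall>j\<in>J. u $ j = \<tau> s $ j + (-t) * w $ j" by (simp add: algebra_simps)
      moreover have "-t \<in> {-1..1}" using t by simp
      ultimately show False using no s(1) by blast
    qed
    then show ?thesis using u(1) by blast
  qed
  show "ball y0 \<rho> \<subseteq> closure (ball y0 \<rho> - E)"
  proof
    fix a assume a: "a \<in> ball y0 \<rho>"
    show "a \<in> closure (ball y0 \<rho> - E)"
      unfolding closure_approachable
    proof (intro allI impI)
      fix e :: real assume "e > 0"
      moreover obtain e' where "e' > 0" "ball a e' \<subseteq> ball y0 \<rho>" using a open_contains_ball by blast
      ultimately obtain u where "u \<in> ball a (min e e')" "\<forall>t\<in>{0..1}. u + t *\<^sub>R 0 \<notin> E"
        using avoid[of "min e e'" a 0] by auto
      then show "\<exists>y\<in>ball y0 \<rho> - E. dist y a < e"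
        using \<open>ball a e' \<subseteq> ball y0 \<rho>\<close> by (intro bexI[of _ u]) (auto simp: dist_commute)
    qed
  qed
  have op: "open (ball y0 \<rho> - E)" using cl by (simp add: open_Diff)
  show "connected (ball y0 \<rho> - E)"
    unfolding connected_iff_connected_component
  proof (intro ballI)
    fix a b assume a: "a \<in> ball y0 \<rho> - E" and b: "b \<in> ball y0 \<rho> - E"
    obtain e1 where e1: "e1 > 0" "ball a e1 \<subseteq> ball y0 \<rho> - E" using a op open_contains_ball by blast
    obtain e2 where e2: "e2 > 0" "ball b e2 \<subseteq> ball y0 \<rho> - E" using b op open_contains_ball by blast
    obtain u where u: "u \<in> ball a (min e1 e2)" "\<forall>t\<in>{0..1}. u + t *\<^sub>R (b - a) \<notin> E"
      using avoid[of "min e1 e2" a "b - a"] e1 e2 by auto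
    let ?v = "u + (b - a)"
    have v: "?v \<in> ball b e2" using u(1) by (simp add: dist_norm algebra_simps)
    have uv: "u \<in> ball y0 \<rho>" "?v \<in> ball y0 \<rho>" using u(1) v e1 e2 by auto
    have "closed_segment u ?v \<subseteq> ball y0 \<rho> - E"
    proof -
      have "closed_segment u ?v \<subseteq> ball y0 \<rho>" using uv by (simp add: closed_segment_subset)
      moreover have "z \<notin> E" if z: "z \<in> closed_segment u ?v" for z
      proof -
        obtain t where "0 \<le> t" "t \<le> 1" "z = (1 - t) *\<^sub>R u + t *\<^sub>R ?v"
          using z by (auto simp: in_segment)
        then have "z = u + t *\<^sub>R (b - a)" "t \<in> {0..1}" by (auto simp: algebra_simps)
        then show ?thesis using u(2) by simp
      qed
      ultimately show ?thesis by blast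
    qed
    then have "connected_component (ball y0 \<rho> - E) u ?v"
      unfolding connected_component_def by (intro exI[of _ "closed_segment u ?v"]) auto
    moreover have "connected_component (ball y0 \<rho> - E) a u"
      unfolding connected_component_def using e1 u by (intro exI[of _ "ball a e1"]) auto
    moreover have "connected_component (ball y0 \<rho> - E) ?v b"
      unfolding connected_component_def using e2 v by (intro exI[of _ "ball b e2"]) auto
    ultimately show "connected_component (ball y0 \<rho> - E) a b"
      by (meson connected_component_trans)
  qed
qed


section \<open>Local normal forms\<close>

text \<open>The inverse function theorem, with the image shrunk to a ball: connectedness arguments can then use the
  convexity of the image.\<close>

lemma C1_local_homeomorphism:
  fixes f :: "'a::euclidean_space \<Rightarrow> 'a"
  assumes "open U" "C_k_on 1 U f" "u0 \<in> U" "inj (frechet_derivative f (at u0))"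
  obtains V \<rho> g where "open V" "u0 \<in> V" "V \<subseteq> U" "0 < \<rho>" "homeomorphism V (ball (f u0) \<rho>) f g"
proof -
  have d: "f differentiable (at x)" if "x \<in> U" for x using assms(2) that by simp
  define f' where "f' x = Blinfun (frechet_derivative f (at x))" for x
  have f': "blinfun_apply (f' x) = frechet_derivative f (at x)" if "x \<in> U" for x
    unfolding f'_def using linear_frechet[OF d[OF that]]
    by (intro bounded_linear_Blinfun_apply) (simp add: linear_conv_bounded_linear)
  have "continuous_on U f'"
  proof (rule continuous_on_blinfun_componentwise)
    fix b :: 'a
    have "continuous_on U (\<lambda>x. frechet_derivative f (at x) b)" using assms(2) by simp
    then show "continuous_on U (\<lambda>x. blinfun_apply (f' x) b)" by (simp add: f' cong: continuous_on_cong)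
  qed
  moreover have "(f has_derivative blinfun_apply (f' x)) (at x)" if "x \<in> U" for x
    using f'[OF that] has_derivative_frechet[OF d[OF that]] by simp
  moreover obtain L where L: "linear L" "L \<circ> frechet_derivative f (at u0) = id"
    using linear_injective_left_inverse[OF linear_frechet[OF d[OF assms(3)]] assms(4)] by blast
  have "Blinfun L o\<^sub>L f' u0 = id_blinfun"
    using L f'[OF assms(3)]
    by (intro blinfun_eqI)
       (simp add: bounded_linear_Blinfun_apply linear_conv_bounded_linear o_def fun_eq_iff)
  ultimately obtain U' W g where UW: "open U'" "U' \<subseteq> U" "u0 \<in> U'" "open W" "f u0 \<in> W" "homeomorphism U' W f g"
    using inverse_function_theorem[OF \<open>open U\<close> _ _ \<open>u0 \<in> U\<close>] by metis
  obtain \<rho> where \<rho>: "0 < \<rho>" "ball (f u0) \<rho> \<subseteq> W" using UW(4,5) open_contains_ball by blast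
  define V where "V = g ` ball (f u0) \<rho>"
  have hom: "homeomorphism V (ball (f u0) \<rho>) f g"
    unfolding V_def using homeomorphism_of_subsets[OF homeomorphism_symD[OF UW(6)]] \<rho>(2)
    by (metis UW(6) homeomorphism_def homeomorphism_of_subsets homeomorphism_symD image_mono)
  have "openin (top_of_set W) (ball (f u0) \<rho>)" using \<rho> UW(4) by (simp add: open_subset)
  then have "openin (top_of_set U') V"
    unfolding V_def using homeomorphism_imp_open_map[OF homeomorphism_symD[OF UW(6)]] by blast
  then have "open V" "V \<subseteq> U" using UW by (auto simp: openin_open_eq)
  moreover have "u0 \<in> V"
    unfolding V_def using UW(3,6) \<rho>(1) by (metis centre_in_ball homeomorphism_def image_eqI)
  ultimately show ?thesis using that \<rho>(1) hom by blast
qed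

text \<open>If a linear map has rank at least \<open>k\<close>, then \<open>k\<close> coordinates of its values, completed by
  linear functions, give coordinates on the source.\<close>

lemma linear_rank_completion:
  fixes A :: "real^'n \<Rightarrow> real^'m"
  assumes A: "linear A" and k: "k \<le> dim (range A)"
  obtains J :: "'n set" and T :: "real^'m \<Rightarrow> real^'n" and Q :: "real^'n \<Rightarrow> real^'n"
  where "card J = k" "linear T" "linear Q" "\<And>y j. j \<notin> J \<Longrightarrow> T y $ j = 0" "\<And>u j. j \<in> J \<Longrightarrow> Q u $ j = 0"
    "inj (\<lambda>u. T (A u) + Q u)"
proof -
  obtain B where B: "B \<subseteq> range A" "independent B" "card B = dim (range A)"
    using basis_exists by metis
  obtain F where F: "F \<subseteq> B" "card F = k" using k B(3) by (metis obtain_subset_with_card_n)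
  have indF: "independent F" using F(1) B(2) independent_mono by blast
  have "\<forall>y\<in>F. \<exists>x. A x = y" using F(1) B(1) by auto
  then obtain g where g: "\<And>y. y \<in> F \<Longrightarrow> A (g y) = y" by metis
  define E where "E = g ` F"
  have AE: "A ` E = F" using g by (force simp: E_def image_image)
  have injAE: "inj_on A E" using g by (auto simp: E_def inj_on_def)
  have cE: "card E = k" using AE injAE F(2) card_image by metis
  have indE: "independent E"
  proof -
    have "finite E" using indF by (simp add: E_def finiteI_independent)
    moreover have "card E \<le> dim E"
    proof -
      have "card E = dim F" using cE F(2) dim_eq_card_independent[OF indF] by simp
      also have "\<dots> \<le> dim E" using dim_image_le[OF A, of E] by (simp add: AE)
      finally show ?thesis .
    qed
    ultimately show ?thesis by (intro card_le_dim_spanning[OF subset_refl span_superset])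
  qed
  obtain E' where E': "E \<subseteq> E'" "independent E'" "span E' = UNIV"
    using maximal_independent_subset_extend[OF subset_UNIV indE] by (metis top.extremum_uniqueI)
  have finE': "finite E'" using E'(2) finiteI_independent by blast
  have "card E' = CARD('n)" using E'(2,3) by (metis dim_UNIV dim_span dim_eq_card_independent DIM_cart DIM_real mult.right_neutral)
  then obtain \<beta> :: "real^'n \<Rightarrow> 'n" where \<beta>: "bij_betw \<beta> E' UNIV"
    using finE' by (metis finite_same_card_bij finite_class.finite_UNIV)
  have \<beta>i: "inj_on \<beta> E'" using \<beta> by (simp add: bij_betw_def)
  define J where "J = \<beta> ` E"
  have cJ: "card J = k" unfolding J_def using cE \<beta>i E'(1) by (metis card_image inj_on_subset)
  have spanJ: "v $ j = 0" if "v \<in> span ((\<lambda>i. axis i 1) ` I)" "j \<notin> I" for v :: "real^'n" and I j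
    using that(1)
  proof (induction rule: span_induct_alt)
    case (step c x y)
    then obtain i where "i \<in> I" "x = axis i 1" by blast
    then show ?case using that(2) step by (cases "i = j") (auto simp: axis_def)
  qed simp
  obtain T :: "real^'m \<Rightarrow> real^'n" where T: "linear T" "\<forall>y\<in>F. T y = axis (\<beta> (g y)) 1"
      "range T = span ((\<lambda>y. axis (\<beta> (g y)) 1) ` F)"
    using linear_independent_extend_subspace[OF indF, of "\<lambda>y. axis (\<beta> (g y)) (1::real)"]
    by (elim exE conjE) (rule that)
  have TJ: "T y $ j = 0" if "j \<notin> J" for y j
  proof -
    have "(\<lambda>y. axis (\<beta> (g y)) 1) ` F = (\<lambda>i. axis i (1::real)) ` J" by (auto simp: J_def E_def)
    then show ?thesis using spanJ[of "T y" J j] that T(3) by (metis rangeI)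
  qed
  define q where "q e = (if e \<in> E then 0 else axis (\<beta> e) (1::real))" for e
  obtain Q where Q: "linear Q" "\<forall>e\<in>E'. Q e = q e" "range Q = span (q ` E')"
    using linear_independent_extend_subspace[OF E'(2), of q]
    by (elim exE conjE) (rule that)
  have QJ: "Q u $ j = 0" if "j \<in> J" for u j
  proof -
    have "q ` E' \<subseteq> insert 0 ((\<lambda>i. axis i 1) ` (- J))"
    proof
      fix x assume "x \<in> q ` E'"
      then obtain e where e: "e \<in> E'" "x = q e" by blast
      show "x \<in> insert 0 ((\<lambda>i. axis i 1) ` (- J))"
      proof (cases "e \<in> E")
        case False
        then have "\<beta> e \<notin> J" using \<beta>i e(1) E'(1) unfolding J_def by (auto dest: inj_onD)
        then show ?thesis using e False by (auto simp: q_def)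
      qed (use e in \<open>simp add: q_def\<close>)
    qed
    then have "range Q \<subseteq> span ((\<lambda>i. axis i 1) ` (- J))"
      using Q(3) span_mono[of "q ` E'" "insert 0 ((\<lambda>i. axis i 1) ` (- J))"] by (simp add: span_insert_0)
    then have "Q u \<in> span ((\<lambda>i. axis i 1) ` (- J))" by blast
    then show ?thesis using spanJ[of "Q u" "- J" j] that by simp
  qed
  define \<Psi> where "\<Psi> u = T (A u) + Q u" for u
  have lin: "linear \<Psi>" unfolding \<Psi>_def
    by (rule linear_compose_add[OF linear_compose[OF A T(1), unfolded o_def] Q(1)])
  have ran: "subspace (range \<Psi>)" using linear_subspace_image[OF lin subspace_UNIV] .
  \<comment> \<open>the map is block triangular: it is onto the \<open>J\<close>-coordinates, and modulo these onto the others\<close>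
  have axJ: "axis j 1 \<in> range \<Psi>" if j: "j \<in> J" for j
  proof -
    obtain e where e: "e \<in> E" "j = \<beta> e" using j J_def by blast
    then obtain y where y: "y \<in> F" "e = g y" by (auto simp: E_def)
    have "\<Psi> e = axis j 1" using e y T(2) Q(2) E'(1) g by (auto simp: \<Psi>_def q_def)
    then show ?thesis by (metis rangeI)
  qed
  have TR: "T y \<in> range \<Psi>" for y
  proof -
    have "T y = (\<Sum>j\<in>UNIV. T y $ j *\<^sub>R axis j 1)"
      using basis_expansion[of "T y"] by (simp add: scalar_mult_eq_scaleR)
    also have "\<dots> \<in> range \<Psi>"
      using axJ TJ ran by (intro subspace_sum ran) (metis scale_zero_left subspace_0 subspace_scale)
    finally show ?thesis .
  qed
  have "axis j 1 \<in> range \<Psi>" for j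
  proof (cases "j \<in> J")
    case False
    obtain e where e: "e \<in> E'" "j = \<beta> e" using \<beta> by (metis UNIV_I bij_betw_imp_surj_on image_iff)
    then have "e \<notin> E" using False J_def by auto
    then have "axis j 1 = \<Psi> e - T (A e)" using e Q(2) by (simp add: \<Psi>_def q_def)
    then show ?thesis using subspace_diff[OF ran _ TR] by (metis rangeI)
  qed (rule axJ)
  then have "v \<in> range \<Psi>" for v
  proof -
    have "v = (\<Sum>j\<in>UNIV. v $ j *\<^sub>R axis j 1)"
      using basis_expansion[of v] by (simp add: scalar_mult_eq_scaleR)
    also have "\<dots> \<in> range \<Psi>"
      using \<open>\<And>j. axis j 1 \<in> range \<Psi>\<close> by (intro subspace_sum ran subspace_scale)
    finally show ?thesis .
  qed
  then have "inj \<Psi>" using linear_surjective_imp_injective[OF lin] by blast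
  then show ?thesis using that cJ T(1) Q(1) TJ QJ unfolding \<Psi>_def by blast
qed

text \<open>Near a point where \<open>N\<close> has rank greater than \<open>m\<close>, the preimage of a null set lies, in suitable
  coordinates, in a cylinder over a null set; so it is nowhere dense and does not separate.\<close>

lemma preimage_null_set_nonseparating:
  fixes N :: "real^'n \<Rightarrow> real^'m"
  assumes "open U" and N: "C_k_on 1 U N" and u0: "u0 \<in> U"
    and rk: "Suc m \<le> dim (range (frechet_derivative N (at u0)))"
    and S: "ball_null m S" "compact S"
  obtains V where "open V" "u0 \<in> V" "V \<subseteq> U" "connected (V - N -` S)" "V \<subseteq> closure (V - N -` S)"
proof -
  have d: "N differentiable (at u)" if "u \<in> U" for u using N that by simp
  let ?A = "frechet_derivative N (at u0)"
  obtain J :: "'n set" and T :: "real^'m \<Rightarrow> real^'n" and Q :: "real^'n \<Rightarrow> real^'n"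
    where J: "card J = Suc m" "linear T" "linear Q" "\<And>y j. j \<notin> J \<Longrightarrow> T y $ j = 0"
      "\<And>u j. j \<in> J \<Longrightarrow> Q u $ j = 0" "inj (\<lambda>u. T (?A u) + Q u)"
    by (rule linear_rank_completion[OF linear_frechet[OF d[OF u0]] rk]) (rule that; assumption)
  have bl: "bounded_linear T" "bounded_linear Q" using J by (simp_all add: linear_conv_bounded_linear)
  define \<Phi> where "\<Phi> u = T (N u) + Q u" for u
  have d\<Phi>: "(\<Phi> has_derivative (\<lambda>w. T (frechet_derivative N (at u) w) + Q w)) (at u)" if "u \<in> U" for u
    unfolding \<Phi>_def
    by (intro has_derivative_add bounded_linear.has_derivative[OF bl(1)] has_derivative_frechet d that
        bounded_linear_imp_has_derivative bl)
  have C\<Phi>: "C_k_on 1 U \<Phi>"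
    unfolding One_nat_def
  proof (rule C_k_on_SucI[OF \<open>open U\<close> d\<Phi>])
    show "C_k_on 0 U (\<lambda>x. T (frechet_derivative N (at x) v) + Q v)" for v
      using N by (auto intro!: continuous_intros bounded_linear.continuous_on[OF bl(1)])
  qed auto
  have inj: "inj (frechet_derivative \<Phi> (at u0))"
    using J(6) by (simp add: frechet_derivative_eqI[OF d\<Phi>[OF u0]])
  obtain V \<rho> g where V: "open V" "u0 \<in> V" "V \<subseteq> U" "0 < \<rho>" "homeomorphism V (ball (\<Phi> u0) \<rho>) \<Phi> g"
    using C1_local_homeomorphism[OF \<open>open U\<close> C\<Phi> u0 inj] by metis
  define E where "E = {y. \<exists>s\<in>S. \<forall>j\<in>J. y $ j = T s $ j}"
  have clE: "closed E"
  proof -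
    let ?P = "\<lambda>y::real^'n. (\<chi> j. if j \<in> J then y $ j else 0)"
    have "E = ?P -` (T ` S)"
    proof (intro set_eqI iffI)
      fix y assume "y \<in> E"
      then obtain s where s: "s \<in> S" "\<forall>j\<in>J. y $ j = T s $ j" by (auto simp: E_def)
      then have "?P y = T s" using J(4) by (simp add: vec_eq_iff)
      then show "y \<in> ?P -` (T ` S)" using s(1) by simp
    next
      fix y assume "y \<in> ?P -` (T ` S)"
      then obtain s where s: "s \<in> S" "?P y = T s" by auto
      then have "\<forall>j\<in>J. y $ j = T s $ j" by (metis (mono_tags, lifting) vec_lambda_beta)
      then show "y \<in> E" using s(1) by (auto simp: E_def)
    qed
    moreover have "closed (T ` S)"
      using S(2) bounded_linear.continuous_on[OF bl(1) continuous_on_id]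
      by (intro compact_imp_closed compact_continuous_image) auto
    moreover have "continuous_on UNIV ?P"
    proof (intro continuous_on_vec_lambda)
      show "continuous_on UNIV (\<lambda>y::real^'n. if j \<in> J then y $ j else 0)" for j
        by (cases "j \<in> J") (auto intro: continuous_intros)
    qed
    ultimately show ?thesis by (simp add: closed_vimage)
  qed
  obtain \<Lambda> where "\<forall>y. norm (T y) \<le> norm y * \<Lambda>" using bounded_linear.bounded[OF bl(1)] ..
  then have \<Lambda>: "norm (T y) \<le> norm y * \<Lambda>" for y by simp
  have lip: "\<bar>T s $ j - T s' $ j\<bar> \<le> \<Lambda> * dist s s'" for s s' j
    using component_le_norm_cart[of "T (s - s')" j] \<Lambda>[of "s - s'"]
    by (simp add: linear_diff[OF J(2)] dist_norm mult.commute)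
  let ?B = "ball (\<Phi> u0) \<rho>"
  note BE = ball_minus_cylinder[OF S(1) J(1) lip E_def clE V(4), of "\<Phi> u0"]
  have g: "continuous_on ?B g" "g ` ?B = V" "\<And>y. y \<in> ?B \<Longrightarrow> \<Phi> (g y) = y" "\<And>u. u \<in> V \<Longrightarrow> g (\<Phi> u) = u"
    "\<And>u. u \<in> V \<Longrightarrow> \<Phi> u \<in> ?B"
    using V(5) by (auto simp: homeomorphism_def)
  have sub: "g ` (?B - E) \<subseteq> V - N -` S"
  proof clarify
    fix y assume y: "y \<in> ?B" "y \<notin> E"
    have "N (g y) \<notin> S"
    proof
      assume "N (g y) \<in> S"
      moreover have "\<forall>j\<in>J. y $ j = T (N (g y)) $ j"
        using g(3)[OF y(1)] J(5) by (metis \<Phi>_def add.right_neutral vector_add_component)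
      ultimately show False using y(2) by (auto simp: E_def)
    qed
    then show "g y \<in> V - N -` S" using g(2) y(1) by blast
  qed
  have con: "connected (g ` (?B - E))"
    using BE(1) g(1) by (intro connected_continuous_image) (auto intro: continuous_on_subset)
  have cl: "V \<subseteq> closure (g ` (?B - E))"
  proof
    fix u assume u: "u \<in> V"
    show "u \<in> closure (g ` (?B - E))"
      unfolding closure_approachable
    proof (intro allI impI)
      fix e :: real assume "e > 0"
      then obtain \<delta> where \<delta>: "\<delta> > 0" "\<And>y. y \<in> ?B \<Longrightarrow> dist y (\<Phi> u) < \<delta> \<Longrightarrow> dist (g y) (g (\<Phi> u)) < e"
        using g(1) g(5)[OF u] unfolding continuous_on_iff by meson
      have "\<Phi> u \<in> closure (?B - E)" using BE(2) g(5)[OF u] by blast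
      then obtain y where "y \<in> ?B - E" "dist y (\<Phi> u) < \<delta>" using \<delta>(1) closure_approachable by blast
      then show "\<exists>x\<in>g ` (?B - E). dist x u < e" using \<delta>(2)[of y] g(4)[OF u] by auto
    qed
  qed
  have "connected (V - N -` S)"
    by (rule connected_intermediate_closure[OF con sub]) (use cl in auto)
  moreover have "V \<subseteq> closure (V - N -` S)" using cl closure_mono[OF sub] by blast
  ultimately show ?thesis using that V by blast
qed

text \<open>Near a regular point a superlevel set is, in suitable coordinates, a half ball.\<close>

lemma superlevel_connected_at_regular_point:
  fixes h :: "'a::euclidean_space \<Rightarrow> real"
  assumes "open U" and h: "C_k_on 1 U h" and u0: "u0 \<in> U" and ne: "frechet_derivative h (at u0) w \<noteq> 0"
  obtains V where "open V" "u0 \<in> V" "V \<subseteq> U" "connected {u \<in> V. h u0 < h u}" "{u \<in> V. h u0 < h u} \<noteq> {}"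
proof -
  have d: "h differentiable (at u)" if "u \<in> U" for u using h that by simp
  let ?D = "\<lambda>u. frechet_derivative h (at u)"
  define e where "e = w /\<^sub>R ?D u0 w"
  have De: "?D u0 e = 1" unfolding e_def using linear_scale[OF linear_frechet[OF d[OF u0]]] ne by simp
  have "e \<noteq> 0" using De linear_0[OF linear_frechet[OF d[OF u0]]] by auto
  \<comment> \<open>the coordinate change \<open>\<Phi>\<close> is made such that \<open>h\<close> becomes the linear function \<open>b \<bullet> _\<close>\<close>
  define b where "b = e /\<^sub>R (e \<bullet> e)"
  have be: "b \<bullet> e = 1" using \<open>e \<noteq> 0\<close> by (simp add: b_def)
  define \<Phi> where "\<Phi> u = u + (h u - b \<bullet> u) *\<^sub>R e" for u
  have b\<Phi>: "b \<bullet> \<Phi> u = h u" for u by (simp add: \<Phi>_def inner_add_right be)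
  have d\<Phi>: "(\<Phi> has_derivative (\<lambda>w. w + (?D u w - b \<bullet> w) *\<^sub>R e)) (at u)" if "u \<in> U" for u
    unfolding \<Phi>_def by (auto intro!: derivative_eq_intros has_derivative_frechet d that)
  have C\<Phi>: "C_k_on 1 U \<Phi>"
    unfolding One_nat_def
  proof (rule C_k_on_SucI[OF \<open>open U\<close> d\<Phi>])
    show "C_k_on 0 U (\<lambda>x. v + (?D x v - b \<bullet> v) *\<^sub>R e)" for v
      using h by (auto intro!: continuous_intros)
  qed auto
  have "inj (\<lambda>w. w + (?D u0 w - b \<bullet> w) *\<^sub>R e)"
  proof -
    have lin: "linear (\<lambda>w. w + (?D u0 w - b \<bullet> w) *\<^sub>R e)"
      using d\<Phi>[OF u0] has_derivative_linear by blast
    have "w = 0" if 0: "w + (?D u0 w - b \<bullet> w) *\<^sub>R e = 0" for w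
    proof -
      have "w = - ((?D u0 w - b \<bullet> w) *\<^sub>R e)" using 0 by (simp add: eq_neg_iff_add_eq_0)
      then have w: "w = (b \<bullet> w - ?D u0 w) *\<^sub>R e" by (metis minus_diff_eq scaleR_minus_left)
      obtain s where s: "w = s *\<^sub>R e" "s = b \<bullet> w - ?D u0 w" using w by blast
      have "?D u0 (s *\<^sub>R e) = s" "b \<bullet> (s *\<^sub>R e) = s"
        using De be linear_scale[OF linear_frechet[OF d[OF u0]], of s e] by simp_all
      then have "s = 0" using s by (metis diff_self)
      then show ?thesis using s(1) by simp
    qed
    then show ?thesis using linear_injective_0[OF lin] by blast
  qed
  then have inj: "inj (frechet_derivative \<Phi> (at u0))"
    by (simp add: frechet_derivative_eqI[OF d\<Phi>[OF u0]])
  obtain V \<rho> g where V: "open V" "u0 \<in> V" "V \<subseteq> U" "0 < \<rho>" "homeomorphism V (ball (\<Phi> u0) \<rho>) \<Phi> g"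
    using C1_local_homeomorphism[OF \<open>open U\<close> C\<Phi> u0 inj] by metis
  let ?B = "ball (\<Phi> u0) \<rho>"
  have g: "continuous_on ?B g" "g ` ?B = V" "\<And>y. y \<in> ?B \<Longrightarrow> \<Phi> (g y) = y" "\<And>u. u \<in> V \<Longrightarrow> g (\<Phi> u) = u"
    "\<And>u. u \<in> V \<Longrightarrow> \<Phi> u \<in> ?B"
    using V(5) by (auto simp: homeomorphism_def)
  let ?H = "?B \<inter> {y. b \<bullet> y > h u0}"
  have eq: "{u \<in> V. h u0 < h u} = g ` ?H"
  proof (intro set_eqI iffI)
    fix u assume "u \<in> {u \<in> V. h u0 < h u}"
    then show "u \<in> g ` ?H" using g(4,5) b\<Phi> by (intro image_eqI[of _ _ "\<Phi> u"]) auto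
  next
    fix u assume "u \<in> g ` ?H"
    then show "u \<in> {u \<in> V. h u0 < h u}" using g(2,3) b\<Phi> by (auto simp: image_iff) metis+
  qed
  have "connected ?H" by (intro convex_connected convex_Int convex_ball convex_halfspace_gt)
  then have "connected (g ` ?H)"
    using g(1) by (intro connected_continuous_image) (auto intro: continuous_on_subset)
  moreover have "?H \<noteq> {}"
  proof -
    have "norm e > 0" using \<open>e \<noteq> 0\<close> by simp
    let ?y = "\<Phi> u0 + (\<rho> / (2 * norm e)) *\<^sub>R e"
    have "?y \<in> ?B" using V(4) \<open>norm e > 0\<close> by (simp add: dist_norm)
    moreover have "b \<bullet> ?y > h u0"
      using V(4) \<open>norm e > 0\<close> b\<Phi>[of u0] be by (simp add: inner_add_right)
    ultimately show ?thesis by blast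
  qed
  ultimately show ?thesis using that[of V] V eq by auto
qed


section \<open>Second-order conditions for extrema\<close>

abbreviation second_derivative ::
  "('a::euclidean_space \<Rightarrow> 'b::real_normed_vector) \<Rightarrow> 'a \<Rightarrow> 'a \<Rightarrow> 'a \<Rightarrow> 'b" where
  "second_derivative f u v w \<equiv> frechet_derivative (\<lambda>y. frechet_derivative f (at y) v) (at u) w"

lemma C2_D:
  assumes "C_k_on 2 U f" "u \<in> U"
  shows "f differentiable (at u)" "(\<lambda>y. frechet_derivative f (at y) v) differentiable (at u)"
  using assms by (auto simp: numeral_2_eq_2)

lemma C2_continuous:
  assumes "C_k_on 2 U f"
  shows "continuous_on U (\<lambda>u. second_derivative f u v w)"
  using assms by (auto simp: numeral_2_eq_2)

lemma second_derivative_expand_left: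
  fixes f :: "'a::euclidean_space \<Rightarrow> 'b::real_normed_vector"
  assumes "open U" "C_k_on 2 U f" "u \<in> U"
  shows "second_derivative f u v w = (\<Sum>b\<in>Basis. (v \<bullet> b) *\<^sub>R second_derivative f u b w)"
proof -
  have "((\<lambda>y. \<Sum>b\<in>Basis. (v \<bullet> b) *\<^sub>R frechet_derivative f (at y) b) has_derivative
      (\<lambda>w. \<Sum>b\<in>Basis. (v \<bullet> b) *\<^sub>R second_derivative f u b w)) (at u)"
    by (intro has_derivative_sum has_derivative_scaleR_right has_derivative_frechet C2_D[OF assms(2,3)])
  then have "((\<lambda>y. frechet_derivative f (at y) v) has_derivative
      (\<lambda>w. \<Sum>b\<in>Basis. (v \<bullet> b) *\<^sub>R second_derivative f u b w)) (at u)"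
    by (rule has_derivative_transform_within_open[OF _ \<open>open U\<close> \<open>u \<in> U\<close>])
      (metis linear_Basis_expansion linear_frechet C2_D(1) assms(2))
  from frechet_derivative_eqI[OF this] show ?thesis by simp
qed

lemma second_derivative_expand:
  fixes f :: "'a::euclidean_space \<Rightarrow> 'b::real_normed_vector"
  assumes "open U" "C_k_on 2 U f" "u \<in> U"
  shows "second_derivative f u v w = (\<Sum>b\<in>Basis. \<Sum>c\<in>Basis. ((v \<bullet> b) * (w \<bullet> c)) *\<^sub>R second_derivative f u b c)"
proof -
  have "second_derivative f u b w = (\<Sum>c\<in>Basis. (w \<bullet> c) *\<^sub>R second_derivative f u b c)" for b
    using linear_Basis_expansion[OF linear_frechet[OF C2_D(2)[OF assms(2,3)]]] .
  then show ?thesis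
    by (simp add: second_derivative_expand_left[OF assms, of v] scaleR_sum_right)
qed

lemma second_derivative_scale:
  fixes h :: "'a::euclidean_space \<Rightarrow> real"
  assumes "open U" "C_k_on 2 U h" "u \<in> U"
  shows "second_derivative h u (c *\<^sub>R v) (c *\<^sub>R v) = c * c * second_derivative h u v v"
proof -
  have "second_derivative h u (c *\<^sub>R v) w = c * second_derivative h u v w" for w
    by (simp add: second_derivative_expand_left[OF assms, of "c *\<^sub>R v"]
        second_derivative_expand_left[OF assms, of v] sum_distrib_left mult_ac)
  moreover have "second_derivative h u v (c *\<^sub>R v) = c * second_derivative h u v v"
    using linear_scale[OF linear_frechet[OF C2_D(2)[OF assms(2,3)]]] by simp
  ultimately show ?thesis by simp
qed

text \<open>Positivity of a form on the unit sphere persists nearby, by compactness of the sphere.\<close>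

lemma positive_form_open:
  fixes F :: "'a::euclidean_space \<Rightarrow> 'b::euclidean_space \<Rightarrow> real"
  assumes "open U" "u0 \<in> U" and cont: "continuous_on (U \<times> UNIV) (\<lambda>z. F (fst z) (snd z))"
    and pos: "\<And>w. norm w = 1 \<Longrightarrow> 0 < F u0 w"
  obtains d where "0 < d" "ball u0 d \<subseteq> U" "\<And>u w. u \<in> ball u0 d \<Longrightarrow> norm w = 1 \<Longrightarrow> 0 < F u w"
proof -
  define W where "W = {z \<in> U \<times> UNIV. 0 < F (fst z) (snd z)}"
  have "open W"
  proof -
    have "openin (top_of_set (U \<times> UNIV)) ((U \<times> UNIV) \<inter> (\<lambda>z. F (fst z) (snd z)) -` {0<..})"
      using cont by (rule continuous_openin_preimage_gen) auto
    moreover have "(U \<times> UNIV) \<inter> (\<lambda>z. F (fst z) (snd z)) -` {0<..} = W" by (auto simp: W_def)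
    ultimately show ?thesis using \<open>open U\<close> by (metis openin_open_eq open_Times open_UNIV)
  qed
  moreover have "{u0} \<times> sphere 0 1 \<subseteq> W" using pos \<open>u0 \<in> U\<close> by (auto simp: W_def)
  ultimately obtain X where X: "u0 \<in> X" "open X" "X \<times> sphere 0 1 \<subseteq> W"
    using Elementary_Topology.tube_lemma[of "sphere (0::'b) 1" W u0] compact_sphere by blast
  obtain d where d: "0 < d" "ball u0 d \<subseteq> X \<inter> U"
    using X \<open>open U\<close> \<open>u0 \<in> U\<close> open_contains_ball[of "X \<inter> U"] by (meson IntI open_Int)
  have "0 < F u w" if "u \<in> ball u0 d" "norm w = 1" for u w
  proof -
    have "(u, w) \<in> W" using that d(2) X(3) by (auto simp: subset_iff)
    then show ?thesis by (simp add: W_def)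
  qed
  then show ?thesis using that d by auto
qed

lemma decreasing_along_segment:
  fixes h :: "'a::euclidean_space \<Rightarrow> real"
  assumes h: "C_k_on 2 U h" and seg: "\<And>t. 0 \<le> t \<Longrightarrow> t \<le> 1 \<Longrightarrow> u + t *\<^sub>R w \<in> U"
    and crit: "frechet_derivative h (at u) w = 0"
    and neg: "\<And>t. 0 \<le> t \<Longrightarrow> t \<le> 1 \<Longrightarrow> second_derivative h (u + t *\<^sub>R w) w w < 0"
  shows "h (u + w) < h u"
proof -
  have line: "((\<lambda>t. f (u + t *\<^sub>R w)) has_real_derivative frechet_derivative f (at (u + t *\<^sub>R w)) w) (at t)"
    if "f differentiable (at (u + t *\<^sub>R w))" for f :: "'a \<Rightarrow> real" and t
  proof -
    have "((\<lambda>t. f (u + t *\<^sub>R w)) has_derivative (\<lambda>r. frechet_derivative f (at (u + t *\<^sub>R w)) (r *\<^sub>R w))) (at t)"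
      by (rule has_derivative_compose[where f="\<lambda>t. u + t *\<^sub>R w", OF _ has_derivative_frechet[OF that]])
        (auto intro!: derivative_eq_intros)
    moreover have "frechet_derivative f (at (u + t *\<^sub>R w)) (r *\<^sub>R w) = frechet_derivative f (at (u + t *\<^sub>R w)) w * r" for r
      using linear_scale[OF linear_frechet[OF that]] by simp
    ultimately show ?thesis by (simp add: has_field_derivative_def)
  qed
  let ?D = "\<lambda>y. frechet_derivative h (at y) w"
  have D: "?D (u + t *\<^sub>R w) < 0" if t: "0 < t" "t \<le> 1" for t
  proof -
    have "\<exists>z. 0 < z \<and> z < t \<and> ?D (u + t *\<^sub>R w) - ?D (u + 0 *\<^sub>R w) = (t - 0) * second_derivative h (u + z *\<^sub>R w) w w"
      using t by (intro MVT2 line C2_D[OF h] seg) auto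
    then obtain z where "0 < z" "z < t" "?D (u + t *\<^sub>R w) = t * second_derivative h (u + z *\<^sub>R w) w w"
      using crit by auto
    then show ?thesis using neg[of z] t by (simp add: mult_pos_neg)
  qed
  have "\<exists>z. 0 < z \<and> z < 1 \<and> h (u + 1 *\<^sub>R w) - h (u + 0 *\<^sub>R w) = (1 - 0) * ?D (u + z *\<^sub>R w)"
    by (intro MVT2 line C2_D[OF h] seg) auto
  then show ?thesis using D by force
qed

text \<open>The second derivative stays negative definite nearby, so the function decreases along every short
  segment that starts at the critical point.\<close>

lemma strict_local_max_if_negative_definite:
  fixes h :: "'a::euclidean_space \<Rightarrow> real"
  assumes "open U" and h: "C_k_on 2 U h" and u0: "u0 \<in> U"
    and crit: "\<And>w. frechet_derivative h (at u0) w = 0"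
    and neg: "\<And>w. w \<noteq> 0 \<Longrightarrow> second_derivative h u0 w w < 0"
  obtains d where "0 < d" "ball u0 d \<subseteq> U" "\<And>u. u \<in> ball u0 d \<Longrightarrow> u \<noteq> u0 \<Longrightarrow> h u < h u0"
proof -
  have "continuous_on (U \<times> UNIV) (\<lambda>z::'a\<times>'a. \<Sum>b\<in>Basis. \<Sum>c\<in>Basis.
      ((snd z \<bullet> b) * (snd z \<bullet> c)) *\<^sub>R second_derivative h (fst z) b c)"
    by (intro continuous_intros continuous_on_compose2[OF C2_continuous[OF h]]) auto
  then have cont: "continuous_on (U \<times> UNIV) (\<lambda>z. - second_derivative h (fst z) (snd z) (snd z))"
    by (intro continuous_on_minus, elim continuous_on_eq) (auto simp: second_derivative_expand[OF \<open>open U\<close> h])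
  obtain d where d: "0 < d" "ball u0 d \<subseteq> U"
    "\<And>u w. u \<in> ball u0 d \<Longrightarrow> norm w = 1 \<Longrightarrow> 0 < - second_derivative h u w w"
    using positive_form_open[OF \<open>open U\<close> u0 cont] neg by (metis neg_0_less_iff_less norm_zero zero_neq_one)
  have "h u < h u0" if u: "u \<in> ball u0 d" "u \<noteq> u0" for u
  proof -
    let ?w = "u - u0"
    have seg: "u0 + t *\<^sub>R ?w \<in> ball u0 d" if "0 \<le> t" "t \<le> 1" for t
    proof -
      have "norm (t *\<^sub>R ?w) \<le> 1 * norm ?w" unfolding norm_scaleR using that by (intro mult_right_mono) auto
      moreover have "norm ?w < d" using u by (simp add: dist_norm norm_minus_commute)
      moreover have "dist u0 (u0 + t *\<^sub>R ?w) = norm (t *\<^sub>R ?w)" unfolding dist_norm by (metis add_diff_cancel_left' norm_minus_commute)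
      ultimately show ?thesis by simp
    qed
    have "second_derivative h (u0 + t *\<^sub>R ?w) ?w ?w < 0" if t: "0 \<le> t" "t \<le> 1" for t
    proof -
      let ?y = "u0 + t *\<^sub>R ?w"
      have yU: "?y \<in> U" using seg[OF t] d by blast
      let ?e = "sgn ?w"
      have w: "?w = norm ?w *\<^sub>R ?e" using u by (simp add: sgn_div_norm)
      from second_derivative_scale[OF \<open>open U\<close> h yU, of "norm ?w" ?e] have "second_derivative h ?y ?w ?w = norm ?w * norm ?w * second_derivative h ?y ?e ?e"
        using w by simp
      moreover have "second_derivative h ?y ?e ?e < 0" using d(3)[OF seg[OF t], of ?e] u by (simp add: norm_sgn)
      ultimately show ?thesis using u by (simp add: mult_pos_neg)
    qed
    then have "h (u0 + ?w) < h u0" using seg d(2) crit by (intro decreasing_along_segment[OF h]) auto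
    then show ?thesis by simp
  qed
  then show ?thesis using that d by auto
qed

lemma second_derivative_nonpos_at_local_max:
  fixes h :: "'a::euclidean_space \<Rightarrow> real"
  assumes "open U" and h: "C_k_on 2 U h" and u0: "u0 \<in> U" and mx: "\<And>u. u \<in> U \<Longrightarrow> h u \<le> h u0"
  shows "frechet_derivative h (at u0) w = 0" "second_derivative h u0 w w \<le> 0"
proof -
  have z: "frechet_derivative h (at u0) = (\<lambda>v. 0)"
    using differential_zero_maxmin[OF u0 \<open>open U\<close> has_derivative_frechet[OF C2_D(1)[OF h u0]]] mx by blast
  then show "frechet_derivative h (at u0) w = 0" by simp
  show "second_derivative h u0 w w \<le> 0"
  proof (rule ccontr)
    assume "\<not> second_derivative h u0 w w \<le> 0"
    then have pos: "0 < second_derivative h u0 w w" by simp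
    have "open {u \<in> U. 0 < second_derivative h u w w}"
    proof -
      have "open (U \<inter> (\<lambda>u. second_derivative h u w w) -` {0<..})"
        by (rule continuous_open_preimage[OF C2_continuous[OF h] \<open>open U\<close>]) auto
      moreover have "U \<inter> (\<lambda>u. second_derivative h u w w) -` {0<..} = {u \<in> U. 0 < second_derivative h u w w}" by auto
      ultimately show ?thesis by simp
    qed
    then obtain e where e: "e > 0" "ball u0 e \<subseteq> {u \<in> U. 0 < second_derivative h u w w}"
      using pos u0 open_contains_ball by (metis (mono_tags, lifting) mem_Collect_eq)
    define s where "s = e / (2 * (norm w + 1))"
    have nw: "norm w + 1 > 0" by (simp add: add_nonneg_pos)
    have s: "s > 0" "s * norm w < e"
    proof -
      show "s > 0" using e nw by (simp add: s_def)
      have "s * norm w \<le> s * (norm w + 1)" using \<open>s > 0\<close> by simp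
      also have "\<dots> = e / 2" using nw by (simp add: s_def field_simps)
      finally show "s * norm w < e" using e by simp
    qed
    have seg: "u0 + t *\<^sub>R (s *\<^sub>R w) \<in> {u \<in> U. 0 < second_derivative h u w w}" if "0 \<le> t" "t \<le> 1" for t
    proof -
      have "norm (t *\<^sub>R (s *\<^sub>R w)) = t * (s * norm w)" using that s by simp
      also have "\<dots> \<le> 1 * (s * norm w)" using that s by (intro mult_right_mono) auto
      finally show ?thesis using s e by (intro subsetD[OF e(2)]) (simp add: dist_norm)
    qed
    define k where "k u = - h u" for u
    have k: "C_k_on 2 U k" unfolding k_def
      by (rule C_k_on_bounded_linear[OF bounded_linear_minus[OF bounded_linear_ident] \<open>open U\<close> h])
    have dk: "frechet_derivative k (at u) v = - frechet_derivative h (at u) v" if "u \<in> U" for u v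
      unfolding k_def using frechet_derivative_eqI[OF has_derivative_minus[OF has_derivative_frechet[OF C2_D(1)[OF h that]]]]
      by simp
    have d2k: "second_derivative k u v v' = - second_derivative h u v v'" if "u \<in> U" for u v v'
    proof -
      have "((\<lambda>y. frechet_derivative k (at y) v) has_derivative (\<lambda>v'. - second_derivative h u v v')) (at u)"
        by (rule has_derivative_transform_within_open[OF
              has_derivative_minus[OF has_derivative_frechet[OF C2_D(2)[OF h that]]] \<open>open U\<close> that])
          (simp add: dk)
      from frechet_derivative_eqI[OF this] show ?thesis by simp
    qed
    have "k (u0 + s *\<^sub>R w) < k u0"
    proof (rule decreasing_along_segment[OF k])
      show "frechet_derivative k (at u0) (s *\<^sub>R w) = 0" using dk[OF u0] z by simp
      show "u0 + t *\<^sub>R (s *\<^sub>R w) \<in> U" if "0 \<le> t" "t \<le> 1" for t using seg[OF that] by simp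
      show "second_derivative k (u0 + t *\<^sub>R (s *\<^sub>R w)) (s *\<^sub>R w) (s *\<^sub>R w) < 0" if t: "0 \<le> t" "t \<le> 1" for t
      proof -
        let ?y = "u0 + t *\<^sub>R (s *\<^sub>R w)"
        have y: "?y \<in> U" "0 < second_derivative h ?y w w" using seg[OF t] by auto
        have "second_derivative h ?y (s *\<^sub>R w) (s *\<^sub>R w) = s * s * second_derivative h ?y w w"
          by (rule second_derivative_scale[OF \<open>open U\<close> h y(1)])
        moreover have "0 < s * s * second_derivative h ?y w w" using y(2) s(1) by (intro mult_pos_pos)
        ultimately show ?thesis using d2k[OF y(1), of "s *\<^sub>R w" "s *\<^sub>R w"] by linarith
      qed
    qed
    then show False using mx[of "u0 + s *\<^sub>R w"] seg[of 1] by (simp add: k_def)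
  qed
qed


section \<open>Connectedness and mountain passes\<close>

text \<open>The closures of two parts separating the complement of \<open>L\<close> would cover the connected space, hence
  meet, and this at a point of \<open>L\<close>; but near such a point the complement is connected and dense.\<close>

lemma connected_minus_nonseparating:
  assumes M: "connected_space M" and L: "closedin M L"
    and loc: "\<And>p. p \<in> L \<Longrightarrow> \<exists>N. openin M N \<and> p \<in> N \<and> connectedin M (N - L) \<and> N \<subseteq> M closure_of (N - L)"
  shows "connectedin M (topspace M - L)" "M closure_of (topspace M - L) = topspace M"
proof -
  let ?X = "topspace M - L"
  have X: "openin M ?X" using L by blast
  show "M closure_of ?X = topspace M"
  proof (rule antisym[OF closure_of_subset_topspace], rule subsetI)
    fix p assume p: "p \<in> topspace M"
    show "p \<in> M closure_of ?X"
    proof (cases "p \<in> L")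
      case True
      then obtain N where N: "openin M N" "p \<in> N" "N \<subseteq> M closure_of (N - L)" using loc by blast
      then have "M closure_of (N - L) \<subseteq> M closure_of ?X"
        by (intro closure_of_mono) (auto dest: openin_subset)
      then show ?thesis using N by blast
    next
      case False
      then show ?thesis using p closure_of_subset[of ?X M] by blast
    qed
  qed
  show "connectedin M ?X"
    unfolding connectedin
  proof (intro conjI notI)
    assume "\<exists>E1 E2. openin M E1 \<and> openin M E2 \<and> ?X \<subseteq> E1 \<union> E2 \<and> E1 \<inter> E2 \<inter> ?X = {} \<and> E1 \<inter> ?X \<noteq> {} \<and> E2 \<inter> ?X \<noteq> {}"
    then obtain E1 E2 where E: "openin M E1" "openin M E2" "?X \<subseteq> E1 \<union> E2" "E1 \<inter> E2 \<inter> ?X = {}"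
      "E1 \<inter> ?X \<noteq> {}" "E2 \<inter> ?X \<noteq> {}" by blast
    define U where "U = E1 \<inter> ?X"
    define V where "V = E2 \<inter> ?X"
    have UV: "openin M U" "openin M V" "U \<inter> V = {}" "U \<noteq> {}" "V \<noteq> {}" "U \<union> V = ?X"
      using E X by (auto simp: U_def V_def)
    have "M closure_of U \<union> M closure_of V = topspace M"
      using \<open>M closure_of ?X = topspace M\<close> UV(6) closure_of_Un by metis
    moreover have "M closure_of U \<noteq> {}" "M closure_of V \<noteq> {}"
      using UV by (metis closure_of_eq_empty_gen disjnt_def inf.absorb_iff2 openin_subset)+
    ultimately have "M closure_of U \<inter> M closure_of V \<noteq> {}"
      using M unfolding connected_space_closedin_eq by (metis closedin_closure_of)
    then obtain p where p: "p \<in> M closure_of U" "p \<in> M closure_of V" by blast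
    have "p \<notin> U" "p \<notin> V" using p UV(1-3) unfolding in_closure_of by blast+
    then have "p \<in> L" using UV(6) p(1) closure_of_subset_topspace by fastforce
    then obtain N where N: "openin M N" "p \<in> N" "connectedin M (N - L)" using loc by blast
    have "N \<inter> U \<noteq> {}" "N \<inter> V \<noteq> {}" using p N unfolding in_closure_of by blast+
    moreover have "N - L \<subseteq> U \<union> V" using N(1) openin_subset UV(6) by fastforce
    ultimately show False
      using connectedinD[OF N(3) UV(1,2)] UV(3,6) by blast
  qed auto
qed

text \<open>A mountain pass principle. If two peaks were separated inside all superlevel sets above a level
  \<open>t\<close>, they would be separated inside the one at level \<open>t\<close>, as \<open>t\<close> is a level of no
  pass; and by compactness separation persists a little below \<open>t\<close>. So it would persist down to
  the minimum, where the superlevel set is the whole connected space. At a point outside \<open>P\<close> the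
  points that are higher accumulate, and locally they form a connected set; this is what excludes
  passes. Separation is expressed by closed sets, rather than by components, because this form is the
  one that compactness handles.\<close>

lemma unique_peak:
  fixes h :: "'a \<Rightarrow> real"
  assumes cpt: "compact_space M" and haus: "Hausdorff_space M" and con: "connected_space M"
    and lpc: "locally_path_connected_space M"
    and h: "continuous_map M euclideanreal h"
    and P: "closedin M P"
    and peak: "\<And>p. p \<in> P \<Longrightarrow> \<exists>N. openin M N \<and> p \<in> N \<and> (\<forall>u\<in>N. u \<noteq> p \<longrightarrow> h u < h p)"
    and pass: "\<And>q. q \<in> topspace M \<Longrightarrow> q \<notin> P \<Longrightarrow> q \<in> M closure_of {u \<in> topspace M. h q < h u} \<and>
       (\<exists>N. openin M N \<and> q \<in> N \<and> connectedin M {u \<in> N. h q < h u})"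
    and p1: "p1 \<in> P" and p2: "p2 \<in> P" and le: "h p1 \<le> h p2"
  shows "p1 = p2"
proof (rule ccontr)
  assume ne: "p1 \<noteq> p2"
  have top: "p1 \<in> topspace M" "p2 \<in> topspace M" using p1 p2 closedin_subset[OF P] by auto
  define F where "F t = {u \<in> topspace M. t \<le> h u}" for t
  have clF: "closedin M (F t)" for t
    using closedin_continuous_map_preimage[OF h, of "{t..}"] by (simp add: F_def)
  \<comment> \<open>\<open>F t\<close> is the superlevel set, and \<open>Sep t\<close> says that it splits between the two peaks\<close>
  define Sep where "Sep t \<longleftrightarrow> (\<exists>A B. closedin M A \<and> closedin M B \<and> A \<inter> B = {} \<and> A \<union> B = F t \<and> p1 \<in> A \<and> p2 \<in> B)" for t
  have Sep_connected: False if sep: "Sep t" and C: "connectedin M C" "C \<subseteq> F t" "p1 \<in> C" "p2 \<in> C" for t C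
  proof -
    obtain A B where "closedin M A" "closedin M B" "A \<inter> B = {}" "A \<union> B = F t" "p1 \<in> A" "p2 \<in> B"
      using sep unfolding Sep_def by blast
    then show False using C unfolding connectedin_closedin by blast
  qed
  obtain m where m: "\<And>u. u \<in> topspace M \<Longrightarrow> m \<le> h u"
  proof -
    have "compact (h ` topspace M)"
      using image_compactin[OF _ h] cpt unfolding compact_space_def by (simp add: compactin_euclidean_iff)
    then have "bdd_below (h ` topspace M)" by (simp add: compact_imp_bounded bounded_imp_bdd_below)
    then show ?thesis using that unfolding bdd_below_def by blast
  qed
  have low: "m < t" if "Sep t" for t
  proof (rule ccontr)
    assume "\<not> m < t"
    then have "F t = topspace M" using m by (force simp: F_def)
    then show False using Sep_connected[OF that, of "topspace M"] con top by (simp add: connectedin_topspace)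
  qed
  have start: "Sep (h p1)"
  proof -
    obtain N where N: "openin M N" "p1 \<in> N" "\<forall>u\<in>N. u \<noteq> p1 \<longrightarrow> h u < h p1" using peak[OF p1] by blast
    have "closedin M {p1}" using haus top by (simp add: closedin_Hausdorff_singleton)
    moreover have "closedin M (F (h p1) - N)" using clF N by blast
    moreover have "{p1} \<union> (F (h p1) - N) = F (h p1)" using N top by (force simp: F_def)
    moreover have "p2 \<in> F (h p1) - N" using le top N ne by (force simp: F_def)
    ultimately show ?thesis unfolding Sep_def using N(2) by (intro exI[of _ "{p1}"] exI[of _ "F (h p1) - N"]) auto
  qed
  have mono: "Sep t'" if sep: "Sep t" and t: "t \<le> t'" "t' \<le> h p1" for t t'
  proof -
    obtain A B where AB: "closedin M A" "closedin M B" "A \<inter> B = {}" "A \<union> B = F t" "p1 \<in> A" "p2 \<in> B"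
      using sep unfolding Sep_def by blast
    have "F t' \<subseteq> F t" using t by (auto simp: F_def)
    moreover have "p1 \<in> F t'" "p2 \<in> F t'" using t le top by (auto simp: F_def)
    ultimately show ?thesis unfolding Sep_def using AB clF
      by (intro exI[of _ "A \<inter> F t'"] exI[of _ "B \<inter> F t'"]) auto
  qed
  have down: "\<exists>t'<t. Sep t'" if sep: "Sep t" and t: "t \<le> h p1" for t
  proof -
    obtain A B where AB: "closedin M A" "closedin M B" "A \<inter> B = {}" "A \<union> B = F t" "p1 \<in> A" "p2 \<in> B"
      using sep unfolding Sep_def by blast
    have "normal_space M" using cpt haus compact_Hausdorff_or_regular_imp_normal_space by blast
    then obtain U V where UV: "openin M U" "openin M V" "A \<subseteq> U" "B \<subseteq> V" "disjnt U V"
      using AB(1-3) unfolding normal_space_def disjnt_def by meson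
    define K where "K = topspace M - (U \<union> V)"
    have "closedin M K" unfolding K_def using UV by blast
    then have "compact (h ` K)"
      using image_compactin[OF closedin_compact_space[OF cpt] h] by (simp add: compactin_euclidean_iff)
    moreover have hK: "h z < t" if "z \<in> K" for z using that AB(4) UV(3,4) by (force simp: K_def F_def)
    ultimately obtain t' where t': "t' < t" "\<And>z. z \<in> K \<Longrightarrow> h z < t'"
    proof (cases "K = {}")
      case True
      then show ?thesis using that[of "t - 1"] by auto
    next
      case False
      then obtain z where z: "z \<in> K" "\<And>y. y \<in> K \<Longrightarrow> h y \<le> h z"
        using compact_attains_sup[OF \<open>compact (h ` K)\<close>] by auto
      then obtain r where "h z < r" "r < t" using hK dense by blast
      then show ?thesis using z(2) by (intro that[of r]) (auto intro: le_less_trans)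
    qed
    have "F t' \<subseteq> U \<union> V" using t'(2) by (force simp: F_def K_def)
    moreover have "p1 \<in> F t'" "p2 \<in> F t'" using t t' le top by (auto simp: F_def)
    moreover have "closedin M (F t' - V)" "closedin M (F t' - U)" using clF UV by blast+
    ultimately have "Sep t'" unfolding Sep_def using AB UV(3-5)
      by (intro exI[of _ "F t' - V"] exI[of _ "F t' - U"]) (auto simp: disjnt_def)
    then show ?thesis using t' by blast
  qed
  define T where "T = {t. t \<le> h p1 \<and> Sep t}"
  define s where "s = Inf T"
  have bT: "bdd_below T" unfolding T_def bdd_below_def using low by (intro exI[of _ m]) force
  have sle: "s \<le> h p1" unfolding s_def using start bT by (intro cInf_lower) (auto simp: T_def)
  have above: "Sep t" if t: "s < t" "t \<le> h p1" for t
  proof -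
    obtain t0 where "t0 \<in> T" "t0 < t"
      using cInf_lessD[of T t] t start unfolding s_def by (force simp: T_def)
    then show ?thesis using mono[of t0 t] t by (auto simp: T_def)
  qed
  have "Sep s"
  proof (cases "s = h p1")
    case False
    then have sp: "s < h p1" using sle by simp
    define W where "W = {u \<in> topspace M. s < h u}"
    have opW: "openin M W"
      using openin_continuous_map_preimage[OF h, of "{s<..}"] by (simp add: W_def)
    have Wt: "W \<subseteq> topspace M" by (auto simp: W_def)
    have lpcW: "locally_path_connected_space (subtopology M W)"
      using locally_path_connected_space_open_subset[OF lpc opW] .
    \<comment> \<open>the points above level \<open>s\<close> that can be reached from \<open>p1\<close> above this level, and the others\<close>
    define O1 where "O1 = Collect (path_component_of (subtopology M W) p1)"
    define O2 where "O2 = W - O1"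
    have O1: "openin M O1"
      using openin_path_component_of_locally_path_connected_space[OF lpcW] opW
      unfolding O1_def by (metis openin_trans_full)
    have O2: "openin M O2"
    proof -
      have "closedin (subtopology M W) O1"
        unfolding O1_def by (rule closedin_path_component_of_locally_path_connected_space[OF lpcW])
      then have "openin (subtopology M W) (topspace (subtopology M W) - O1)" by blast
      moreover have "topspace (subtopology M W) - O1 = O2" using Wt by (auto simp: O2_def)
      ultimately show ?thesis using opW openin_trans_full by metis
    qed
    have O1W: "O1 \<subseteq> W"
    proof
      fix y assume "y \<in> O1"
      then have "y \<in> topspace (subtopology M W)"
        unfolding O1_def using path_component_in_topspace by fastforce
      then show "y \<in> W" by simp
    qed
    then have OW: "O1 \<union> O2 = W" "O1 \<inter> O2 = {}" by (auto simp: O2_def)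
    have p1W: "p1 \<in> W" "p2 \<in> W" using sp le top by (auto simp: W_def)
    then have p1O: "p1 \<in> O1" unfolding O1_def using Wt by (auto simp: path_component_of_refl)
    have p2O: "p2 \<in> O2"
    proof (rule ccontr)
      assume "p2 \<notin> O2"
      then have "path_component_of (subtopology M W) p1 p2" using p1W by (auto simp: O2_def O1_def)
      then obtain g where g: "pathin (subtopology M W) g" "g 0 = p1" "g 1 = p2"
        unfolding path_component_of_def by blast
      define C where "C = g ` {0..1}"
      have gM: "pathin M g" and CW: "C \<subseteq> W" using g(1) by (auto simp: pathin_subtopology C_def)
      have C: "connectedin M C" "compactin M C" unfolding C_def
        using connectedin_path_image[OF gM] compactin_path_image[OF gM] by auto
      have ends: "p1 \<in> C" "p2 \<in> C" using g(2,3) by (auto simp: C_def)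
      have "compact (h ` C)" using image_compactin[OF C(2) h] by (simp add: compactin_euclidean_iff)
      then obtain z where z: "z \<in> C" "\<And>y. y \<in> C \<Longrightarrow> h z \<le> h y"
        using compact_attains_inf[of "h ` C"] ends by auto
      have "s < h z" using z(1) CW by (auto simp: W_def)
      then have "Sep (h z)" using above z(2)[OF ends(1)] by blast
      moreover have "C \<subseteq> F (h z)" using z(2) CW Wt by (auto simp: F_def)
      ultimately show False using Sep_connected C(1) ends by blast
    qed
    \<comment> \<open>peaks at level \<open>s\<close> are isolated in the superlevel set, so they are in neither closure\<close>
    define R where "R = P \<inter> {u \<in> topspace M. h u = s}"
    have clR: "closedin M R"
      using closedin_continuous_map_preimage[OF h, of "{s}"] P unfolding R_def
      by (intro closedin_Int) auto
    have clF': "M closure_of O1 \<subseteq> F s" "M closure_of O2 \<subseteq> F s"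
      using OW by (intro closure_of_minimal clF; force simp: W_def F_def)+
    have notR: "q \<notin> M closure_of W" if qR: "q \<in> R" for q
    proof
      assume q: "q \<in> M closure_of W"
      obtain N where N: "openin M N" "q \<in> N" "\<forall>u\<in>N. u \<noteq> q \<longrightarrow> h u < h q" using peak qR unfolding R_def by blast
      then obtain u where "u \<in> W" "u \<in> N" using q unfolding in_closure_of by blast
      then show False using N(3) qR by (force simp: W_def R_def)
    qed
    have disj: "M closure_of O1 \<inter> (M closure_of O2 \<union> R) = {}"
    proof (rule ccontr)
      assume "M closure_of O1 \<inter> (M closure_of O2 \<union> R) \<noteq> {}"
      then obtain q where q: "q \<in> M closure_of O1" "q \<in> M closure_of O2 \<or> q \<in> R" by blast
      have "q \<in> M closure_of W" using q(1) closure_of_mono[OF O1W] by blast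
      then have "q \<notin> R" using notR by blast
      then have q2: "q \<in> M closure_of O2" using q(2) by blast
      have qs: "q \<in> topspace M" "s \<le> h q" using q(1) clF' by (auto simp: F_def)
      have "q \<notin> O1" "q \<notin> O2" using q(1) q2 O1 O2 OW(2) unfolding in_closure_of by blast+
      then have hq: "h q = s" using OW(1) qs by (force simp: W_def)
      then have "q \<notin> P" using \<open>q \<notin> R\<close> qs by (auto simp: R_def)
      from conjunct2[OF pass[OF qs(1) this], unfolded hq]
      obtain N where N: "openin M N" "q \<in> N" "connectedin M {u \<in> N. s < h u}" by (elim exE conjE)
      have Nw: "{u \<in> N. s < h u} \<subseteq> O1 \<union> O2"
        unfolding OW(1) W_def using openin_subset[OF N(1)] by blast
      have "O1 \<inter> N \<noteq> {}" "O2 \<inter> N \<noteq> {}" using q(1) q2 N unfolding in_closure_of by blast+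
      then have "O1 \<inter> {u \<in> N. s < h u} \<noteq> {}" "O2 \<inter> {u \<in> N. s < h u} \<noteq> {}"
        using OW(1) by (auto simp: W_def)
      then show False using connectedinD[OF N(3) O1 O2 Nw] OW(2) by blast
    qed
    moreover have "M closure_of O1 \<union> (M closure_of O2 \<union> R) = F s"
    proof (intro antisym subsetI)
      fix q assume "q \<in> F s"
      then have q: "q \<in> topspace M" "s \<le> h q" by (auto simp: F_def)
      have "q \<in> M closure_of W" if "q \<notin> R"
      proof (cases "s < h q")
        case True
        then have "q \<in> W" using q by (simp add: W_def)
        then show ?thesis using closure_of_subset[OF Wt] by blast
      next
        case False
        then have "h q = s" using q by simp
        then show ?thesis using pass[OF q(1)] that q(1) by (auto simp: R_def W_def)
      qed
      then show "q \<in> M closure_of O1 \<union> (M closure_of O2 \<union> R)"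
        using OW(1) by (metis Un_iff closure_of_Un)
    qed (use clF' in \<open>auto simp: R_def F_def\<close>)
    moreover have "p1 \<in> M closure_of O1" "p2 \<in> M closure_of O2"
      using p1O p2O closure_of_subset O1 O2 openin_subset by (meson subsetD)+
    ultimately show ?thesis unfolding Sep_def using clR
      by (intro exI[of _ "M closure_of O1"] exI[of _ "M closure_of O2 \<union> R"]) auto
  qed (use start in simp)
  then obtain t' where "t' < s" "Sep t'" using down sle by blast
  then have "t' \<in> T" using sle by (simp add: T_def)
  then show False using cInf_lower[OF _ bT] \<open>t' < s\<close> unfolding s_def by force
qed


section \<open>Working in charts\<close>

lemma chartD:
  assumes "chart M c"
  shows chart_openin: "openin M (fst c)"
    and chart_open_image: "open (snd c ` fst c)"
    and chart_inv_left: "\<And>p. p \<in> fst c \<Longrightarrow> chart_inv c (snd c p) = p"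
    and chart_inv_right: "\<And>u. u \<in> snd c ` fst c \<Longrightarrow> snd c (chart_inv c u) = u"
    and chart_inv_in: "\<And>u. u \<in> snd c ` fst c \<Longrightarrow> chart_inv c u \<in> fst c"
    and chart_continuous: "continuous_map (subtopology M (fst c)) (top_of_set (snd c ` fst c)) (snd c)"
    and chart_inv_continuous: "continuous_map (top_of_set (snd c ` fst c)) M (chart_inv c)"
proof -
  have o: "openin M (fst c)" "open (snd c ` fst c)"
    and h: "homeomorphic_map (subtopology M (fst c)) (top_of_set (snd c ` fst c)) (snd c)"
    using assms by (auto simp: chart_def)
  then show "openin M (fst c)" "open (snd c ` fst c)" by auto
  have top: "topspace (subtopology M (fst c)) = fst c" using openin_subset[OF o(1)] by auto
  obtain g where g: "homeomorphic_maps (subtopology M (fst c)) (top_of_set (snd c ` fst c)) (snd c) g"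
    using h homeomorphic_map_maps by blast
  then have gi: "\<And>p. p \<in> fst c \<Longrightarrow> g (snd c p) = p" using top by (auto simp: homeomorphic_maps_def)
  then have inj: "inj_on (snd c) (fst c)" by (metis inj_onI)
  then show inv: "\<And>p. p \<in> fst c \<Longrightarrow> chart_inv c (snd c p) = p" by (simp add: chart_inv_def)
  show "\<And>u. u \<in> snd c ` fst c \<Longrightarrow> snd c (chart_inv c u) = u" by (simp add: chart_inv_def f_inv_into_f)
  show "\<And>u. u \<in> snd c ` fst c \<Longrightarrow> chart_inv c u \<in> fst c" by (simp add: chart_inv_def inv_into_into)
  show "continuous_map (subtopology M (fst c)) (top_of_set (snd c ` fst c)) (snd c)"
    using h homeomorphic_imp_continuous_map by blast
  have "continuous_map (top_of_set (snd c ` fst c)) (subtopology M (fst c)) g"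
    using g by (auto simp: homeomorphic_maps_def)
  then have "continuous_map (top_of_set (snd c ` fst c)) M g" by (simp add: continuous_map_in_subtopology)
  then show "continuous_map (top_of_set (snd c ` fst c)) M (chart_inv c)"
    by (rule continuous_map_eq) (use gi inv in auto)
qed

lemma chart_inv_image_openin:
  assumes c: "chart M c" and T: "open T" "T \<subseteq> snd c ` fst c"
  shows "openin M (chart_inv c ` T)"
proof -
  have "openin (subtopology M (fst c)) {p \<in> topspace (subtopology M (fst c)). snd c p \<in> T}"
    by (rule openin_continuous_map_preimage[OF chart_continuous[OF c]]) (use T in \<open>simp add: open_subset\<close>)
  moreover have "{p \<in> topspace (subtopology M (fst c)). snd c p \<in> T} = chart_inv c ` T"
    using T(2) openin_subset[OF chart_openin[OF c]] chart_inv_left[OF c] chart_inv_right[OF c] chart_inv_in[OF c]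
    by (force simp: image_iff)
  ultimately show ?thesis using chart_openin[OF c] openin_trans_full by metis
qed

lemma chart_image_open:
  assumes c: "chart M c" and N: "openin M N"
  shows "open (snd c ` (fst c \<inter> N))"
proof -
  let ?V = "snd c ` fst c"
  have "openin (top_of_set ?V) {u \<in> topspace (top_of_set ?V). chart_inv c u \<in> N}"
    by (rule openin_continuous_map_preimage[OF chart_inv_continuous[OF c] N])
  moreover have "{u \<in> topspace (top_of_set ?V). chart_inv c u \<in> N} = snd c ` (fst c \<inter> N)"
    using chart_inv_left[OF c] chart_inv_right[OF c] chart_inv_in[OF c] by (force simp: image_iff)
  ultimately show ?thesis using chart_open_image[OF c] openin_open_eq by metis
qed

lemma chart_inv_image_connectedin:
  assumes c: "chart M c" and T: "connected T" "T \<subseteq> snd c ` fst c"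
  shows "connectedin M (chart_inv c ` T)"
  by (rule connectedin_continuous_map_image[OF chart_inv_continuous[OF c]])
    (use T in \<open>simp add: connectedin_subtopology\<close>)

lemma chart_inv_image_closure:
  assumes c: "chart M c" and u: "u \<in> snd c ` fst c" "u \<in> closure T" and T: "T \<subseteq> snd c ` fst c"
  shows "chart_inv c u \<in> M closure_of (chart_inv c ` T)"
  unfolding in_closure_of
proof (intro conjI allI impI)
  show "chart_inv c u \<in> topspace M"
    using chart_inv_in[OF c u(1)] openin_subset[OF chart_openin[OF c]] by blast
  fix N assume N: "chart_inv c u \<in> N \<and> openin M N"
  then have "u \<in> snd c ` (fst c \<inter> N)"
    using u(1) chart_inv_in[OF c u(1)] chart_inv_right[OF c u(1)] by (metis IntI image_eqI)
  moreover have "open (snd c ` (fst c \<inter> N))" using chart_image_open[OF c] N by blast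
  ultimately obtain t where "t \<in> T" "t \<in> snd c ` (fst c \<inter> N)"
    using u(2) by (metis closure_iff_nhds_not_empty disjoint_iff subset_refl)
  then obtain p where "p \<in> fst c" "p \<in> N" "t = snd c p" by blast
  then show "\<exists>y. y \<in> chart_inv c ` T \<and> y \<in> N"
    using chart_inv_left[OF c, of p] \<open>t \<in> T\<close> by (intro exI[of _ p]) force
qed

lemma continuous_map_chartwise:
  fixes f :: "'a \<Rightarrow> 'b::topological_space"
  assumes charts: "\<And>c. c \<in> B \<Longrightarrow> chart M c" and cover: "(\<Union>c\<in>B. fst c) = topspace M"
    and f: "\<And>c. c \<in> B \<Longrightarrow> continuous_on (snd c ` fst c) (f \<circ> chart_inv c)"
  shows "continuous_map M euclidean f"
  unfolding continuous_map_def
proof (intro conjI allI impI)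
  fix W :: "'b set" assume "openin euclidean W"
  then have W: "open W" by simp
  show "openin M {p \<in> topspace M. f p \<in> W}"
  proof (subst openin_subopen, clarify)
    fix p assume p: "p \<in> topspace M" "f p \<in> W"
    then obtain c where c: "c \<in> B" "p \<in> fst c" using cover by blast
    note ch = charts[OF c(1)]
    define T where "T = snd c ` fst c \<inter> (f \<circ> chart_inv c) -` W"
    have "open T" unfolding T_def
      using continuous_open_preimage[OF f[OF c(1)] chart_open_image[OF ch] W] .
    then have "openin M (chart_inv c ` T)" by (intro chart_inv_image_openin[OF ch]) (auto simp: T_def)
    moreover have "p \<in> chart_inv c ` T"
      using c(2) p(2) chart_inv_left[OF ch c(2)] by (intro image_eqI[of _ _ "snd c p"]) (auto simp: T_def)
    moreover have "chart_inv c ` T \<subseteq> {p \<in> topspace M. f p \<in> W}"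
      using chart_inv_in[OF ch] openin_subset[OF chart_openin[OF ch]] by (auto simp: T_def)
    ultimately show "\<exists>N. openin M N \<and> p \<in> N \<and> N \<subseteq> {p \<in> topspace M. f p \<in> W}" by blast
  qed
qed auto

lemma chart_change_derivative:
  fixes f :: "'a \<Rightarrow> 'b::real_normed_vector"
  assumes ch: "chart M c" "chart M c'" and p: "p \<in> fst c" "p \<in> fst c'"
    and \<tau>: "(snd c' \<circ> chart_inv c) differentiable (at (snd c p))"
    and f: "(f \<circ> chart_inv c') differentiable (at (snd c' p))"
  shows "((f \<circ> chart_inv c) has_derivative (\<lambda>w. frechet_derivative (f \<circ> chart_inv c') (at (snd c' p))
      (frechet_derivative (snd c' \<circ> chart_inv c) (at (snd c p)) w))) (at (snd c p))"
proof -
  let ?u = "snd c p" and ?u' = "snd c' p"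
  let ?\<tau> = "snd c' \<circ> chart_inv c"
  let ?W = "snd c ` (fst c \<inter> fst c')"
  have opW: "open ?W" using chart_image_open[OF ch(1) chart_openin[OF ch(2)]] .
  have uW: "?u \<in> ?W" using p by blast
  have \<tau>u: "?\<tau> ?u = ?u'" by (simp add: chart_inv_left[OF ch(1) p(1)])
  have same: "chart_inv c' (?\<tau> y) = chart_inv c y" if "y \<in> ?W" for y
    using that chart_inv_left[OF ch(1)] chart_inv_left[OF ch(2)] by auto
  have "(((f \<circ> chart_inv c') \<circ> ?\<tau>) has_derivative
      (frechet_derivative (f \<circ> chart_inv c') (at ?u') \<circ> frechet_derivative ?\<tau> (at ?u))) (at ?u)"
    by (rule diff_chain_at[OF has_derivative_frechet[OF \<tau>]]) (use f \<tau>u in \<open>simp add: has_derivative_frechet\<close>)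
  then have "((f \<circ> chart_inv c) has_derivative
      (frechet_derivative (f \<circ> chart_inv c') (at ?u') \<circ> frechet_derivative ?\<tau> (at ?u))) (at ?u)"
    by (rule has_derivative_transform_within_open[OF _ opW uW]) (use same in auto)
  then show ?thesis by (simp add: o_def)
qed

lemma locally_path_connected_chartwise:
  assumes charts: "\<And>c. c \<in> B \<Longrightarrow> chart M c" and cover: "(\<Union>c\<in>B. fst c) = topspace M"
  shows "locally_path_connected_space M"
  unfolding locally_path_connected_space
proof (intro allI impI)
  fix N p assume N: "openin M N \<and> p \<in> N"
  then obtain c where c: "c \<in> B" "p \<in> fst c" using cover openin_subset by blast
  note ch = charts[OF c(1)]
  have "open (snd c ` (fst c \<inter> N))" using chart_image_open[OF ch] N by blast
  moreover have "snd c p \<in> snd c ` (fst c \<inter> N)" using c N by blast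
  ultimately obtain e where e: "e > 0" "ball (snd c p) e \<subseteq> snd c ` (fst c \<inter> N)"
    using open_contains_ball by blast
  let ?U = "chart_inv c ` ball (snd c p) e"
  have "openin M ?U" using e(2) by (intro chart_inv_image_openin[OF ch]) auto
  moreover have "path_connectedin M ?U"
    by (rule path_connectedin_continuous_map_image[OF chart_inv_continuous[OF ch]])
      (use e(2) in \<open>auto simp: path_connectedin_subtopology convex_imp_path_connected\<close>)
  moreover have "p \<in> ?U" using e(1) chart_inv_left[OF ch c(2)] by (metis centre_in_ball image_eqI)
  moreover have "?U \<subseteq> N" using e(2) chart_inv_left[OF ch] by fastforce
  ultimately show "\<exists>U. openin M U \<and> path_connectedin M U \<and> p \<in> U \<and> U \<subseteq> N" by blast
qed


section \<open>Hypersurfaces whose normal field has few critical values\<close>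

text \<open>A hyperplane together with a transversal vector spans the space; the index \<open>None\<close> serves as
  the additional coordinate.\<close>

lemma hyperplane_decomposition:
  fixes A :: "real^'n \<Rightarrow> real^('n option)"
  assumes A: "linear A" "inj A" and N: "\<And>w. A w \<bullet> N = 0" and y0: "y0 \<bullet> N \<noteq> 0"
  obtains w t where "y = A w + t *\<^sub>R y0"
proof -
  define \<Psi> where "\<Psi> z = A (\<chi> i. z $ Some i) + (z $ None) *\<^sub>R y0" for z :: "real^('n option)"
  have "linear (\<lambda>z::real^('n option). \<chi> i. z $ Some i)"
    by (intro linearI) (simp_all add: vec_eq_iff)
  then have l1: "linear (\<lambda>z::real^('n option). A (\<chi> i. z $ Some i))"
    using linear_compose[OF _ A(1)] by (auto simp: o_def)
  have lin: "linear \<Psi>" unfolding \<Psi>_def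
    by (rule linear_compose_add[OF l1]) (auto intro!: linearI simp: scaleR_add_left)
  have "z = 0" if "\<Psi> z = 0" for z
  proof -
    have "\<Psi> z \<bullet> N = z $ None * (y0 \<bullet> N)" by (simp add: \<Psi>_def inner_add_left N)
    then have z0: "z $ None = 0" using that y0 by simp
    then have "A (\<chi> i. z $ Some i) = A 0" using that linear_0[OF A(1)] by (simp add: \<Psi>_def)
    then have "(\<chi> i. z $ Some i) = 0" using A(2) by (simp add: inj_eq)
    then have "z $ Some i = 0" for i by (simp add: vec_eq_iff)
    then show ?thesis using z0 by (simp add: vec_eq_iff) (metis option.exhaust)
  qed
  then have "inj \<Psi>" using linear_injective_0[OF lin] by blast
  then have "surj \<Psi>" using linear_injective_imp_surjective[OF lin] by blast
  then obtain z where "y = \<Psi> z" by (metis surjD)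
  then show ?thesis using that by (simp add: \<Psi>_def)
qed

text \<open>The orthogonal complement of a hyperplane is the line of its normals.\<close>

lemma normal_line:
  fixes A :: "real^'n \<Rightarrow> real^('n option)"
  assumes A: "linear A" "inj A" and N: "\<And>w. A w \<bullet> N = 0" "norm N = 1" and y: "\<And>w. A w \<bullet> y = 0"
  shows "y = (y \<bullet> N) *\<^sub>R N"
proof -
  have NN: "N \<bullet> N = 1" using N(2) by (simp add: dot_square_norm)
  obtain w t where wt: "y = A w + t *\<^sub>R N"
    using hyperplane_decomposition[OF A N(1), of N y] NN by force
  have "A w \<bullet> A w = 0" using y[of w] N(1)[of w] by (simp add: wt inner_add_right)
  then have "y = t *\<^sub>R N" using wt by simp
  then show ?thesis using NN by simp
qed

lemma positive_inner_open:
  fixes P Q :: "'a::euclidean_space \<Rightarrow> 'a \<Rightarrow> 'b::euclidean_space"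
  assumes U: "open U" "u0 \<in> U" and lin: "\<And>u. u \<in> U \<Longrightarrow> linear (P u)" "\<And>u. u \<in> U \<Longrightarrow> linear (Q u)"
    and cont: "\<And>b. continuous_on U (\<lambda>u. P u b)" "\<And>b. continuous_on U (\<lambda>u. Q u b)"
    and pos: "\<And>w. w \<noteq> 0 \<Longrightarrow> 0 < P u0 w \<bullet> Q u0 w"
  obtains d where "0 < d" "ball u0 d \<subseteq> U" "\<And>u w. u \<in> ball u0 d \<Longrightarrow> w \<noteq> 0 \<Longrightarrow> 0 < P u w \<bullet> Q u w"
proof -
  have expand: "P u w \<bullet> Q u w = (\<Sum>b\<in>Basis. (w \<bullet> b) *\<^sub>R P u b) \<bullet> (\<Sum>b\<in>Basis. (w \<bullet> b) *\<^sub>R Q u b)"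
    if "u \<in> U" for u w
    using linear_Basis_expansion[OF lin(1)[OF that], of w] linear_Basis_expansion[OF lin(2)[OF that], of w] by simp
  have "continuous_on (U \<times> UNIV) (\<lambda>z::'a\<times>'a.
     (\<Sum>b\<in>Basis. (snd z \<bullet> b) *\<^sub>R P (fst z) b) \<bullet> (\<Sum>b\<in>Basis. (snd z \<bullet> b) *\<^sub>R Q (fst z) b))"
    by (intro continuous_intros continuous_on_compose2[OF cont(1)] continuous_on_compose2[OF cont(2)]) auto
  then have c: "continuous_on (U \<times> UNIV) (\<lambda>z. P (fst z) (snd z) \<bullet> Q (fst z) (snd z))"
    by (elim continuous_on_eq) (auto simp: expand)
  have pos1: "0 < P u0 w \<bullet> Q u0 w" if "norm w = 1" for w
    using pos that by (metis norm_zero zero_neq_one)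
  obtain d where d: "0 < d" "ball u0 d \<subseteq> U" "\<And>u w. u \<in> ball u0 d \<Longrightarrow> norm w = 1 \<Longrightarrow> 0 < P u w \<bullet> Q u w"
    using positive_form_open[OF U c pos1] by metis
  have "0 < P u w \<bullet> Q u w" if u: "u \<in> ball u0 d" and w: "w \<noteq> 0" for u w
  proof -
    have uU: "u \<in> U" using u d by blast
    have w': "w = norm w *\<^sub>R sgn w" using w by (simp add: sgn_div_norm)
    have "P u (norm w *\<^sub>R sgn w) \<bullet> Q u (norm w *\<^sub>R sgn w) = norm w * (norm w * (P u (sgn w) \<bullet> Q u (sgn w)))"
      by (simp only: linear_scale[OF lin(1)[OF uU]] linear_scale[OF lin(2)[OF uU]] inner_scaleR_left inner_scaleR_right)
    then have "P u w \<bullet> Q u w = norm w * (norm w * (P u (sgn w) \<bullet> Q u (sgn w)))" using w' by simp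
    then show ?thesis using d(3)[OF u, of "sgn w"] w by (simp add: norm_sgn)
  qed
  then show ?thesis using that d by auto
qed

locale normal_field =
  fixes M :: "'a topology" and B :: "('a set \<times> ('a \<Rightarrow> real^'n::finite)) set"
    and x G :: "'a \<Rightarrow> real^('n option)"
  assumes charts: "\<And>c. c \<in> B \<Longrightarrow> chart M c" and cover: "(\<Union>c\<in>B. fst c) = topspace M"
    and transition: "\<And>c c' u. c \<in> B \<Longrightarrow> c' \<in> B \<Longrightarrow> u \<in> snd c ` (fst c \<inter> fst c') \<Longrightarrow>
       (snd c' \<circ> chart_inv c) differentiable (at u)"
    and x_C2: "\<And>c. c \<in> B \<Longrightarrow> C_k_on 2 (snd c ` fst c) (x \<circ> chart_inv c)"
    and G_C1: "\<And>c. c \<in> B \<Longrightarrow> C_k_on 1 (snd c ` fst c) (G \<circ> chart_inv c)"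
    and immersion: "\<And>c u. c \<in> B \<Longrightarrow> u \<in> snd c ` fst c \<Longrightarrow> inj (frechet_derivative (x \<circ> chart_inv c) (at u))"
    and unit: "\<And>p. p \<in> topspace M \<Longrightarrow> norm (G p) = 1"
    and normal: "\<And>c u w. c \<in> B \<Longrightarrow> u \<in> snd c ` fst c \<Longrightarrow>
       frechet_derivative (x \<circ> chart_inv c) (at u) w \<bullet> G (chart_inv c u) = 0"
begin

definition "X c = x \<circ> chart_inv c"
definition "N c = G \<circ> chart_inv c"
definition "V c = snd c ` fst c"

abbreviation "DX c u \<equiv> frechet_derivative (X c) (at u)"
abbreviation "DN c u \<equiv> frechet_derivative (N c) (at u)"

text \<open>The second fundamental form in a chart, with the sign for which it is positive on a sphere with
  outward normal.\<close>

definition "II c u v w = DX c u v \<bullet> DN c u w"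

lemma openV: "c \<in> B \<Longrightarrow> open (V c)"
  unfolding V_def by (rule chart_open_image[OF charts])

lemma XC2: "c \<in> B \<Longrightarrow> C_k_on 2 (V c) (X c)" and NC1: "c \<in> B \<Longrightarrow> C_k_on 1 (V c) (N c)"
  using x_C2 G_C1 by (simp_all add: X_def N_def V_def)

lemma Xd: "c \<in> B \<Longrightarrow> u \<in> V c \<Longrightarrow> X c differentiable (at u)"
  and Nd: "c \<in> B \<Longrightarrow> u \<in> V c \<Longrightarrow> N c differentiable (at u)"
  using C2_D(1)[OF XC2] NC1[of c] by auto

lemma DXc: "c \<in> B \<Longrightarrow> continuous_on (V c) (\<lambda>u. DX c u w)"
  and DNc: "c \<in> B \<Longrightarrow> continuous_on (V c) (\<lambda>u. DN c u w)"
  using C_k_on_SucD[of 1 "V c" "X c"] XC2[of c] NC1[of c] by (auto simp: numeral_2_eq_2)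

lemma topspace_if: "c \<in> B \<Longrightarrow> p \<in> fst c \<Longrightarrow> p \<in> topspace M"
  using cover by blast

lemma inv_top: "c \<in> B \<Longrightarrow> u \<in> V c \<Longrightarrow> chart_inv c u \<in> topspace M"
  using chart_inv_in[OF charts] topspace_if V_def by metis

lemma N_unit: "c \<in> B \<Longrightarrow> u \<in> V c \<Longrightarrow> norm (N c u) = 1"
  using unit inv_top by (simp add: N_def)

lemma DX_inj: "c \<in> B \<Longrightarrow> u \<in> V c \<Longrightarrow> inj (DX c u)"
  using immersion by (simp add: X_def V_def)

lemma DX_lin: "c \<in> B \<Longrightarrow> u \<in> V c \<Longrightarrow> linear (DX c u)" and DN_lin: "c \<in> B \<Longrightarrow> u \<in> V c \<Longrightarrow> linear (DN c u)"
  using linear_frechet Xd Nd by blast+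

lemma DX_N: "c \<in> B \<Longrightarrow> u \<in> V c \<Longrightarrow> DX c u w \<bullet> N c u = 0"
  using normal by (simp add: X_def V_def N_def)

lemma X_eq: "c \<in> B \<Longrightarrow> p \<in> fst c \<Longrightarrow> X c (snd c p) = x p"
  and N_eq: "c \<in> B \<Longrightarrow> p \<in> fst c \<Longrightarrow> N c (snd c p) = G p"
  by (simp_all add: X_def N_def chart_inv_left[OF charts])

lemma V_in: "p \<in> fst c \<Longrightarrow> snd c p \<in> V c"
  by (simp add: V_def)

lemma chart_around:
  assumes "p \<in> topspace M" obtains c where "c \<in> B" "p \<in> fst c" "snd c p \<in> V c"
proof -
  obtain c where c: "c \<in> B" "p \<in> fst c" using assms unfolding cover[symmetric] by (elim UN_E)
  then show thesis by (intro that[of c] V_in)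
qed

lemma x_continuous: "continuous_map M euclidean x"
proof (rule continuous_map_chartwise[OF charts cover])
  show "continuous_on (snd c ` fst c) (x \<circ> chart_inv c)" if "c \<in> B" for c
    using C_k_on_imp_continuous_on[OF XC2[OF that]] by (simp add: X_def V_def)
qed

lemma G_continuous: "continuous_map M euclidean G"
proof (rule continuous_map_chartwise[OF charts cover])
  show "continuous_on (snd c ` fst c) (G \<circ> chart_inv c)" if "c \<in> B" for c
    using C_k_on_imp_continuous_on[OF NC1[OF that]] by (simp add: N_def V_def)
qed

text \<open>Differentiating the orthogonality of tangent vectors and normal.\<close>

lemma II_second_derivative:
  assumes c: "c \<in> B" and u: "u \<in> V c"
  shows "second_derivative (X c) u v w \<bullet> N c u = - II c u v w"
proof -
  have "((\<lambda>y. DX c y v \<bullet> N c y) has_derivative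
      (\<lambda>w. DX c u v \<bullet> DN c u w + second_derivative (X c) u v w \<bullet> N c u)) (at u)"
    by (intro has_derivative_inner has_derivative_frechet C2_D[OF XC2[OF c] u] Nd[OF c u])
  moreover have "((\<lambda>y. DX c y v \<bullet> N c y) has_derivative (\<lambda>w. 0)) (at u)"
    by (rule has_derivative_transform_within_open[OF has_derivative_const openV[OF c] u])
      (simp add: DX_N[OF c])
  ultimately have "DX c u v \<bullet> DN c u w + second_derivative (X c) u v w \<bullet> N c u = 0"
    using has_derivative_unique by (metis (no_types, lifting))
  then show ?thesis by (simp add: II_def)
qed

lemma II_sym: "c \<in> B \<Longrightarrow> u \<in> V c \<Longrightarrow> II c u v w = II c u w v"
  using II_second_derivative[of c u v w] II_second_derivative[of c u w v]
    second_derivative_symmetric[OF openV[of c] XC2[of c], of u v w] by simp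

lemma DN_N:
  assumes c: "c \<in> B" and u: "u \<in> V c"
  shows "DN c u w \<bullet> N c u = 0"
proof -
  have "((\<lambda>y. N c y \<bullet> N c y) has_derivative (\<lambda>w. N c u \<bullet> DN c u w + DN c u w \<bullet> N c u)) (at u)"
    by (intro has_derivative_inner has_derivative_frechet Nd[OF c u])
  moreover have "((\<lambda>y. N c y \<bullet> N c y) has_derivative (\<lambda>w. 0)) (at u)"
    by (rule has_derivative_transform_within_open[OF has_derivative_const openV[OF c] u, of 1])
      (simp add: N_unit[OF c] dot_square_norm)
  ultimately have "N c u \<bullet> DN c u w + DN c u w \<bullet> N c u = 0"
    using has_derivative_unique by (metis (no_types, lifting))
  then show ?thesis by (simp add: inner_commute)
qed

lemma II_add: "c \<in> B \<Longrightarrow> u \<in> V c \<Longrightarrow> II c u (v + v') w = II c u v w + II c u v' w"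
  and II_scale: "c \<in> B \<Longrightarrow> u \<in> V c \<Longrightarrow> II c u (a *\<^sub>R v) w = a * II c u v w"
  and II_add2: "c \<in> B \<Longrightarrow> u \<in> V c \<Longrightarrow> II c u w (v + v') = II c u w v + II c u w v'"
  and II_scale2: "c \<in> B \<Longrightarrow> u \<in> V c \<Longrightarrow> II c u w (a *\<^sub>R v) = a * II c u w v"
  using linear_add[OF DX_lin] linear_scale[OF DX_lin] linear_add[OF DN_lin] linear_scale[OF DN_lin]
  by (simp_all add: II_def inner_add_left inner_add_right)


section \<open>Positive definiteness of the second fundamental form\<close>

definition "posdef c u \<longleftrightarrow> (\<forall>w. w \<noteq> 0 \<longrightarrow> 0 < II c u w w)"

text \<open>The differentials in two charts differ by the differential of the transition map. The latter is injective
  because the immersion is.\<close>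

lemma chart_change:
  assumes c: "c \<in> B" "p \<in> fst c" and c': "c' \<in> B" "p \<in> fst c'"
  obtains \<tau>' where "\<And>w. w \<noteq> 0 \<Longrightarrow> \<tau>' w \<noteq> 0" "\<And>w. DX c (snd c p) w = DX c' (snd c' p) (\<tau>' w)"
    "\<And>w. DN c (snd c p) w = DN c' (snd c' p) (\<tau>' w)"
proof -
  let ?\<tau>' = "frechet_derivative (snd c' \<circ> chart_inv c) (at (snd c p))"
  have \<tau>: "(snd c' \<circ> chart_inv c) differentiable (at (snd c p))" using transition[OF c(1) c'(1)] c(2) c'(2) by blast
  have u: "snd c p \<in> V c" and u': "snd c' p \<in> V c'" using V_in[OF c(2)] V_in[OF c'(2)] by simp_all
  note change = chart_change_derivative[OF charts[OF c(1)] charts[OF c'(1)] c(2) c'(2) \<tau>]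
  have 1: "DX c (snd c p) w = DX c' (snd c' p) (?\<tau>' w)" for w
    using fun_cong[OF frechet_derivative_eqI[OF change[of x]]] Xd[OF c'(1) u'] unfolding X_def by blast
  have 2: "DN c (snd c p) w = DN c' (snd c' p) (?\<tau>' w)" for w
    using fun_cong[OF frechet_derivative_eqI[OF change[of G]]] Nd[OF c'(1) u'] unfolding N_def by blast
  have 3: "?\<tau>' w \<noteq> 0" if "w \<noteq> 0" for w
  proof -
    have "DX c (snd c p) w \<noteq> 0"
      using that DX_inj[OF c(1) u] linear_0[OF DX_lin[OF c(1) u]] by (metis injD)
    then show ?thesis using 1 linear_0[OF DX_lin[OF c'(1) u']] by metis
  qed
  show ?thesis by (rule that[OF 3 1 2])
qed

lemma posdef_chart_independent:
  assumes c: "c \<in> B" "p \<in> fst c" and c': "c' \<in> B" "p \<in> fst c'" and pos: "posdef c' (snd c' p)"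
  shows "posdef c (snd c p)"
proof -
  obtain \<tau>' where "\<And>w. w \<noteq> 0 \<Longrightarrow> \<tau>' w \<noteq> 0" "\<And>w. DX c (snd c p) w = DX c' (snd c' p) (\<tau>' w)"
    "\<And>w. DN c (snd c p) w = DN c' (snd c' p) (\<tau>' w)" using chart_change[OF c c'] by metis
  then show ?thesis using pos by (simp add: posdef_def II_def)
qed

text \<open>The points where the second fundamental form is positive definite, that is, where \<open>G\<close> is an outward
  normal of a locally strictly convex hypersurface.\<close>

definition "D = {p \<in> topspace M. \<exists>c\<in>B. p \<in> fst c \<and> posdef c (snd c p)}"

lemma D_posdef: "p \<in> D \<Longrightarrow> c \<in> B \<Longrightarrow> p \<in> fst c \<Longrightarrow> posdef c (snd c p)"
  unfolding D_def using posdef_chart_independent by blast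

lemma D_I: "c \<in> B \<Longrightarrow> u \<in> V c \<Longrightarrow> posdef c u \<Longrightarrow> chart_inv c u \<in> D"
  using inv_top[of c u] chart_inv_in[OF charts, of c u] chart_inv_right[OF charts, of c u]
  by (auto simp: D_def V_def intro!: bexI[of _ c])

lemma openin_chartwise:
  assumes "\<And>p. p \<in> E \<Longrightarrow> \<exists>c\<in>B. \<exists>d>0. p \<in> fst c \<and> ball (snd c p) d \<subseteq> V c \<and> chart_inv c ` ball (snd c p) d \<subseteq> E"
  shows "openin M E"
proof (subst openin_subopen, rule ballI)
  fix p assume "p \<in> E"
  then obtain c d where c: "c \<in> B" "d > 0" "p \<in> fst c" "ball (snd c p) d \<subseteq> V c" "chart_inv c ` ball (snd c p) d \<subseteq> E"
    using assms by blast
  have "openin M (chart_inv c ` ball (snd c p) d)"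
    using c(4) by (intro chart_inv_image_openin[OF charts[OF c(1)]]) (auto simp: V_def)
  moreover have "p \<in> chart_inv c ` ball (snd c p) d"
    using c(2) chart_inv_left[OF charts[OF c(1)] c(3)] by (metis centre_in_ball image_eqI)
  ultimately show "\<exists>T. openin M T \<and> p \<in> T \<and> T \<subseteq> E" using c(5) by blast
qed

lemma D_openin: "openin M D"
proof (rule openin_chartwise)
  fix p assume p: "p \<in> D"
  then have "p \<in> topspace M" by (simp add: D_def)
  then obtain c where c: "c \<in> B" "p \<in> fst c" "snd c p \<in> V c" by (rule chart_around)
  have pos: "0 < DX c (snd c p) w \<bullet> DN c (snd c p) w" if "w \<noteq> 0" for w
    using D_posdef[OF p c(1,2)] that by (simp add: posdef_def II_def)
  obtain d where d: "0 < d" "ball (snd c p) d \<subseteq> V c"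
    "\<And>u w. u \<in> ball (snd c p) d \<Longrightarrow> w \<noteq> 0 \<Longrightarrow> 0 < DX c u w \<bullet> DN c u w"
    using positive_inner_open[OF openV[OF c(1)] c(3) DX_lin[OF c(1)] DN_lin[OF c(1)] DXc[OF c(1)] DNc[OF c(1)] pos]
    by metis
  then have "posdef c u" if "u \<in> ball (snd c p) d" for u
    using that by (simp add: posdef_def II_def)
  then have "chart_inv c ` ball (snd c p) d \<subseteq> D" using D_I[OF c(1)] d(2) by blast
  then show "\<exists>c\<in>B. \<exists>d>0. p \<in> fst c \<and> ball (snd c p) d \<subseteq> V c \<and> chart_inv c ` ball (snd c p) d \<subseteq> D"
    using c d by blast
qed

text \<open>The regular points of the normal field.\<close>

definition "R = {p \<in> topspace M. \<exists>c\<in>B. p \<in> fst c \<and> inj (DN c (snd c p))}"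

lemma R_inj:
  assumes "p \<in> R" and c: "c \<in> B" "p \<in> fst c"
  shows "inj (DN c (snd c p))"
proof -
  obtain c' where c': "c' \<in> B" "p \<in> fst c'" "inj (DN c' (snd c' p))" using assms(1) by (auto simp: R_def)
  obtain \<tau>' where \<tau>': "\<And>w. w \<noteq> 0 \<Longrightarrow> \<tau>' w \<noteq> 0" "\<And>w. DN c (snd c p) w = DN c' (snd c' p) (\<tau>' w)"
    using chart_change[OF c c'(1,2)] by metis
  note l = DN_lin[OF c(1) V_in[OF c(2)]] and l' = DN_lin[OF c'(1) V_in[OF c'(2)]]
  have "w = 0" if "DN c (snd c p) w = 0" for w
  proof -
    have "\<tau>' w = 0" using that c'(3) unfolding \<tau>'(2) linear_injective_0[OF l'] by simp
    then show ?thesis using \<tau>'(1) by blast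
  qed
  then show ?thesis unfolding linear_injective_0[OF l] by simp
qed

lemma R_openin: "openin M R"
proof (rule openin_chartwise)
  fix p assume p: "p \<in> R"
  then have "p \<in> topspace M" by (simp add: R_def)
  then obtain c where c: "c \<in> B" "p \<in> fst c" "snd c p \<in> V c" by (rule chart_around)
  have pos: "0 < DN c (snd c p) w \<bullet> DN c (snd c p) w" if "w \<noteq> 0" for w
    using R_inj[OF p c(1,2)] that linear_injective_0[OF DN_lin[OF c(1,3)]] by auto
  obtain d where d: "0 < d" "ball (snd c p) d \<subseteq> V c"
    "\<And>u w. u \<in> ball (snd c p) d \<Longrightarrow> w \<noteq> 0 \<Longrightarrow> 0 < DN c u w \<bullet> DN c u w"
    using positive_inner_open[OF openV[OF c(1)] c(3) DN_lin[OF c(1)] DN_lin[OF c(1)] DNc[OF c(1)] DNc[OF c(1)] pos]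
    by metis
  have "chart_inv c u \<in> R" if u: "u \<in> ball (snd c p) d" for u
  proof -
    have uV: "u \<in> V c" using u d(2) by blast
    have "inj (DN c u)" using d(3)[OF u] linear_injective_0[OF DN_lin[OF c(1) uV]] by force
    then show ?thesis
      using inv_top[OF c(1) uV] chart_inv_in[OF charts[OF c(1)]] chart_inv_right[OF charts[OF c(1)]] uV c(1)
      by (auto simp: R_def V_def intro!: bexI[of _ c])
  qed
  then show "\<exists>c\<in>B. \<exists>d>0. p \<in> fst c \<and> ball (snd c p) d \<subseteq> V c \<and> chart_inv c ` ball (snd c p) d \<subseteq> R"
    using c d by blast
qed

end

text \<open>A compact connected hypersurface together with a null set \<open>S\<close> containing the critical values of
  its normal field. The set \<open>S\<close> is taken symmetric about the origin, so that the hypotheses are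
  preserved when \<open>G\<close> is replaced by \<open>- G\<close>.\<close>

locale hypersurface = normal_field M B x G
  for M :: "'a topology" and B :: "('a set \<times> ('a \<Rightarrow> real^'n::finite)) set"
    and x G :: "'a \<Rightarrow> real^('n option)" +
  fixes S :: "(real^('n option)) set" and m :: nat
  assumes haus: "Hausdorff_space M" and cpt: "compact_space M" and con: "connected_space M"
    and ne: "topspace M \<noteq> {}"
    and S_compact: "compact S" and S_null: "ball_null m S" and S_sym: "\<And>y. y \<in> S \<Longrightarrow> - y \<in> S"
    and regular: "\<And>c p. c \<in> B \<Longrightarrow> p \<in> fst c \<Longrightarrow> G p \<notin> S \<Longrightarrow>
       inj (frechet_derivative (G \<circ> chart_inv c) (at (snd c p)))"
    and rank: "\<And>p. p \<in> topspace M \<Longrightarrow> \<exists>c\<in>B. p \<in> fst c \<and>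
       Suc m \<le> dim (range (frechet_derivative (G \<circ> chart_inv c) (at (snd c p))))"
    and dim: "2 \<le> CARD('n)"
begin

text \<open>A limit of positive definite forms is semidefinite, and where the normal field is regular it is
  nondegenerate; so definiteness can be lost only at a critical point of the normal field.\<close>

lemma D_closed_at_regular_points:
  assumes p: "p \<in> topspace M" "G p \<notin> S" "p \<in> M closure_of D"
  shows "p \<in> D"
proof -
  obtain c where c: "c \<in> B" "p \<in> fst c" "snd c p \<in> V c" using p(1) by (rule chart_around)
  let ?u = "snd c p"
  define E where "E = {u \<in> V c. posdef c u}"
  have clE: "?u \<in> closure E"
    unfolding closure_approachable
  proof (intro allI impI)
    fix e :: real assume "e > 0"
    let ?T = "ball ?u e \<inter> V c"
    have "openin M (chart_inv c ` ?T)"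
      using openV[OF c(1)] by (intro chart_inv_image_openin[OF charts[OF c(1)]]) (auto simp: V_def)
    moreover have "p \<in> chart_inv c ` ?T"
      using \<open>e > 0\<close> c chart_inv_left[OF charts[OF c(1)] c(2)] by (intro image_eqI[of _ _ ?u]) auto
    ultimately obtain q where "q \<in> D" "q \<in> chart_inv c ` ?T" using p(3) unfolding in_closure_of by meson
    then obtain u where u: "u \<in> ?T" "chart_inv c u \<in> D" by (elim imageE) simp
    then have "posdef c (snd c (chart_inv c u))"
      using D_posdef c(1) chart_inv_in[OF charts[OF c(1)]] by (simp add: V_def)
    then have "u \<in> E" using u(1) chart_inv_right[OF charts[OF c(1)]] by (simp add: E_def V_def)
    then show "\<exists>y\<in>E. dist y ?u < e" using u(1) by (auto simp: dist_commute)
  qed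
  have nonneg: "0 \<le> II c ?u w w" for w
  proof (rule ccontr)
    assume "\<not> 0 \<le> II c ?u w w"
    have "continuous_on (V c) (\<lambda>u. II c u w w)"
      unfolding II_def by (intro continuous_intros DXc DNc c)
    then have "open (V c \<inter> (\<lambda>u. II c u w w) -` {..<0})"
      by (rule continuous_open_preimage) (use openV[OF c(1)] in auto)
    moreover have "?u \<in> V c \<inter> (\<lambda>u. II c u w w) -` {..<0}" using \<open>\<not> 0 \<le> II c ?u w w\<close> c(3) by simp
    ultimately have "(V c \<inter> (\<lambda>u. II c u w w) -` {..<0}) \<inter> E \<noteq> {}"
      using clE open_Int_closure_eq_empty by blast
    then obtain y where y: "y \<in> E" "II c y w w < 0" by auto
    then have "w \<noteq> 0" using linear_0[OF DX_lin[OF c(1)]] by (auto simp: E_def II_def)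
    then show False using y by (force simp: E_def posdef_def)
  qed
  have "0 < II c ?u w w" if w: "w \<noteq> 0" for w
  proof (rule ccontr)
    assume "\<not> 0 < II c ?u w w"
    then have z: "II c ?u w w = 0" using nonneg[of w] by linarith
    have "II c ?u v w = 0" for v
    proof (rule ccontr)
      assume nz: "II c ?u v w \<noteq> 0"
      define a where "a = II c ?u v w"
      define b where "b = II c ?u v v"
      \<comment> \<open>the value of the form on \<open>v + t w\<close> is \<open>b + 2 a t\<close>, which takes negative values\<close>
      have "II c ?u (v + t *\<^sub>R w) (v + t *\<^sub>R w) = b + 2 * t * a" for t
        using II_sym[OF c(1,3), of w v] z
        by (simp add: II_add[OF c(1,3)] II_add2[OF c(1,3)] II_scale[OF c(1,3)] II_scale2[OF c(1,3)] a_def b_def)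
      then have "0 \<le> b + 2 * (-(b + 1) / (2 * a)) * a" using nonneg by metis
      then show False using nz by (simp add: a_def field_simps)
    qed
    then have "DX c ?u v \<bullet> DN c ?u w = 0" for v by (simp add: II_def)
    from normal_line[OF DX_lin[OF c(1,3)] DX_inj[OF c(1,3)] DX_N[OF c(1,3)] N_unit[OF c(1,3)] this]
    have "DN c ?u w = 0" using DN_N[OF c(1,3)] by simp
    moreover have "inj (DN c ?u)" using regular[OF c(1,2) p(2)] by (simp add: N_def)
    ultimately show False using w linear_0[OF DN_lin[OF c(1,3)]] by (metis injD)
  qed
  then show ?thesis using c p(1) by (auto simp: D_def posdef_def)
qed

definition "L = {p \<in> topspace M. G p \<in> S}"

lemma L_closed: "closedin M L"
  unfolding L_def using closedin_continuous_map_preimage[OF G_continuous, of S] S_compact compact_imp_closed by auto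

text \<open>The rank condition makes \<open>L\<close> small: it bounds the dimension of the fibres of \<open>G\<close>.\<close>

lemma L_nonseparating: "connectedin M (topspace M - L)" "M closure_of (topspace M - L) = topspace M"
proof -
  have loc: "\<exists>T. openin M T \<and> p \<in> T \<and> connectedin M (T - L) \<and> T \<subseteq> M closure_of (T - L)" if "p \<in> L" for p
  proof -
    have "p \<in> topspace M" using that by (simp add: L_def)
    then obtain c where c: "c \<in> B" "p \<in> fst c" "Suc m \<le> dim (range (DN c (snd c p)))"
      using rank unfolding N_def by blast
    obtain W where W: "open W" "snd c p \<in> W" "W \<subseteq> V c" "connected (W - N c -` S)" "W \<subseteq> closure (W - N c -` S)"
      using preimage_null_set_nonseparating[OF openV[OF c(1)] NC1[OF c(1)] V_in[OF c(2)] c(3) S_null S_compact] by metis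
    let ?T = "chart_inv c ` W"
    have eq: "?T - L = chart_inv c ` (W - N c -` S)"
    proof (intro set_eqI iffI)
      fix q assume "q \<in> ?T - L"
      then obtain u where u: "u \<in> W" "q = chart_inv c u" "q \<notin> L" by blast
      then have "N c u \<notin> S" using inv_top[OF c(1)] W(3) by (auto simp: L_def N_def)
      then show "q \<in> chart_inv c ` (W - N c -` S)" using u by blast
    next
      fix q assume "q \<in> chart_inv c ` (W - N c -` S)"
      then show "q \<in> ?T - L" by (auto simp: L_def N_def)
    qed
    note ch = charts[OF c(1)]
    have "openin M ?T" using W(1,3) by (intro chart_inv_image_openin[OF ch]) (auto simp: V_def)
    moreover have "p \<in> ?T" using W(2) chart_inv_left[OF ch c(2)] by (metis image_eqI)
    moreover have "connectedin M (?T - L)"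
      unfolding eq using W(3,4) by (intro chart_inv_image_connectedin[OF ch]) (auto simp: V_def)
    moreover have "?T \<subseteq> M closure_of (?T - L)"
      unfolding eq using W(3,5) by (auto simp: V_def intro!: chart_inv_image_closure[OF ch])
    ultimately show ?thesis by blast
  qed
  show "connectedin M (topspace M - L)" by (rule connected_minus_nonseparating(1)[OF con L_closed loc])
  show "M closure_of (topspace M - L) = topspace M"
    by (rule connected_minus_nonseparating(2)[OF con L_closed loc])
qed

text \<open>The set \<open>D\<close> is open and closed relative to \<open>M - L\<close>, which is connected and dense.\<close>

lemma D_everywhere:
  assumes "D \<noteq> {}"
  shows "topspace M - L \<subseteq> D"
proof (rule ccontr)
  assume no: "\<not> topspace M - L \<subseteq> D"
  define E where "E = topspace M - M closure_of D"
  have opE: "openin M E" by (auto simp: E_def)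
  have Dt: "D \<subseteq> topspace M" by (auto simp: D_def)
  have cov: "topspace M - L \<subseteq> D \<union> E"
    using D_closed_at_regular_points by (auto simp: E_def L_def)
  have dis: "D \<inter> E = {}" using closure_of_subset[OF Dt] by (auto simp: E_def)
  have "D \<inter> (topspace M - L) \<noteq> {}"
  proof -
    obtain p where p: "p \<in> D" using assms by blast
    then have "p \<in> M closure_of (topspace M - L)" using L_nonseparating(2) Dt by blast
    then show ?thesis using p D_openin unfolding in_closure_of by blast
  qed
  moreover have "E \<inter> (topspace M - L) \<noteq> {}" using no cov by blast
  ultimately show False using connectedinD[OF L_nonseparating(1) D_openin opE cov] dis by blast
qed

text \<open>At a point farthest from the origin the hypersurface touches a sphere from inside. The position
  vector there is \<open>s\<close> times the normal, and the sign of \<open>s\<close> is the sign of the form.\<close>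

lemma definite_somewhere:
  obtains c u where "c \<in> B" "u \<in> V c" "posdef c u \<or> (\<forall>w. w \<noteq> 0 \<longrightarrow> II c u w w < 0)"
proof -
  have "compact (x ` topspace M)"
    using image_compactin[OF _ x_continuous] cpt unfolding compact_space_def by (simp add: compactin_euclidean_iff)
  then have "compact ((\<lambda>y. y \<bullet> y) ` (x ` topspace M))"
    by (intro compact_continuous_image continuous_intros)
  then obtain p where p: "p \<in> topspace M" "\<And>q. q \<in> topspace M \<Longrightarrow> x q \<bullet> x q \<le> x p \<bullet> x p"
    using compact_attains_sup[of "(\<lambda>y. y \<bullet> y) ` (x ` topspace M)"] ne by auto
  obtain c where c: "c \<in> B" "p \<in> fst c" "snd c p \<in> V c" using p(1) by (rule chart_around)
  let ?u = "snd c p"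
  define f where "f u = X c u \<bullet> X c u" for u
  have fC: "C_k_on 2 (V c) f" unfolding f_def
    by (intro C_k_on_bilinear[OF bounded_bilinear_inner openV[OF c(1)]] XC2 c)
  have Df: "frechet_derivative f (at y) w = 2 * (X c y \<bullet> DX c y w)" if "y \<in> V c" for y w
  proof -
    have "(f has_derivative (\<lambda>w. X c y \<bullet> DX c y w + DX c y w \<bullet> X c y)) (at y)"
      unfolding f_def by (intro has_derivative_inner has_derivative_frechet Xd[OF c(1) that])
    from frechet_derivative_eqI[OF this] show ?thesis by (simp add: inner_commute)
  qed
  have D2f: "second_derivative f ?u w w = 2 * (X c ?u \<bullet> second_derivative (X c) ?u w w + DX c ?u w \<bullet> DX c ?u w)" for w
  proof -
    have "((\<lambda>y. 2 * (X c y \<bullet> DX c y w)) has_derivative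
        (\<lambda>v. 2 * (X c ?u \<bullet> second_derivative (X c) ?u w v + DX c ?u v \<bullet> DX c ?u w))) (at ?u)"
      by (intro has_derivative_mult_right has_derivative_inner has_derivative_frechet Xd[OF c(1,3)]
          C2_D[OF XC2[OF c(1)] c(3)])
    then have "((\<lambda>y. frechet_derivative f (at y) w) has_derivative
        (\<lambda>v. 2 * (X c ?u \<bullet> second_derivative (X c) ?u w v + DX c ?u v \<bullet> DX c ?u w))) (at ?u)"
      by (rule has_derivative_transform_within_open[OF _ openV[OF c(1)] c(3)]) (simp add: Df)
    from frechet_derivative_eqI[OF this] show ?thesis by simp
  qed
  have mx: "f u \<le> f ?u" if "u \<in> V c" for u
    using p(2)[OF inv_top[OF c(1) that]] by (simp add: f_def X_eq[OF c(1,2)]) (simp add: X_def)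
  have crit: "DX c ?u w \<bullet> X c ?u = 0" and le: "second_derivative f ?u w w \<le> 0" for w
    using second_derivative_nonpos_at_local_max[OF openV[OF c(1)] fC c(3) mx] Df[OF c(3)]
    by (auto simp: inner_commute)
  define s where "s = X c ?u \<bullet> N c ?u"
  have Xs: "X c ?u = s *\<^sub>R N c ?u" unfolding s_def
    by (rule normal_line[OF DX_lin[OF c(1,3)] DX_inj[OF c(1,3)] DX_N[OF c(1,3)] N_unit[OF c(1,3)] crit])
  have key: "0 < s * II c ?u w w" if "w \<noteq> 0" for w
  proof -
    have "DX c ?u w \<noteq> 0"
      using that DX_inj[OF c(1,3)] linear_0[OF DX_lin[OF c(1,3)]] by (metis injD)
    then have "0 < DX c ?u w \<bullet> DX c ?u w" by simp
    also have "\<dots> \<le> - (X c ?u \<bullet> second_derivative (X c) ?u w w)" using le[of w] unfolding D2f by (simp add: algebra_simps)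
    also have "\<dots> = s * II c ?u w w"
      using II_second_derivative[OF c(1,3), of w w] by (simp add: Xs inner_commute)
    finally show ?thesis .
  qed
  show ?thesis
  proof (rule that[OF c(1,3)])
    show "posdef c ?u \<or> (\<forall>w. w \<noteq> 0 \<longrightarrow> II c ?u w w < 0)"
    proof (cases "0 < s")
      case True
      then show ?thesis using key by (simp add: posdef_def zero_less_mult_iff)
    next
      case False
      then show ?thesis using key by (auto simp: zero_less_mult_iff)
    qed
  qed
qed

end


section \<open>Height functions and convexity\<close>

lemma radial_eq_iff:
  fixes a b :: "'a::real_normed_vector"
  assumes "a /\<^sub>R norm a = b /\<^sub>R norm b" "a \<noteq> 0"
  shows "b = (norm b / norm a) *\<^sub>R a"
proof (cases "b = 0")
  case False
  have "b = norm b *\<^sub>R (b /\<^sub>R norm b)" using False by simp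
  also have "\<dots> = norm b *\<^sub>R (a /\<^sub>R norm a)" using assms by simp
  finally show ?thesis by (simp add: divide_inverse)
qed simp

context hypersurface
begin

lemma height_C2: "c \<in> B \<Longrightarrow> C_k_on 2 (V c) (\<lambda>u. X c u \<bullet> v)"
  by (rule C_k_on_inner_right[OF openV XC2])

lemma height_D: "c \<in> B \<Longrightarrow> u \<in> V c \<Longrightarrow> frechet_derivative (\<lambda>u. X c u \<bullet> v) (at u) w = DX c u w \<bullet> v"
  by (rule frechet_derivative_inner_right[OF Xd])

lemma height_continuous: "continuous_map M euclideanreal (\<lambda>p. x p \<bullet> v)"
proof -
  have "continuous_map euclidean euclideanreal (\<lambda>y. y \<bullet> v)"
    by (simp add: continuous_map_iff_continuous2 continuous_intros)
  from continuous_map_compose[OF x_continuous this] show ?thesis by (simp add: o_def)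
qed

lemma height_strict_local_max:
  assumes p: "p \<in> D"
  obtains c d where "c \<in> B" "p \<in> fst c" "0 < d" "ball (snd c p) d \<subseteq> V c"
    "\<And>u. u \<in> ball (snd c p) d \<Longrightarrow> u \<noteq> snd c p \<Longrightarrow> X c u \<bullet> G p < x p \<bullet> G p"
proof -
  have "p \<in> topspace M" using p by (simp add: D_def)
  then obtain c where c: "c \<in> B" "p \<in> fst c" "snd c p \<in> V c" by (rule chart_around)
  have crit: "frechet_derivative (\<lambda>u. X c u \<bullet> G p) (at (snd c p)) w = 0" for w
    using DX_N[OF c(1,3)] by (simp add: height_D[OF c(1,3)] N_eq[OF c(1,2)])
  have neg: "second_derivative (\<lambda>u. X c u \<bullet> G p) (snd c p) w w < 0" if "w \<noteq> 0" for w
    using second_derivative_inner_right[OF openV[OF c(1)] XC2[OF c(1)] c(3), of "G p" w w]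
      II_second_derivative[OF c(1,3), of w w] D_posdef[OF p c(1,2)] that
    by (simp add: N_eq[OF c(1,2)] posdef_def)
  obtain d where "0 < d" "ball (snd c p) d \<subseteq> V c"
    "\<And>u. u \<in> ball (snd c p) d \<Longrightarrow> u \<noteq> snd c p \<Longrightarrow> X c u \<bullet> G p < X c (snd c p) \<bullet> G p"
    using strict_local_max_if_negative_definite[OF openV[OF c(1)] height_C2[OF c(1)] c(3) crit neg] by metis
  then show ?thesis using that[OF c(1,2)] X_eq[OF c(1,2)] by metis
qed

text \<open>The local behaviour of the height in a regular direction: its critical points are those where the
  normal is parallel to the direction, and by definiteness these are strict local extrema.\<close>

lemma height_peak:
  assumes p: "p \<in> D"
  shows "\<exists>T. openin M T \<and> p \<in> T \<and> (\<forall>q\<in>T. q \<noteq> p \<longrightarrow> x q \<bullet> G p < x p \<bullet> G p)"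
proof -
  obtain c d where c: "c \<in> B" "p \<in> fst c" "0 < d" "ball (snd c p) d \<subseteq> V c"
    and mx: "\<And>u. u \<in> ball (snd c p) d \<Longrightarrow> u \<noteq> snd c p \<Longrightarrow> X c u \<bullet> G p < x p \<bullet> G p"
    using height_strict_local_max[OF p] by metis
  note ch = charts[OF c(1)]
  let ?T = "chart_inv c ` ball (snd c p) d"
  have "openin M ?T" using c(4) by (intro chart_inv_image_openin[OF ch]) (auto simp: V_def)
  moreover have "p \<in> ?T" using c(3) chart_inv_left[OF ch c(2)] by (metis centre_in_ball image_eqI)
  moreover have "x q \<bullet> G p < x p \<bullet> G p" if q: "q \<in> ?T" "q \<noteq> p" for q
  proof -
    obtain u where u: "u \<in> ball (snd c p) d" "q = chart_inv c u" using q(1) by blast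
    then have "u \<noteq> snd c p" using q(2) chart_inv_left[OF ch c(2)] by auto
    then show ?thesis using mx[OF u(1)] u(2) by (simp add: X_def)
  qed
  ultimately show ?thesis by blast
qed

text \<open>Where the normal is opposite to the direction the height has a strict local minimum, and a punctured ball
  of dimension at least two is connected.\<close>

lemma height_pit:
  assumes q: "q \<in> D"
  shows "q \<in> M closure_of {u \<in> topspace M. x u \<bullet> G q < x q \<bullet> G q}"
    "\<exists>T. openin M T \<and> q \<in> T \<and> connectedin M {u \<in> T. x u \<bullet> G q < x q \<bullet> G q}"
proof -
  obtain c d where c: "c \<in> B" "q \<in> fst c" "0 < d" "ball (snd c q) d \<subseteq> V c"
    and mx: "\<And>u. u \<in> ball (snd c q) d \<Longrightarrow> u \<noteq> snd c q \<Longrightarrow> X c u \<bullet> G q < x q \<bullet> G q"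
    using height_strict_local_max[OF q] by metis
  note ch = charts[OF c(1)]
  let ?u = "snd c q"
  let ?T = "chart_inv c ` ball ?u d"
  let ?T' = "chart_inv c ` (ball ?u d - {?u})"
  have sub: "ball ?u d - {?u} \<subseteq> snd c ` fst c" using c(4) by (auto simp: V_def)
  have T': "{u \<in> ?T. x u \<bullet> G q < x q \<bullet> G q} = ?T'"
  proof (intro set_eqI iffI)
    fix p assume "p \<in> {u \<in> ?T. x u \<bullet> G q < x q \<bullet> G q}"
    then obtain u where u: "u \<in> ball ?u d" "p = chart_inv c u" "x p \<bullet> G q < x q \<bullet> G q" by blast
    then have "u \<noteq> ?u" using chart_inv_left[OF ch c(2)] by auto
    then show "p \<in> ?T'" using u by blast
  next
    fix p assume "p \<in> ?T'"
    then show "p \<in> {u \<in> ?T. x u \<bullet> G q < x q \<bullet> G q}" using mx by (auto simp: X_def)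
  qed
  have "?u islimpt ball ?u d" using c(3) by (simp add: islimpt_ball)
  then have "?u \<in> closure (ball ?u d - {?u})" by (simp add: islimpt_in_closure)
  then have "chart_inv c ?u \<in> M closure_of ?T'"
    using c(2) by (intro chart_inv_image_closure[OF ch _ _ sub]) auto
  then have "q \<in> M closure_of ?T'" using chart_inv_left[OF ch c(2)] by simp
  moreover have "?T' \<subseteq> {u \<in> topspace M. x u \<bullet> G q < x q \<bullet> G q}"
    using T' c(4) inv_top[OF c(1)] by blast
  ultimately show "q \<in> M closure_of {u \<in> topspace M. x u \<bullet> G q < x q \<bullet> G q}"
    using closure_of_mono by blast
  have "openin M ?T" using c(4) by (intro chart_inv_image_openin[OF ch]) (auto simp: V_def)
  moreover have "q \<in> ?T" using c(3) chart_inv_left[OF ch c(2)] by (metis centre_in_ball image_eqI)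
  moreover have "connectedin M ?T'"
    using dim by (intro chart_inv_image_connectedin[OF ch _ sub] connected_punctured_ball) simp
  ultimately show "\<exists>T. openin M T \<and> q \<in> T \<and> connectedin M {u \<in> T. x u \<bullet> G q < x q \<bullet> G q}"
    unfolding T'[symmetric] by (intro exI[of _ ?T] conjI)
qed

lemma height_regular:
  assumes q: "q \<in> topspace M" and v: "norm v = 1" "v \<noteq> G q" "v \<noteq> - G q"
  shows "q \<in> M closure_of {u \<in> topspace M. x q \<bullet> v < x u \<bullet> v}"
    "\<exists>T. openin M T \<and> q \<in> T \<and> connectedin M {u \<in> T. x q \<bullet> v < x u \<bullet> v}"
proof -
  obtain c where c: "c \<in> B" "q \<in> fst c" "snd c q \<in> V c" using q by (rule chart_around)
  note ch = charts[OF c(1)]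
  let ?u = "snd c q"
  let ?h = "\<lambda>u. X c u \<bullet> v"
  have "\<exists>w. DX c ?u w \<bullet> v \<noteq> 0"
  proof (rule ccontr)
    assume "\<not> (\<exists>w. DX c ?u w \<bullet> v \<noteq> 0)"
    then have "v = (v \<bullet> N c ?u) *\<^sub>R N c ?u"
      by (intro normal_line[OF DX_lin[OF c(1,3)] DX_inj[OF c(1,3)] DX_N[OF c(1,3)] N_unit[OF c(1,3)]]) auto
    then have vG: "v = (v \<bullet> G q) *\<^sub>R G q" by (simp add: N_eq[OF c(1,2)])
    then have "norm v = \<bar>v \<bullet> G q\<bar> * norm (G q)" by (metis norm_scaleR)
    then have "\<bar>v \<bullet> G q\<bar> = 1" using v(1) unit[OF q] by simp
    then have "v \<bullet> G q = 1 \<or> v \<bullet> G q = -1" by linarith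
    then show False using vG v(2,3) by (metis scaleR_minus1_left scaleR_one)
  qed
  then obtain w where w: "frechet_derivative ?h (at ?u) w \<noteq> 0" using height_D[OF c(1,3)] by metis
  have C1: "C_k_on 1 (V c) ?h" using C_k_on_SucD[of 1 "V c" ?h] height_C2[OF c(1)] by (simp add: numeral_2_eq_2)
  \<comment> \<open>inside every neighbourhood \<open>T\<close> of \<open>q\<close> there is a chart domain \<open>W\<close> with connected superlevel set\<close>
  have local: "\<exists>W. open W \<and> ?u \<in> W \<and> W \<subseteq> V c \<and> chart_inv c ` W \<subseteq> T \<and> connected {u \<in> W. ?h ?u < ?h u} \<and>
     {u \<in> W. ?h ?u < ?h u} \<noteq> {}" if T: "openin M T" "q \<in> T" for T
  proof -
    let ?U = "snd c ` (fst c \<inter> T)"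
    have U: "open ?U" "?u \<in> ?U" "?U \<subseteq> V c"
      using chart_image_open[OF ch T(1)] c(2) T(2) by (auto simp: V_def)
    obtain W where W: "open W" "?u \<in> W" "W \<subseteq> ?U" "connected {u \<in> W. ?h ?u < ?h u}" "{u \<in> W. ?h ?u < ?h u} \<noteq> {}"
      by (rule superlevel_connected_at_regular_point[OF U(1) C_k_on_subset[OF C1 U(3)] U(2) w]) (rule that; assumption)
    moreover have "chart_inv c ` W \<subseteq> T" using W(3) chart_inv_left[OF ch] by fastforce
    ultimately show ?thesis using U(3) by blast
  qed
  have hu: "?h ?u = x q \<bullet> v" by (simp add: X_eq[OF c(1,2)])
  show "q \<in> M closure_of {u \<in> topspace M. x q \<bullet> v < x u \<bullet> v}"
    unfolding in_closure_of
  proof (intro conjI q allI impI)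
    fix T assume T: "q \<in> T \<and> openin M T"
    then obtain W u where W: "W \<subseteq> V c" "chart_inv c ` W \<subseteq> T" "u \<in> W" "?h ?u < ?h u" using local[of T] by blast
    then have "chart_inv c u \<in> T" "x q \<bullet> v < x (chart_inv c u) \<bullet> v" "chart_inv c u \<in> topspace M"
      using hu inv_top[OF c(1)] by (auto simp: X_def)
    then show "\<exists>y. y \<in> {u \<in> topspace M. x q \<bullet> v < x u \<bullet> v} \<and> y \<in> T" by blast
  qed
  obtain W where W: "open W" "?u \<in> W" "W \<subseteq> V c" "connected {u \<in> W. ?h ?u < ?h u}"
    using local[OF openin_topspace q] by blast
  let ?T = "chart_inv c ` W"
  have "{p \<in> ?T. x q \<bullet> v < x p \<bullet> v} = chart_inv c ` {u \<in> W. ?h ?u < ?h u}"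
    unfolding hu by (auto simp: X_def)
  moreover have "connectedin M (chart_inv c ` {u \<in> W. ?h ?u < ?h u})"
    using W(3,4) by (intro chart_inv_image_connectedin[OF ch]) (auto simp: V_def)
  moreover have "openin M ?T" using W(1,3) by (intro chart_inv_image_openin[OF ch]) (auto simp: V_def)
  moreover have "q \<in> ?T" using W(2) chart_inv_left[OF ch c(2)] by (metis image_eqI)
  ultimately show "\<exists>T. openin M T \<and> q \<in> T \<and> connectedin M {u \<in> T. x q \<bullet> v < x u \<bullet> v}"
    by (intro exI[of _ ?T] conjI) simp_all
qed

text \<open>Since the height in the direction \<open>G p\<close> has no passes, it has a single peak. A maximum is a peak
  because elsewhere higher points accumulate.\<close>

lemma strictly_supporting:
  assumes D: "D \<noteq> {}" and p: "p \<in> topspace M - L" and q: "q \<in> topspace M" "q \<noteq> p"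
  shows "x q \<bullet> G p < x p \<bullet> G p"
proof -
  let ?v = "G p"
  let ?P = "{u \<in> topspace M. G u = ?v}"
  have pt: "p \<in> topspace M" "?v \<notin> S" using p by (auto simp: L_def)
  have PD: "u \<in> D" if "u \<in> ?P" for u using that D_everywhere[OF D] pt(2) by (auto simp: L_def)
  have clP: "closedin M ?P"
    using closedin_continuous_map_preimage[OF G_continuous, of "{?v}"] by simp
  have peak: "\<exists>T. openin M T \<and> r \<in> T \<and> (\<forall>u\<in>T. u \<noteq> r \<longrightarrow> x u \<bullet> ?v < x r \<bullet> ?v)" if "r \<in> ?P" for r
    using height_peak[OF PD[OF that]] that by simp
  have pass: "r \<in> M closure_of {u \<in> topspace M. x r \<bullet> ?v < x u \<bullet> ?v} \<and>
      (\<exists>T. openin M T \<and> r \<in> T \<and> connectedin M {u \<in> T. x r \<bullet> ?v < x u \<bullet> ?v})"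
    if r: "r \<in> topspace M" "r \<notin> ?P" for r
  proof (cases "?v = - G r")
    case True
    have "G r \<notin> S" using S_sym[of "G r"] True pt(2) by auto
    then have "r \<in> D" using r(1) D_everywhere[OF D] by (auto simp: L_def)
    from height_pit[OF this] show ?thesis unfolding True by simp
  next
    case False
    have "?v \<noteq> G r" using r by auto
    from height_regular[OF r(1) unit[OF pt(1)] this False] show ?thesis by blast
  qed
  have lpc: "locally_path_connected_space M" by (rule locally_path_connected_chartwise[OF charts cover])
  note uniq = unique_peak[OF cpt haus con lpc height_continuous clP peak pass]
  have P1: "r = r'" if "r \<in> ?P" "r' \<in> ?P" for r r'
    using uniq[of r r'] uniq[of r' r] that by (metis linorder_linear)
  have maxP: "z \<in> ?P" if z: "z \<in> topspace M" "\<And>u. u \<in> topspace M \<Longrightarrow> x u \<bullet> ?v \<le> x z \<bullet> ?v" for z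
  proof (rule ccontr)
    assume "z \<notin> ?P"
    then have "z \<in> M closure_of {u \<in> topspace M. x z \<bullet> ?v < x u \<bullet> ?v}" using pass z(1) by blast
    moreover have "{u \<in> topspace M. x z \<bullet> ?v < x u \<bullet> ?v} = {}" using z(2) by force
    ultimately show False by simp
  qed
  have "compact ((\<lambda>r. x r \<bullet> ?v) ` topspace M)"
    using image_compactin[OF _ height_continuous] cpt unfolding compact_space_def
    by (simp add: compactin_euclidean_iff)
  then obtain z where z: "z \<in> topspace M" "\<And>u. u \<in> topspace M \<Longrightarrow> x u \<bullet> ?v \<le> x z \<bullet> ?v"
    using compact_attains_sup[of "(\<lambda>r. x r \<bullet> ?v) ` topspace M"] ne by auto
  have "z = p" using P1 maxP[OF z] pt(1) by blast
  then have le: "x u \<bullet> ?v \<le> x p \<bullet> ?v" if "u \<in> topspace M" for u using z(2)[OF that] by simp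
  have "x q \<bullet> ?v \<noteq> x p \<bullet> ?v"
  proof
    assume "x q \<bullet> ?v = x p \<bullet> ?v"
    then have "q \<in> ?P" using maxP[OF q(1)] le by simp
    then show False using P1[of q p] pt(1) q(2) by blast
  qed
  then show ?thesis using le[OF q(1)] by linarith
qed

text \<open>The weak form of the inequality passes to the limit.\<close>

lemma supporting:
  assumes D: "D \<noteq> {}" and p: "p \<in> topspace M" and q: "q \<in> topspace M"
  shows "x q \<bullet> G p \<le> x p \<bullet> G p"
proof -
  have "continuous_map M euclideanreal (\<lambda>p. x q \<bullet> G p - x p \<bullet> G p)"
  proof (rule continuous_map_chartwise[OF charts cover])
    fix c assume c: "c \<in> B"
    have "continuous_on (V c) (\<lambda>u. x q \<bullet> N c u - X c u \<bullet> N c u)"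
      by (intro continuous_intros C_k_on_imp_continuous_on[OF XC2[OF c]] C_k_on_imp_continuous_on[OF NC1[OF c]])
    then show "continuous_on (snd c ` fst c) ((\<lambda>p. x q \<bullet> G p - x p \<bullet> G p) \<circ> chart_inv c)"
      by (simp add: X_def N_def V_def o_def)
  qed
  then have "closedin M {p \<in> topspace M. x q \<bullet> G p - x p \<bullet> G p \<in> {..0}}"
    by (rule closedin_continuous_map_preimage) simp
  moreover have "topspace M - L \<subseteq> {p \<in> topspace M. x q \<bullet> G p - x p \<bullet> G p \<in> {..0}}"
    using strictly_supporting[OF D _ q] by force
  ultimately have "M closure_of (topspace M - L) \<subseteq> {p \<in> topspace M. x q \<bullet> G p - x p \<bullet> G p \<in> {..0}}"
    by (rule closure_of_minimal[rotated])
  then show ?thesis using L_nonseparating(2) p by auto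
qed

text \<open>The hypersurface does not lie in a hyperplane, so its convex hull has an interior point, and this
  point is strictly inside all supporting half spaces.\<close>

lemma interior_point:
  assumes D: "D \<noteq> {}"
  obtains ctr where "\<And>p. p \<in> topspace M \<Longrightarrow> 0 < (x p - ctr) \<bullet> G p"
proof -
  let ?K = "convex hull (x ` topspace M)"
  have "interior ?K \<noteq> {}"
  proof
    assume "interior ?K = {}"
    then obtain a b where ab: "a \<noteq> 0" "?K \<subseteq> {y. a \<bullet> y = b}"
      using empty_interior_subset_hyperplane[OF convex_convex_hull] by metis
    have xb: "x q \<bullet> a = b" if "q \<in> topspace M" for q
      using ab(2) hull_inc[of "x q" "x ` topspace M" convex] that by (auto simp: inner_commute)
    have "topspace M - L \<noteq> {}" using L_nonseparating(2) ne by (metis closure_of_empty)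
    then obtain p where p: "p \<in> topspace M - L" by blast
    then obtain c where c: "c \<in> B" "p \<in> fst c" "snd c p \<in> V c" using chart_around by blast
    let ?u = "snd c p"
    have "DX c ?u w \<bullet> a = 0" for w
    proof -
      have "((\<lambda>u. X c u \<bullet> a) has_derivative (\<lambda>w. DX c ?u w \<bullet> a)) (at ?u)"
        by (intro has_derivative_inner_left has_derivative_frechet Xd c)
      moreover have "((\<lambda>u. X c u \<bullet> a) has_derivative (\<lambda>w. 0)) (at ?u)"
        by (rule has_derivative_transform_within_open[OF has_derivative_const[of b] openV[OF c(1)] c(3)])
          (use xb inv_top[OF c(1)] in \<open>simp add: X_def\<close>)
      ultimately show ?thesis using fun_cong[OF has_derivative_unique] by blast
    qed
    from normal_line[OF DX_lin[OF c(1,3)] DX_inj[OF c(1,3)] DX_N[OF c(1,3)] N_unit[OF c(1,3)] this]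
    have aG: "a = (a \<bullet> G p) *\<^sub>R G p" by (simp add: N_eq[OF c(1,2)])
    obtain e where e: "e > 0" "ball ?u e \<subseteq> V c" using openV[OF c(1)] c(3) open_contains_ball by blast
    have "ball ?u e \<noteq> {?u}"
      using e(1) islimpt_ball[of ?u ?u e] islimpt_finite[of "{?u}"] by auto
    then obtain u where u: "u \<in> ball ?u e" "u \<noteq> ?u" using e(1) by (metis all_not_in_conv centre_in_ball insertI1 singletonD subsetI subset_singletonD)
    let ?q = "chart_inv c u"
    have q: "?q \<in> topspace M" "?q \<noteq> p"
      using u e inv_top[OF c(1)] chart_inv_right[OF charts[OF c(1)]] by (auto simp: V_def)
    have "x ?q \<bullet> a = x p \<bullet> a" using xb q(1) p by simp
    then have "(a \<bullet> G p) * (x ?q \<bullet> G p) = (a \<bullet> G p) * (x p \<bullet> G p)" by (metis aG inner_scaleR_right)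
    moreover have "a \<bullet> G p \<noteq> 0" using aG ab(1) by auto
    ultimately show False using strictly_supporting[OF D p q] by simp
  qed
  then obtain ctr e where ctr: "e > 0" "cball ctr e \<subseteq> ?K" by (meson ex_in_conv mem_interior_cball)
  have "0 < (x p - ctr) \<bullet> G p" if p: "p \<in> topspace M" for p
  proof -
    have "ctr + e *\<^sub>R G p \<in> ?K" using ctr unit[OF p] by (intro subsetD[OF ctr(2)]) (simp add: dist_norm)
    moreover have "?K \<subseteq> {y. G p \<bullet> y \<le> G p \<bullet> x p}"
      using supporting[OF D p] by (intro hull_minimal convex_halfspace_le) (auto simp: inner_commute)
    ultimately have "G p \<bullet> (ctr + e *\<^sub>R G p) \<le> G p \<bullet> x p" by blast
    moreover have "G p \<bullet> G p = 1" using unit[OF p] by (simp add: dot_square_norm)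
    ultimately have "0 < G p \<bullet> (x p - ctr)" using ctr(1) by (simp add: inner_add_right inner_diff_right)
    then show ?thesis by (subst inner_commute)
  qed
  then show ?thesis using that by blast
qed


section \<open>Radial projection\<close>

text \<open>The position vector from an interior point is transversal to the hypersurface, so the cone over
  an open piece of the hypersurface is open.\<close>

lemma radial_open:
  assumes ctr: "\<And>p. p \<in> topspace M \<Longrightarrow> 0 < (x p - ctr) \<bullet> G p"
    and T: "openin M T" "p \<in> T"
  obtains e where "0 < e" "\<And>z. norm z = 1 \<Longrightarrow> dist z ((x p - ctr) /\<^sub>R norm (x p - ctr)) < e \<Longrightarrow>
    \<exists>q\<in>T. z = (x q - ctr) /\<^sub>R norm (x q - ctr)"
proof -
  have pt: "p \<in> topspace M" using T openin_subset by blast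
  obtain c where c: "c \<in> B" "p \<in> fst c" "snd c p \<in> V c" using pt by (rule chart_around)
  note ch = charts[OF c(1)]
  let ?u = "snd c p"
  define f where "f z = snd z *\<^sub>R (X c (fst z) - ctr)" for z :: "(real^'n) \<times> real"
  have R: "0 < norm (x p - ctr)" using ctr[OF pt] by auto
  have Xp: "X c ?u = x p" by (rule X_eq[OF c(1,2)])
  define f' where "f' = (\<lambda>z::(real^'n) \<times> real. DX c ?u (fst z) + snd z *\<^sub>R (x p - ctr))"
  have "((\<lambda>z::(real^'n) \<times> real. X c (fst z)) has_derivative (\<lambda>z. DX c ?u (fst z))) (at (?u, 1))"
    by (rule has_derivative_compose[where f=fst]) (use has_derivative_frechet[OF Xd[OF c(1,3)]] in \<open>auto intro: derivative_intros\<close>)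
  then have df: "(f has_derivative f') (at (?u, 1))"
    unfolding f_def f'_def by (auto intro!: derivative_eq_intros simp: Xp)
  have "surj f'"
  proof -
    have "(x p - ctr) \<bullet> N c ?u \<noteq> 0" using ctr[OF pt] by (simp add: N_eq[OF c(1,2)])
    have "\<exists>z. y = f' z" for y
    proof -
      obtain w t where "y = DX c ?u w + t *\<^sub>R (x p - ctr)"
        using hyperplane_decomposition[OF DX_lin[OF c(1,3)] DX_inj[OF c(1,3)] DX_N[OF c(1,3)]
            \<open>(x p - ctr) \<bullet> N c ?u \<noteq> 0\<close>] by metis
      then show ?thesis by (intro exI[of _ "(w, t)"]) (simp add: f'_def)
    qed
    then show ?thesis unfolding surj_def by blast
  qed
  then obtain g' where g': "linear g'" "f' \<circ> g' = id"
    using linear_surjective_right_inverse[OF has_derivative_linear[OF df]] by blast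
  have contf: "continuous_on (V c \<times> UNIV) f" unfolding f_def
    by (intro continuous_intros continuous_on_compose2[OF C_k_on_imp_continuous_on[OF XC2[OF c(1)]]]) auto
  let ?U = "snd c ` (fst c \<inter> T)"
  have U: "open ?U" "?u \<in> ?U" "?U \<subseteq> V c"
    using chart_image_open[OF ch T(1)] c(2) T(2) by (auto simp: V_def)
  have "f (?u, 1) \<in> interior (f ` (?U \<times> {0<..}))"
  proof (rule sussmann_open_mapping[OF _ contf _ df _ g'(2)])
    show "open (V c \<times> (UNIV::real set))" using openV[OF c(1)] by (simp add: open_Times)
    show "bounded_linear g'" using g'(1) by (simp add: linear_conv_bounded_linear)
    have "open (?U \<times> {0::real<..})" using U(1) by (simp add: open_Times)
    then show "(?u, 1) \<in> interior (?U \<times> {0::real<..})" using U(2) by (simp add: interior_open)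
  qed (use U c(3) in auto)
  then obtain e where e: "e > 0" "ball (x p - ctr) e \<subseteq> f ` (?U \<times> {0<..})"
    unfolding mem_interior by (auto simp: f_def Xp)
  show ?thesis
  proof (rule that[of "e / norm (x p - ctr)"])
    show "0 < e / norm (x p - ctr)" using e(1) R by simp
    fix z :: "real^('n option)"
    assume z: "norm z = 1" "dist z ((x p - ctr) /\<^sub>R norm (x p - ctr)) < e / norm (x p - ctr)"
    have "dist (norm (x p - ctr) *\<^sub>R z) (norm (x p - ctr) *\<^sub>R ((x p - ctr) /\<^sub>R norm (x p - ctr)))
       = norm (x p - ctr) * dist z ((x p - ctr) /\<^sub>R norm (x p - ctr))"
      unfolding dist_norm scaleR_diff_right[symmetric] norm_scaleR by simp
    also have "\<dots> < e" using z(2) R by (simp add: field_simps)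
    finally have "norm (x p - ctr) *\<^sub>R z \<in> ball (x p - ctr) e" using R by (simp add: dist_commute)
    then have "norm (x p - ctr) *\<^sub>R z \<in> f ` (?U \<times> {0<..})" using e(2) by (rule subsetD[rotated])
    then obtain y where y: "y \<in> ?U \<times> {0<..}" "norm (x p - ctr) *\<^sub>R z = f y" by (elim imageE)
    define u where "u = fst y"
    define s where "s = snd y"
    have us: "u \<in> ?U" "s > 0" "norm (x p - ctr) *\<^sub>R z = s *\<^sub>R (X c u - ctr)"
      using y by (simp_all add: u_def s_def f_def mem_Times_iff)
    let ?q = "chart_inv c u"
    have q: "?q \<in> T" using us(1) chart_inv_left[OF ch] by auto
    have eq: "norm (x p - ctr) *\<^sub>R z = s *\<^sub>R (x ?q - ctr)" using us(3) by (simp add: X_def)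
    have "norm (norm (x p - ctr) *\<^sub>R z) = norm (s *\<^sub>R (x ?q - ctr))" by (rule arg_cong[OF eq])
    then have "norm (x p - ctr) = s * norm (x ?q - ctr)" using us(2) z(1) by simp
    moreover have "z = (s / norm (x p - ctr)) *\<^sub>R (x ?q - ctr)"
    proof -
      have "z = inverse (norm (x p - ctr)) *\<^sub>R (norm (x p - ctr) *\<^sub>R z)" using R by simp
      also have "\<dots> = (s / norm (x p - ctr)) *\<^sub>R (x ?q - ctr)" unfolding eq by (simp add: divide_inverse mult.commute)
      finally show ?thesis .
    qed
    ultimately have "z = (x ?q - ctr) /\<^sub>R norm (x ?q - ctr)" using us(2) R by (simp add: field_simps)
    then show "\<exists>q\<in>T. z = (x q - ctr) /\<^sub>R norm (x q - ctr)" using q by blast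
  qed
qed

text \<open>The radial projection from an interior point is a continuous open map onto the sphere. Two points on
  the same ray can be moved, by openness, such that one of them avoids \<open>L\<close>. Strict support at this
  point puts the other one closer to the centre, and support at the other one excludes this.\<close>

theorem homeomorphic_sphere_if_definite:
  assumes D: "D \<noteq> {}"
  shows "M homeomorphic_space top_of_set (sphere (0 :: real^('n option)) 1)"
proof -
  obtain ctr where ctr: "\<And>p. p \<in> topspace M \<Longrightarrow> 0 < (x p - ctr) \<bullet> G p" using interior_point[OF D] by metis
  define r where "r p = (x p - ctr) /\<^sub>R norm (x p - ctr)" for p
  let ?S = "sphere (0 :: real^('n option)) 1"
  have nz: "x p - ctr \<noteq> 0" if "p \<in> topspace M" for p using ctr[OF that] by auto
  have rS: "r p \<in> ?S" if "p \<in> topspace M" for p using nz[OF that] by (simp add: r_def)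
  have cont: "continuous_map M euclidean r"
  proof (rule continuous_map_chartwise[OF charts cover])
    fix c assume c: "c \<in> B"
    have "continuous_on (V c) (\<lambda>u. (X c u - ctr) /\<^sub>R norm (X c u - ctr))"
      using nz[OF inv_top[OF c]] C_k_on_imp_continuous_on[OF XC2[OF c]]
      by (intro continuous_intros) (auto simp: X_def)
    then show "continuous_on (snd c ` fst c) (r \<circ> chart_inv c)" by (simp add: r_def X_def V_def o_def)
  qed
  have contS: "continuous_map M (top_of_set ?S) r"
    using cont rS by (auto simp: continuous_map_in_subtopology)
  have local: "\<exists>e>0. \<forall>z\<in>?S. dist z (r p) < e \<longrightarrow> z \<in> r ` T" if T: "openin M T" "p \<in> T" for T p
  proof -
    obtain e where "e > 0" "\<And>z. norm z = 1 \<Longrightarrow> dist z ((x p - ctr) /\<^sub>R norm (x p - ctr)) < e \<Longrightarrow>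
      \<exists>q\<in>T. z = (x q - ctr) /\<^sub>R norm (x q - ctr)" using radial_open[OF ctr T] by metis
    then show ?thesis by (intro exI[of _ e]) (auto simp: r_def image_iff)
  qed
  have "inj_on r (topspace M)"
  proof (rule inj_onI, rule ccontr)
    fix p q assume p: "p \<in> topspace M" and q: "q \<in> topspace M" and eq: "r p = r q" and "p \<noteq> q"
    then obtain T T' where T: "openin M T" "openin M T'" "p \<in> T" "q \<in> T'" "disjnt T T'"
      using haus unfolding Hausdorff_space_def by meson
    obtain e where e: "e > 0" "\<forall>z\<in>?S. dist z (r q) < e \<longrightarrow> z \<in> r ` T'" using local[OF T(2,4)] by blast
    \<comment> \<open>a point near \<open>p\<close> outside \<open>L\<close> is, like \<open>p\<close>, on the ray of a point near \<open>q\<close>\<close>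
    let ?W = "T \<inter> {a \<in> topspace M. r a \<in> ball (r q) e}"
    have "openin M {a \<in> topspace M. r a \<in> ball (r q) e}"
      by (rule openin_continuous_map_preimage[OF cont]) simp
    then have W: "p \<in> ?W \<and> openin M ?W" using T(1,3) p eq e(1) by auto
    have "p \<in> M closure_of (topspace M - L)" using p L_nonseparating(2) by simp
    then have "\<forall>T. p \<in> T \<and> openin M T \<longrightarrow> (\<exists>a. a \<in> topspace M - L \<and> a \<in> T)" unfolding in_closure_of by blast
    from this[rule_format, OF W] obtain a where a: "a \<in> topspace M - L" "a \<in> T" "r a \<in> ball (r q) e" by auto
    then have "r a \<in> r ` T'" using e(2) rS by (simp add: dist_commute)
    then obtain b where b: "b \<in> T'" "r a = r b" by blast
    have bt: "b \<in> topspace M" "b \<noteq> a" using b(1) T a(2) openin_subset by (auto simp: disjnt_def)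
    have at: "a \<in> topspace M" using a(1) by blast
    define l where "l = norm (x b - ctr) / norm (x a - ctr)"
    have l: "l > 0" using nz[OF bt(1)] nz[OF at] by (simp add: l_def)
    have xb: "x b - ctr = l *\<^sub>R (x a - ctr)"
      using radial_eq_iff[OF _ nz[OF at], of "x b - ctr"] b(2) by (simp add: r_def l_def)
    have "(x b - ctr) \<bullet> G a < (x a - ctr) \<bullet> G a"
      using strictly_supporting[OF D a(1) bt] by (simp add: inner_diff_left)
    then have "l * ((x a - ctr) \<bullet> G a) < 1 * ((x a - ctr) \<bullet> G a)" using xb by simp
    then have "l < 1" using ctr[OF at] by (simp add: mult_less_cancel_right_pos)
    have "(x a - ctr) \<bullet> G b \<le> (x b - ctr) \<bullet> G b"
      using supporting[OF D bt(1) at] by (simp add: inner_diff_left)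
    then have "(x a - ctr) \<bullet> G b \<le> l * ((x a - ctr) \<bullet> G b)" using xb by simp
    moreover have "0 < (x a - ctr) \<bullet> G b"
      using ctr[OF bt(1)] l unfolding xb by (simp add: zero_less_mult_iff)
    ultimately show False using \<open>l < 1\<close> by simp
  qed
  moreover have "r ` topspace M = ?S"
  proof -
    have "openin (top_of_set ?S) (r ` topspace M)"
      unfolding openin_euclidean_subtopology_iff
    proof (intro conjI ballI)
      show "r ` topspace M \<subseteq> ?S" using rS by blast
      fix y assume "y \<in> r ` topspace M"
      then obtain p where "p \<in> topspace M" "y = r p" by blast
      then show "\<exists>e>0. \<forall>z\<in>?S. dist z y < e \<longrightarrow> z \<in> r ` topspace M"
        using local[OF openin_topspace] by blast
    qed
    moreover have "closedin (top_of_set ?S) (r ` topspace M)"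
    proof -
      have "compact (r ` topspace M)"
        using image_compactin[OF _ cont] cpt unfolding compact_space_def by (simp add: compactin_euclidean_iff)
      then show ?thesis using rS by (intro closed_subset compact_imp_closed) auto
    qed
    moreover have "connected ?S" using dim by (intro connected_sphere) simp
    moreover have "r ` topspace M \<noteq> {}" using ne by simp
    ultimately show ?thesis by (metis connected_clopen)
  qed
  ultimately have "homeomorphic_map M (top_of_set ?S) r"
    using cpt contS
    by (intro continuous_imp_homeomorphic_map) (auto simp: Hausdorff_space_subtopology)
  then show ?thesis using homeomorphic_map_imp_homeomorphic_space by blast
qed

end

text \<open>Reversing the normal field changes the sign of the second fundamental form, so definiteness at one
  point, of either sign, suffices.\<close>

theorem hypersurface_homeomorphic_sphere:
  assumes "hypersurface M B x (G :: 'a \<Rightarrow> real^('n::finite option)) S m"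
  shows "M homeomorphic_space top_of_set (sphere (0 :: real^('n option)) 1)"
proof -
  interpret hypersurface M B x G S m by fact
  have Dneg: "((\<lambda>p. - G p) \<circ> chart_inv c has_derivative (\<lambda>w. - DN c u w)) (at u)" if "c \<in> B" "u \<in> V c" for c u
    using has_derivative_minus[OF has_derivative_frechet[OF Nd[OF that]]] by (simp add: N_def o_def)
  then have Dneg': "frechet_derivative ((\<lambda>p. - G p) \<circ> chart_inv c) (at u) = (\<lambda>w. - DN c u w)"
    if "c \<in> B" "u \<in> V c" for c u
    using frechet_derivative_eqI that by blast
  interpret neg: hypersurface M B x "\<lambda>p. - G p" S m
  proof
    show "Hausdorff_space M" "compact_space M" "connected_space M" "topspace M \<noteq> {}"
      "(\<Union>c\<in>B. fst c) = topspace M" "compact S" "ball_null m S" "2 \<le> CARD('n)"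
      by (fact haus cpt con ne cover S_compact S_null dim)+
    show "chart M c" if "c \<in> B" for c by (fact charts[OF that])
    show "(snd c' \<circ> chart_inv c) differentiable at u"
      if "c \<in> B" "c' \<in> B" "u \<in> snd c ` (fst c \<inter> fst c')" for c c' u by (fact transition[OF that])
    show "C_k_on 2 (snd c ` fst c) (x \<circ> chart_inv c)" if "c \<in> B" for c by (fact x_C2[OF that])
    show "C_k_on 1 (snd c ` fst c) ((\<lambda>p. - G p) \<circ> chart_inv c)" if "c \<in> B" for c
      using C_k_on_bounded_linear[OF bounded_linear_minus[OF bounded_linear_ident] openV[OF that] NC1[OF that]]
      by (simp add: N_def o_def V_def)
    show "inj (frechet_derivative (x \<circ> chart_inv c) (at u))" if "c \<in> B" "u \<in> snd c ` fst c" for c u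
      by (fact immersion[OF that])
    show "norm (- G p) = 1" if "p \<in> topspace M" for p using unit[OF that] by simp
    show "frechet_derivative (x \<circ> chart_inv c) (at u) w \<bullet> - G (chart_inv c u) = 0"
      if "c \<in> B" "u \<in> snd c ` fst c" for c u w using normal[OF that] by simp
    show "- y \<in> S" if "y \<in> S" for y by (fact S_sym[OF that])
    show "inj (frechet_derivative ((\<lambda>p. - G p) \<circ> chart_inv c) (at (snd c p)))"
      if "c \<in> B" "p \<in> fst c" "- G p \<notin> S" for c p
    proof -
      have "G p \<notin> S" using S_sym that(3) by blast
      then have "inj (DN c (snd c p))" using regular[OF that(1,2)] by (simp add: N_def)
      then show ?thesis using Dneg'[OF that(1) V_in[OF that(2)]] by (simp add: inj_def)
    qed
    show "\<exists>c\<in>B. p \<in> fst c \<and> Suc m \<le> dim (range (frechet_derivative ((\<lambda>p. - G p) \<circ> chart_inv c) (at (snd c p))))"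
      if pt: "p \<in> topspace M" for p
    proof -
      obtain c where c: "c \<in> B" "p \<in> fst c" "Suc m \<le> dim (range (DN c (snd c p)))"
        using rank[OF pt] unfolding N_def by blast
      have "range (\<lambda>w. - DN c (snd c p) w) = uminus ` range (DN c (snd c p))" by auto
      moreover have "dim (uminus ` range (DN c (snd c p))) = dim (range (DN c (snd c p)))"
        by (intro dim_image_eq) (auto simp: linear_uminus)
      ultimately show ?thesis using c Dneg'[OF c(1) V_in[OF c(2)]] by auto
    qed
  qed
  obtain c u where cu: "c \<in> B" "u \<in> V c" "posdef c u \<or> (\<forall>w. w \<noteq> 0 \<longrightarrow> II c u w w < 0)"
    using definite_somewhere by metis
  then consider "posdef c u" | "\<forall>w. w \<noteq> 0 \<longrightarrow> II c u w w < 0" by blast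
  then show ?thesis
  proof cases
    case 1
    then show ?thesis using D_I[OF cu(1,2)] homeomorphic_sphere_if_definite by blast
  next
    case 2
    then have "neg.posdef c u"
      unfolding neg.posdef_def neg.II_def II_def neg.X_def neg.N_def Dneg'[OF cu(1,2)] X_def by simp
    moreover have "u \<in> neg.V c" using cu(2) by (simp add: neg.V_def V_def)
    ultimately show ?thesis using neg.D_I[OF cu(1)] neg.homeomorphic_sphere_if_definite by blast
  qed
qed


section \<open>The unit normal of a hyperplane\<close>

lemma sum_option: "(\<Sum>i\<in>UNIV. f i) = f None + (\<Sum>i\<in>UNIV. f (Some i))"
  for f :: "'n::finite option \<Rightarrow> 'b::comm_monoid_add"
  by (simp add: UNIV_option_conv sum.reindex o_def)

lemma prod_option: "(\<Prod>i\<in>UNIV. f i) = f None * (\<Prod>i\<in>UNIV. f (Some i))"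
  for f :: "'n::finite option \<Rightarrow> 'b::comm_monoid_mult"
  by (simp add: UNIV_option_conv prod.reindex o_def)

lemma linear_axis_expansion:
  fixes A :: "real^'n \<Rightarrow> 'b::real_vector"
  assumes "linear A"
  shows "A w = (\<Sum>k\<in>UNIV. w $ k *\<^sub>R A (axis k 1))"
proof -
  have "w = (\<Sum>k\<in>UNIV. w $ k *\<^sub>R axis k 1)"
    using basis_expansion[of w] by (simp add: scalar_mult_eq_scaleR)
  then have "A w = A (\<Sum>k\<in>UNIV. w $ k *\<^sub>R axis k 1)" by simp
  then show ?thesis by (simp only: linear_sum[OF assms] linear_scale[OF assms])
qed

definition frame :: "(real^'n \<Rightarrow> real^('n option)) \<Rightarrow> real^('n option) \<Rightarrow> real^('n option)^('n option)" where
  "frame A y = (\<chi> i j. case j of Some k \<Rightarrow> A (axis k 1) $ i | None \<Rightarrow> y $ i)"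

lemma frame_mult_vector:
  assumes "linear A"
  shows "frame A y *v z = A (\<chi> i. z $ Some i) + z $ None *\<^sub>R y"
  by (simp add: vec_eq_iff frame_def matrix_vector_mult_def sum_option
      linear_axis_expansion[OF assms, of "\<chi> i. z $ Some i"] mult.commute)

text \<open>The generalised cross product of the columns of \<open>A\<close>: the vector that represents the linear
  functional \<open>y \<mapsto> det (frame A y)\<close>.\<close>

definition cross :: "(real^'n \<Rightarrow> real^('n option)) \<Rightarrow> real^('n option)" where
  "cross A = (\<chi> i. det (frame A (axis i 1)))"

lemma det_frame: "det (frame A y) = cross A \<bullet> y"
proof -
  define c where "c j = (case j of Some k \<Rightarrow> A (axis k 1) | None \<Rightarrow> 0)" for j
  have T: "transpose (frame A y) = (\<chi> j. if j = None then y else c j)" for y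
    by (auto simp: vec_eq_iff transpose_def frame_def c_def split: option.splits)
  have "det (frame A y) = det (transpose (frame A y))" by (simp add: det_transpose)
  also have "\<dots> = det (\<chi> j. if j = None then (\<Sum>i\<in>UNIV. y $ i *s axis i 1) else c j)"
    unfolding T by (simp only: basis_expansion)
  also have "\<dots> = (\<Sum>i\<in>UNIV. det (\<chi> j. if j = None then y $ i *s axis i 1 else c j))"
    by (rule det_linear_row_sum) simp
  also have "\<dots> = (\<Sum>i\<in>UNIV. y $ i * det (\<chi> j. if j = None then axis i 1 else c j))"
    by (simp only: det_row_mul)
  also have "\<dots> = (\<Sum>i\<in>UNIV. y $ i * det (frame A (axis i 1)))"
    by (simp only: T[symmetric] det_transpose)
  finally show ?thesis by (simp add: cross_def inner_vec_def mult.commute)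
qed

lemma cross_orthogonal:
  assumes "linear A"
  shows "A w \<bullet> cross A = 0"
proof -
  have "cross A \<bullet> A (axis k 1) = 0" for k
  proof -
    have "det (frame A (A (axis k 1))) = 0"
      by (rule det_identical_columns[of None "Some k"]) (simp_all add: column_def frame_def)
    then show ?thesis by (simp add: det_frame)
  qed
  then show ?thesis
    by (simp add: linear_axis_expansion[OF assms, of w] inner_sum_right inner_commute[of _ "cross A"])
qed

text \<open>A nonzero normal vector completes the columns of \<open>A\<close> to an invertible matrix, so the functional
  represented by the cross product does not vanish on it.\<close>

lemma cross_nonzero:
  fixes A :: "real^'n \<Rightarrow> real^('n option)"
  assumes A: "linear A" "inj A"
  shows "cross A \<noteq> 0"
proof -
  have "dim (range A) \<le> CARD('n)" using dim_image_le[OF A(1), of UNIV] by simp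
  then have "dim (range A) < DIM(real^('n option))" by simp
  then obtain N0 where N0: "N0 \<noteq> 0" "\<And>y. y \<in> span (range A) \<Longrightarrow> orthogonal N0 y"
    using orthogonal_to_subspace_exists by metis
  have orth: "A w \<bullet> N0 = 0" for w using N0(2)[OF span_base, of "A w"] by (simp add: orthogonal_def inner_commute)
  have "\<exists>z. y = frame A N0 *v z" for y
  proof -
    obtain w t where "y = A w + t *\<^sub>R N0"
      using hyperplane_decomposition[OF A orth, of N0 y] N0(1) by force
    then have "y = frame A N0 *v (\<chi> i. case i of None \<Rightarrow> t | Some k \<Rightarrow> w $ k)"
      by (simp add: frame_mult_vector[OF A(1)])
    then show ?thesis by blast
  qed
  then have "surj ((*v) (frame A N0))" unfolding surj_def by blast
  then have "invertible (frame A N0)"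
    using matrix_right_invertible_surjective invertible_right_inverse by blast
  then have "det (frame A N0) \<noteq> 0" using invertible_det_nz by blast
  then show ?thesis by (auto simp: det_frame)
qed

definition unit_normal :: "(real^'n \<Rightarrow> real^('n option)) \<Rightarrow> real^('n option)" where
  "unit_normal A = cross A /\<^sub>R norm (cross A)"

lemma unit_normal:
  assumes A: "linear A" "inj A"
  shows "norm (unit_normal A) = 1" "A w \<bullet> unit_normal A = 0" "0 < det (frame A (unit_normal A))"
  using cross_nonzero[OF A] cross_orthogonal[OF A(1)]
  by (simp_all add: unit_normal_def det_frame dot_square_norm)

lemma unit_normal_unique:
  assumes A: "linear A" "inj A" and N: "norm N = 1" "\<And>w. A w \<bullet> N = 0" "0 < det (frame A N)"
  shows "N = unit_normal A"
proof -
  let ?\<nu> = "unit_normal A"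
  have "N = (N \<bullet> ?\<nu>) *\<^sub>R ?\<nu>" by (rule normal_line[OF A unit_normal(2)[OF A] unit_normal(1)[OF A] N(2)])
  moreover have "\<bar>N \<bullet> ?\<nu>\<bar> = 1"
    using calculation N(1) unit_normal(1)[OF A] by (metis mult.right_neutral norm_scaleR)
  moreover have "0 < N \<bullet> ?\<nu>"
    using N(3) cross_nonzero[OF A] by (simp add: det_frame unit_normal_def inner_commute zero_less_mult_iff)
  ultimately show ?thesis by simp
qed

definition border :: "real^'n^'n \<Rightarrow> real^('n option)^('n option)" where
  "border P = (\<chi> i j. case i of
     None \<Rightarrow> (case j of None \<Rightarrow> 1 | Some b \<Rightarrow> 0)
   | Some a \<Rightarrow> (case j of None \<Rightarrow> 0 | Some b \<Rightarrow> P $ a $ b))"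

lemma det_swap_matrix:
  fixes a b :: "'k::finite"
  assumes "a \<noteq> b"
  shows "det (\<chi> i j. mat 1 $ i $ Transposition.transpose a b j) = (- 1 :: real)"
proof -
  have "Transposition.transpose a b permutes UNIV" by (rule permutes_swap_id) auto
  from det_permute_columns[OF this, of "mat 1 :: real^'k^'k"] show ?thesis
    using assms by (simp add: sign_swap_id)
qed

lemma det_transvection:
  fixes a b :: "'k::finite" and c :: real
  assumes "a \<noteq> b"
  shows "det (\<chi> i j. if i = a \<and> j = b then c else of_bool (i = j)) = 1"
proof -
  have "(\<chi> i j. if i = a \<and> j = b then c else of_bool (i = j)) =
    (\<chi> k. if k = a then row a (mat 1) + c *s row b (mat 1) else row k (mat 1))"
    using assms by (auto simp: vec_eq_iff row_def mat_def)
  then show ?thesis using det_row_operation[OF assms, of "mat 1" c] by simp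
qed

text \<open>The border is compatible with products, so it suffices to consider elementary matrices.\<close>

lemma det_border: "det (border P) = det (P :: real^'n^'n)"
proof (induction P rule: induct_matrix_elementary)
  case (1 A B)
  have "border (A ** B) = border A ** border B"
    by (auto simp: vec_eq_iff border_def matrix_matrix_mult_def sum_option split: option.splits)
  then show ?case using 1 by (simp add: det_mul)
next
  case (2 A i)
  then have "row (Some i) (border A) = 0"
    by (auto simp: row_def border_def vec_eq_iff split: option.splits)
  then show ?case using 2 by (simp add: det_zero_row(1))
next
  case (3 A)
  then have "border A $ i $ j = 0" if "i \<noteq> j" for i j
    using that by (auto simp: border_def split: option.splits)
  then have "det (border A) = (\<Prod>i\<in>UNIV. border A $ i $ i)" by (rule det_diagonal)
  then show ?case using 3 by (simp add: det_diagonal prod_option border_def)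
next
  case (4 m n)
  have "border (\<chi> i j. mat 1 $ i $ Transposition.transpose m n j) =
      (\<chi> i j. mat 1 $ i $ Transposition.transpose (Some m) (Some n) j)"
    using 4 by (auto simp: vec_eq_iff border_def mat_def Transposition.transpose_def split: option.splits)
  then show ?case using 4 by (simp add: det_swap_matrix)
next
  case (5 m n c)
  have "border (\<chi> i j. if i = m \<and> j = n then c else of_bool (i = j)) =
     (\<chi> i j. if i = Some m \<and> j = Some n then c else of_bool (i = j))"
    by (auto simp: vec_eq_iff border_def split: option.splits)
  then show ?case using 5 by (simp add: det_transvection)
qed

text \<open>The oriented unit normal depends only on the hyperplane and its orientation.\<close>

lemma unit_normal_compose:
  assumes A: "linear A" "inj A" and J: "linear J" "0 < det (matrix J)"
  shows "unit_normal (\<lambda>w. A (J w)) = unit_normal A"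
proof -
  have "frame (\<lambda>w. A (J w)) y = frame A y ** border (matrix J)" for y
    by (auto simp: vec_eq_iff frame_def border_def matrix_matrix_mult_def sum_option matrix_def
        linear_axis_expansion[OF A(1), of "J v" for v] mult.commute split: option.splits)
  then have d: "det (frame (\<lambda>w. A (J w)) y) = det (frame A y) * det (matrix J)" for y
    by (simp add: det_mul det_border)
  have "inj J" using J det_nz_iff_inj by fastforce
  then have "inj (\<lambda>w. A (J w))" using A(2) by (auto simp: inj_def)
  moreover have "linear (\<lambda>w. A (J w))" using linear_compose[OF J(1) A(1)] by (simp add: o_def)
  ultimately show ?thesis
    using unit_normal[OF A] J(2) by (intro unit_normal_unique[symmetric]) (auto simp: d)
qed

lemma C_k_on_unit_normal:
  fixes F :: "real^'n \<Rightarrow> real^'n \<Rightarrow> real^('n option)"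
  assumes "open U" and F: "\<And>w. C_k_on k U (\<lambda>u. F u w)" and inj: "\<And>u. u \<in> U \<Longrightarrow> linear (F u)" "\<And>u. u \<in> U \<Longrightarrow> inj (F u)"
  shows "C_k_on k U (\<lambda>u. unit_normal (F u))"
  unfolding unit_normal_def
proof (rule C_k_on_normalize[OF \<open>open U\<close> C_k_on_vec[OF \<open>open U\<close>]])
  show "cross (F u) \<noteq> 0" if "u \<in> U" for u using cross_nonzero inj that by blast
  fix i
  have "C_k_on k U (\<lambda>u. frame (F u) (axis i 1) $ r $ s)" for r s
  proof (cases s)
    case None
    then show ?thesis by (simp add: frame_def C_k_on_const)
  next
    case (Some a)
    then show ?thesis using C_k_on_bounded_linear[OF bounded_linear_vec_nth \<open>open U\<close> F] by (simp add: frame_def)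
  qed
  from C_k_on_det[OF \<open>open U\<close> this] show "C_k_on k U (\<lambda>u. cross (F u) $ i)" by (simp add: cross_def)
qed


section \<open>The Gauss map in charts\<close>

lemma C_k_on_local:
  assumes "\<And>x. x \<in> S \<Longrightarrow> \<exists>T. open T \<and> x \<in> T \<and> C_k_on k T f"
  shows "C_k_on k S f"
  using assms
proof (induction k arbitrary: f)
  case 0
  have "isCont f x" if "x \<in> S" for x
    using 0[OF that] by (auto simp: continuous_on_eq_continuous_at)
  then show ?case by (simp add: continuous_at_imp_continuous_on)
next
  case (Suc k)
  have "f differentiable (at x)" if "x \<in> S" for x using Suc.prems[OF that] by auto
  moreover have "C_k_on k S (\<lambda>x. frechet_derivative f (at x) v)" for v
    using Suc.prems by (intro Suc.IH) force
  ultimately show ?case by simp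
qed

lemma smooth_atlas_chart: "smooth_atlas M A \<Longrightarrow> c \<in> A \<Longrightarrow> chart M c"
  and smooth_atlas_cover: "smooth_atlas M A \<Longrightarrow> (\<Union>c\<in>A. fst c) = topspace M"
  by (auto simp: smooth_atlas_def)

lemma smooth_atlas_transition:
  "smooth_atlas M A \<Longrightarrow> c \<in> A \<Longrightarrow> c' \<in> A \<Longrightarrow> C_k_on k (snd c ` (fst c \<inter> fst c')) (snd c' \<circ> chart_inv c)"
  by (simp add: smooth_atlas_def smooth_on_def)

lemma smooth_atlas_transition_differentiable:
  "smooth_atlas M A \<Longrightarrow> c \<in> A \<Longrightarrow> c' \<in> A \<Longrightarrow> u \<in> snd c ` (fst c \<inter> fst c') \<Longrightarrow>
     (snd c' \<circ> chart_inv c) differentiable (at u)"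
  using smooth_atlas_transition[of M A c c' 1] by auto

lemma chart_at:
  assumes "smooth_atlas M A" "p \<in> topspace M"
  shows "chart_at A p \<in> A" "p \<in> fst (chart_at A p)"
proof -
  have "\<exists>c. c \<in> A \<and> p \<in> fst c" using assms smooth_atlas_cover by blast
  then have "chart_at A p \<in> A \<and> p \<in> fst (chart_at A p)" unfolding chart_at_def by (rule someI_ex)
  then show "chart_at A p \<in> A" "p \<in> fst (chart_at A p)" by auto
qed

text \<open>The transition map in the opposite direction provides a left inverse of the derivative.\<close>

lemma transition_derivative_inj:
  assumes at: "smooth_atlas M A" and c: "c \<in> A" "p \<in> fst c" and c': "c' \<in> A" "p \<in> fst c'"
  shows "inj (frechet_derivative (snd c' \<circ> chart_inv c) (at (snd c p)))"
proof -
  note ch = smooth_atlas_chart[OF at c(1)] and ch' = smooth_atlas_chart[OF at c'(1)]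
  let ?u = "snd c p"
  let ?\<sigma> = "frechet_derivative (snd c \<circ> chart_inv c') (at (snd c' p))"
  let ?\<tau> = "frechet_derivative (snd c' \<circ> chart_inv c) (at ?u)"
  have "((snd c \<circ> chart_inv c) has_derivative (\<lambda>w. ?\<sigma> (?\<tau> w))) (at ?u)"
    using c c' by (intro chart_change_derivative[OF ch ch'] smooth_atlas_transition_differentiable[OF at]) auto
  moreover have "((snd c \<circ> chart_inv c) has_derivative (\<lambda>w. w)) (at ?u)"
    by (rule has_derivative_transform_within_open[OF has_derivative_ident chart_open_image[OF ch]])
      (use c(2) chart_inv_right[OF ch] in auto)
  ultimately have "?\<sigma> (?\<tau> w) = w" for w using fun_cong[OF has_derivative_unique] by blast
  then show ?thesis by (metis injI)
qed

context
  fixes M :: "'a topology" and A B :: "('a set \<times> ('a \<Rightarrow> real^'n::finite)) set"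
    and x :: "'a \<Rightarrow> real^('n option)"
  assumes A: "smooth_atlas M A" and or: "orientation M A B" and x: "smooth_immersion M A x"
begin

lemma oriented_atlas: "smooth_atlas M B" "smooth_atlas M (A \<union> B)"
  using or by (simp_all add: orientation_def)

lemma immersion_chart_A: "a \<in> A \<Longrightarrow> C_k_on k (snd a ` fst a) (x \<circ> chart_inv a)"
  using x by (simp add: smooth_immersion_def smooth_on_def)

lemma immersion_smooth:
  assumes c: "c \<in> B"
  shows "C_k_on k (snd c ` fst c) (x \<circ> chart_inv c)"
proof (rule C_k_on_local)
  fix u assume "u \<in> snd c ` fst c"
  then obtain p where p: "p \<in> fst c" "u = snd c p" by blast
  note ch = smooth_atlas_chart[OF oriented_atlas(1) c]
  have pt: "p \<in> topspace M" using p(1) c smooth_atlas_cover[OF oriented_atlas(1)] by blast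
  obtain a where a: "a \<in> A" "p \<in> fst a" using chart_at[OF A pt] by blast
  note cha = smooth_atlas_chart[OF A a(1)]
  let ?W = "snd c ` (fst c \<inter> fst a)"
  have op: "open ?W" using chart_image_open[OF ch chart_openin[OF cha]] .
  have "C_k_on k ?W (\<lambda>y. (x \<circ> chart_inv a) ((snd a \<circ> chart_inv c) y))"
  proof (rule C_k_on_compose[OF op _ _ immersion_chart_A[OF a(1)]])
    show "C_k_on k ?W (snd a \<circ> chart_inv c)"
      using a(1) c by (intro smooth_atlas_transition[OF oriented_atlas(2)]) auto
    show "(snd a \<circ> chart_inv c) ` ?W \<subseteq> snd a ` fst a" using chart_inv_left[OF ch] by auto
  qed
  then have "C_k_on k ?W (x \<circ> chart_inv c)"
    by (rule C_k_on_cong[OF op, rotated]) (auto simp: chart_inv_left[OF ch] chart_inv_left[OF cha])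
  then show "\<exists>T. open T \<and> u \<in> T \<and> C_k_on k T (x \<circ> chart_inv c)" using op p a(2) by blast
qed

lemma immersion_differentiable:
  assumes "c \<in> B" "u \<in> snd c ` fst c"
  shows "(x \<circ> chart_inv c) differentiable (at u)"
  using immersion_smooth[OF assms(1), of 1] assms(2) by auto

lemma immersion_inj:
  assumes c: "c \<in> B" "u \<in> snd c ` fst c"
  shows "inj (frechet_derivative (x \<circ> chart_inv c) (at u))"
proof -
  obtain p where p: "p \<in> fst c" "u = snd c p" using c(2) by blast
  note ch = smooth_atlas_chart[OF oriented_atlas(1) c(1)]
  have pt: "p \<in> topspace M" using p(1) c(1) smooth_atlas_cover[OF oriented_atlas(1)] by blast
  define a where "a = chart_at A p"
  have a: "a \<in> A" "p \<in> fst a" unfolding a_def using chart_at[OF A pt] by auto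
  note cha = smooth_atlas_chart[OF A a(1)]
  let ?\<tau> = "frechet_derivative (snd a \<circ> chart_inv c) (at (snd c p))"
  let ?D = "frechet_derivative (x \<circ> chart_inv a) (at (snd a p))"
  have "inj ?D" using x pt by (simp add: smooth_immersion_def differential_def a_def)
  moreover have "inj ?\<tau>"
    using a c(1) p(1) by (intro transition_derivative_inj[OF oriented_atlas(2)]) auto
  moreover have "((x \<circ> chart_inv c) has_derivative (\<lambda>w. ?D (?\<tau> w))) (at (snd c p))"
  proof (rule chart_change_derivative[OF ch cha p(1) a(2)])
    show "(snd a \<circ> chart_inv c) differentiable at (snd c p)"
      using a c(1) p(1) by (intro smooth_atlas_transition_differentiable[OF oriented_atlas(2)]) auto
    show "(x \<circ> chart_inv a) differentiable at (snd a p)"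
      using immersion_chart_A[OF a(1), of 1] a(2) by simp
  qed
  ultimately show ?thesis by (simp add: frechet_derivative_eqI p(2) inj_def)
qed

lemma immersion_linear:
  assumes "c \<in> B" "u \<in> snd c ` fst c"
  shows "linear (frechet_derivative (x \<circ> chart_inv c) (at u))"
  using linear_frechet[OF immersion_differentiable[OF assms]] .

text \<open>The Gauss map is defined by one chart chosen for each point; positivity of the Jacobian determinants makes
  all oriented charts give the same normal, so that it can be differentiated in a fixed chart.\<close>

lemma gauss_map_chart:
  assumes c: "c \<in> B" "p \<in> fst c"
  shows "gauss_map B x p = unit_normal (frechet_derivative (x \<circ> chart_inv c) (at (snd c p)))"
proof -
  note ch = smooth_atlas_chart[OF oriented_atlas(1) c(1)]
  have pt: "p \<in> topspace M" using c smooth_atlas_cover[OF oriented_atlas(1)] by blast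
  define b where "b = chart_at B p"
  have b: "b \<in> B" "p \<in> fst b" unfolding b_def using chart_at[OF oriented_atlas(1) pt] by auto
  note chb = smooth_atlas_chart[OF oriented_atlas(1) b(1)]
  let ?D = "frechet_derivative (x \<circ> chart_inv c) (at (snd c p))"
  let ?J = "frechet_derivative (snd c \<circ> chart_inv b) (at (snd b p))"
  have u: "snd b p \<in> snd b ` (fst b \<inter> fst c)" "snd c p \<in> snd c ` fst c" "snd b p \<in> snd b ` fst b"
    using b(2) c(2) by auto
  have J: "0 < det (matrix ?J)" using or b(1) c(1) u(1) unfolding orientation_def by blast
  have Jd: "(snd c \<circ> chart_inv b) differentiable (at (snd b p))"
    by (rule smooth_atlas_transition_differentiable[OF oriented_atlas(1) b(1) c(1) u(1)])
  have E: "differential B x p = (\<lambda>w. ?D (?J w))"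
    unfolding differential_def b_def[symmetric]
    by (rule frechet_derivative_eqI, rule chart_change_derivative[OF chb ch b(2) c(2) Jd])
      (rule immersion_differentiable[OF c(1) u(2)])
  have lin: "linear (differential B x p)" "inj (differential B x p)"
    using immersion_linear[OF b(1) u(3)] immersion_inj[OF b(1) u(3)] by (simp_all add: differential_def b_def)
  have "gauss_map B x p = unit_normal (differential B x p)"
    unfolding gauss_map_def frame_def[symmetric]
  proof (rule the_equality, intro conjI allI)
    show "norm (unit_normal (differential B x p)) = 1" "differential B x p v \<bullet> unit_normal (differential B x p) = 0"
      "0 < det (frame (differential B x p) (unit_normal (differential B x p)))" for v
      by (rule unit_normal[OF lin])+
  next
    fix N assume "norm N = 1 \<and> (\<forall>v. differential B x p v \<bullet> N = 0) \<and> 0 < det (frame (differential B x p) N)"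
    then show "N = unit_normal (differential B x p)" by (elim conjE) (intro unit_normal_unique[OF lin]; simp)
  qed
  also have "\<dots> = unit_normal ?D"
    unfolding E by (rule unit_normal_compose[OF immersion_linear[OF c(1) u(2)] immersion_inj[OF c(1) u(2)] linear_frechet[OF Jd] J])
  finally show ?thesis .
qed

lemma gauss_map_normal_field: "normal_field M B x (gauss_map B x)"
proof
  show "chart M c" if "c \<in> B" for c by (rule smooth_atlas_chart[OF oriented_atlas(1) that])
  show "(\<Union>c\<in>B. fst c) = topspace M" by (rule smooth_atlas_cover[OF oriented_atlas(1)])
  show "(snd c' \<circ> chart_inv c) differentiable at u" if "c \<in> B" "c' \<in> B" "u \<in> snd c ` (fst c \<inter> fst c')" for c c' u
    by (rule smooth_atlas_transition_differentiable[OF oriented_atlas(1) that])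
  show "C_k_on 2 (snd c ` fst c) (x \<circ> chart_inv c)" if "c \<in> B" for c by (rule immersion_smooth[OF that])
  show "inj (frechet_derivative (x \<circ> chart_inv c) (at u))" if "c \<in> B" "u \<in> snd c ` fst c" for c u
    by (rule immersion_inj[OF that])
  have G: "gauss_map B x (chart_inv c u) = unit_normal (frechet_derivative (x \<circ> chart_inv c) (at u))"
    if "c \<in> B" "u \<in> snd c ` fst c" for c u
    using gauss_map_chart[OF that(1) chart_inv_in[OF smooth_atlas_chart[OF oriented_atlas(1) that(1)] that(2)]]
    by (simp only: chart_inv_right[OF smooth_atlas_chart[OF oriented_atlas(1) that(1)] that(2)])
  show "C_k_on 1 (snd c ` fst c) (gauss_map B x \<circ> chart_inv c)" if c: "c \<in> B" for c
  proof (rule C_k_on_cong[OF chart_open_image[OF smooth_atlas_chart[OF oriented_atlas(1) c]]])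
    show "unit_normal (frechet_derivative (x \<circ> chart_inv c) (at u)) = (gauss_map B x \<circ> chart_inv c) u"
      if "u \<in> snd c ` fst c" for u using G[OF c that] by simp
    show "C_k_on 1 (snd c ` fst c) (\<lambda>u. unit_normal (frechet_derivative (x \<circ> chart_inv c) (at u)))"
      using immersion_smooth[OF c, of 2]
      by (intro C_k_on_unit_normal chart_open_image[OF smooth_atlas_chart[OF oriented_atlas(1) c]]
          immersion_linear[OF c] immersion_inj[OF c]) (simp_all add: numeral_2_eq_2)
  qed
  show "norm (gauss_map B x p) = 1" if "p \<in> topspace M" for p
  proof -
    have c: "chart_at B p \<in> B" "p \<in> fst (chart_at B p)" using chart_at[OF oriented_atlas(1) that] by auto
    then have u: "snd (chart_at B p) p \<in> snd (chart_at B p) ` fst (chart_at B p)" by blast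
    show ?thesis
      unfolding gauss_map_chart[OF c] by (rule unit_normal(1)[OF immersion_linear[OF c(1) u] immersion_inj[OF c(1) u]])
  qed
  show "frechet_derivative (x \<circ> chart_inv c) (at u) w \<bullet> gauss_map B x (chart_inv c u) = 0"
    if "c \<in> B" "u \<in> snd c ` fst c" for c u w
    unfolding G[OF that] by (rule unit_normal(2)[OF immersion_linear[OF that] immersion_inj[OF that]])
qed

text \<open>By the Weingarten equations the matrix \<open>W\<close> exists, and it is singular exactly if the differential of
  the Gauss map is not injective.\<close>

lemma gauss_critical_iff:
  assumes p: "p \<in> topspace M"
  shows "det (gauss_differential_matrix B x p) \<noteq> 0 \<longleftrightarrow> inj (differential B (gauss_map B x) p)"
proof -
  interpret normal_field M B x "gauss_map B x" by (rule gauss_map_normal_field)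
  define c where "c = chart_at B p"
  have c: "c \<in> B" "p \<in> fst c" unfolding c_def using chart_at[OF oriented_atlas(1) p] by auto
  let ?u = "snd c p"
  have u: "?u \<in> V c" by (rule V_in[OF c(2)])
  have dx: "differential B x p = DX c ?u" and dG: "differential B (gauss_map B x) p = DN c ?u"
    by (simp_all add: differential_def c_def X_def N_def)
  note lin = DX_lin[OF c(1) u] and inj = DX_inj[OF c(1) u]
  have "\<exists>w. DN c ?u (axis j 1) = DX c ?u w" for j
  proof -
    have "N c ?u \<bullet> N c ?u \<noteq> 0" using N_unit[OF c(1) u] by (simp add: dot_square_norm)
    then obtain w t where wt: "DN c ?u (axis j 1) = DX c ?u w + t *\<^sub>R N c ?u"
      using hyperplane_decomposition[OF lin inj DX_N[OF c(1) u]] by metis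
    then have "t * (N c ?u \<bullet> N c ?u) = 0"
      using DN_N[OF c(1) u, of "axis j 1"] DX_N[OF c(1) u, of w] by (simp add: inner_add_left)
    then show ?thesis using wt \<open>N c ?u \<bullet> N c ?u \<noteq> 0\<close> by auto
  qed
  then obtain w where w: "\<And>j. DN c ?u (axis j 1) = DX c ?u (w j)" by metis
  define W where "W = (\<chi> i j. w j $ i)"
  have expand: "DX c ?u (\<chi> i. Z $ i $ j) = (\<Sum>i\<in>UNIV. Z $ i $ j *\<^sub>R DX c ?u (axis i 1))" for Z :: "real^'n^'n" and j
    by (simp add: linear_axis_expansion[OF lin, of "\<chi> i. Z $ i $ j"])
  have "gauss_differential_matrix B x p = W"
    unfolding gauss_differential_matrix_def dx dG expand[symmetric]
  proof (rule the_equality)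
    have "(\<chi> i. W $ i $ j) = w j" for j by (simp add: W_def vec_eq_iff)
    then show "\<forall>j. DN c ?u (axis j 1) = DX c ?u (\<chi> i. W $ i $ j)" using w by simp
    fix Z :: "real^'n^'n" assume "\<forall>j. DN c ?u (axis j 1) = DX c ?u (\<chi> i. Z $ i $ j)"
    then have "(\<chi> i. Z $ i $ j) = w j" for j using w inj by (metis injD)
    then show "Z = W" by (simp add: W_def vec_eq_iff)
  qed
  moreover have DNW: "DN c ?u v = DX c ?u (W *v v)" for v
  proof -
    have "DN c ?u v = (\<Sum>j\<in>UNIV. v $ j *\<^sub>R DX c ?u (w j))"
      by (simp add: linear_axis_expansion[OF DN_lin[OF c(1) u], of v] w)
    also have "\<dots> = DX c ?u (\<Sum>j\<in>UNIV. v $ j *\<^sub>R w j)"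
      by (simp only: linear_sum[OF lin] linear_scale[OF lin])
    also have "(\<Sum>j\<in>UNIV. v $ j *\<^sub>R w j) = W *v v"
      by (simp add: vec_eq_iff W_def matrix_vector_mult_def mult.commute)
    finally show ?thesis .
  qed
  have "inj (DN c ?u) \<longleftrightarrow> inj ((*v) W)" using inj by (auto simp: DNW inj_def)
  moreover have "inj ((*v) W) \<longleftrightarrow> det W \<noteq> 0"
    using det_nz_iff_inj[of "(*v) W"] by (simp add: matrix_vector_mul_linear)
  ultimately show ?thesis by (simp add: dG)
qed

lemma gauss_critical_points_eq:
  "gauss_critical_points M B x = topspace M - normal_field.R M B (gauss_map B x)"
proof -
  interpret normal_field M B x "gauss_map B x" by (rule gauss_map_normal_field)
  have "inj (differential B (gauss_map B x) p) \<longleftrightarrow> p \<in> R" if p: "p \<in> topspace M" for p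
  proof -
    have c: "chart_at B p \<in> B" "p \<in> fst (chart_at B p)" using chart_at[OF oriented_atlas(1) p] by auto
    have "differential B (gauss_map B x) p = DN (chart_at B p) (snd (chart_at B p) p)"
      by (simp add: differential_def N_def)
    then show ?thesis using R_inj[of p, OF _ c] c p by (auto simp: R_def)
  qed
  then show ?thesis using gauss_critical_iff by (auto simp: gauss_critical_points_def)
qed

lemma immersion_rank_le:
  assumes p: "p \<in> topspace M"
  shows "immersion_rank M B x \<le> dim (range (differential B (gauss_map B x) p))"
proof -
  interpret normal_field M B x "gauss_map B x" by (rule gauss_map_normal_field)
  let ?r = "\<lambda>p. rank (matrix (differential B (gauss_map B x) p))"
  \<comment> \<open>the minimum is over an infinite set of points, but only finitely many ranks occur\<close>
  have "?r ` topspace M \<subseteq> {..CARD('n)}" using rank_bound by (auto intro: order_trans)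
  then have "finite (?r ` topspace M)" by (rule finite_subset) simp
  then have "immersion_rank M B x \<le> ?r p" unfolding immersion_rank_def using p by (intro Min_le) auto
  also have "?r p = dim (range (differential B (gauss_map B x) p))"
  proof -
    have c: "chart_at B p \<in> B" "p \<in> fst (chart_at B p)" using chart_at[OF oriented_atlas(1) p] by auto
    have "linear (differential B (gauss_map B x) p)"
      using DN_lin[OF c(1) V_in[OF c(2)]] by (simp add: differential_def N_def)
    then show ?thesis by (simp add: rank_dim_range matrix_works)
  qed
  finally show ?thesis .
qed

end


section \<open>Immersions with a small set of critical values\<close>

text \<open>Interleave the two coverings.\<close>

lemma ball_null_Un:
  assumes "ball_null m S" "ball_null m T"
  shows "ball_null m (S \<union> T)"
  unfolding ball_null_def
proof (intro allI impI)
  fix e :: real assume "e > 0"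
  then have e2: "e / 2 > 0" by simp
  obtain c r where S: "\<forall>i::nat. 0 < r i \<and> r i \<le> 1" "S \<subseteq> (\<Union>i. cball (c i) (r i))"
     "\<forall>N. (\<Sum>i<N. r i ^ m) \<le> e / 2" using assms(1) e2 unfolding ball_null_def by meson
  obtain c' r' where T: "\<forall>i::nat. 0 < r' i \<and> r' i \<le> 1" "T \<subseteq> (\<Union>i. cball (c' i) (r' i))"
     "\<forall>N. (\<Sum>i<N. r' i ^ m) \<le> e / 2" using assms(2) e2 unfolding ball_null_def by meson
  define C where "C i = (if even i then c (i div 2) else c' (i div 2))" for i
  define R where "R i = (if even i then r (i div 2) else r' (i div 2))" for i
  have R: "0 < R i \<and> R i \<le> 1" for i using S(1) T(1) by (simp add: R_def)
  have "S \<union> T \<subseteq> (\<Union>i. cball (C i) (R i))"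
  proof
    fix y assume "y \<in> S \<union> T"
    then consider i where "y \<in> cball (c i) (r i)" | i where "y \<in> cball (c' i) (r' i)" using S(2) T(2) by blast
    then show "y \<in> (\<Union>i. cball (C i) (R i))"
    proof cases
      case 1
      then have "y \<in> cball (C (2 * i)) (R (2 * i))" by (simp add: C_def R_def)
      then show ?thesis by blast
    next
      case 2
      then have "y \<in> cball (C (2 * i + 1)) (R (2 * i + 1))" by (simp add: C_def R_def)
      then show ?thesis by blast
    qed
  qed
  moreover have "(\<Sum>i<N. R i ^ m) \<le> e" for N
  proof -
    have "(\<Sum>i<N. R i ^ m) \<le> (\<Sum>i<2*N. R i ^ m)"
      using R by (intro sum_mono2) (auto simp: less_imp_le)
    also have "(\<Sum>i<2*N. R i ^ m) = (\<Sum>i<N. r i ^ m) + (\<Sum>i<N. r' i ^ m)"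
      by (induction N) (auto simp: R_def)
    also have "\<dots> \<le> e" using S(3) T(3) by (metis add_mono field_sum_of_halves)
    finally show ?thesis .
  qed
  ultimately show "\<exists>c r. (\<forall>i::nat. 0 < r i \<and> r i \<le> 1) \<and> S \<union> T \<subseteq> (\<Union>i. cball (c i) (r i)) \<and>
     (\<forall>N. (\<Sum>i<N. r i ^ m) \<le> e)" using R by blast
qed

text \<open>The critical values and their antipodes form a compact set that is null in dimension \<open>k - 1\<close>,
  whereas the Gauss map has rank at least \<open>k\<close>.\<close>

theorem immersion_homeomorphic_sphere:
  fixes M :: "'a topology" and A B :: "('a set \<times> ('a \<Rightarrow> real^'n::finite)) set"
    and x :: "'a \<Rightarrow> real^('n option)"
  assumes n: "2 \<le> CARD('n)"
    and M: "smooth_manifold M A" "topspace M \<noteq> {}" "compact_space M" "connected_space M" "orientation M A B"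
    and x: "smooth_immersion M A x" "k \<le> immersion_rank M B x" and k: "2 \<le> k"
    and small: "immersion_dim M B x < real k - 1"
  shows "M homeomorphic_space top_of_set (sphere (0 :: real^('n option)) 1)"
proof -
  have A: "smooth_atlas M A" and haus: "Hausdorff_space M" using M(1) by (simp_all add: smooth_manifold_def)
  let ?G = "gauss_map B x"
  interpret normal_field M B x ?G by (rule gauss_map_normal_field[OF A M(5) x(1)])
  define S0 where "S0 = ?G ` gauss_critical_points M B x"
  have crit: "gauss_critical_points M B x = topspace M - R"
    by (rule gauss_critical_points_eq[OF A M(5) x(1)])
  have S0c: "compact S0"
  proof -
    have "closedin M (topspace M - R)" using R_openin by blast
    then have "compactin M (topspace M - R)" using M(3) closedin_compact_space by blast
    then show ?thesis
      using image_compactin[OF _ G_continuous] by (simp add: S0_def crit compactin_euclidean_iff)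
  qed
  obtain d where d: "0 \<le> d" "d < real k - 1" "hausdorff_measure d S0 = 0"
    using hausdorff_dim_lessD[OF compact_imp_bounded[OF S0c]] small unfolding immersion_dim_def S0_def by metis
  have S0n: "ball_null (k - 1) S0"
    using d k by (intro ball_null_if_hausdorff_null[of d]) (auto simp: of_nat_diff)
  define S where "S = S0 \<union> uminus ` S0"
  have "hypersurface M B x ?G S (k - 1)"
  proof
    show "Hausdorff_space M" "compact_space M" "connected_space M" "topspace M \<noteq> {}" "2 \<le> CARD('n)"
      by (fact haus M n)+
    show "compact S" unfolding S_def using S0c compact_negations by (intro compact_Un) auto
    have "ball_null (k - 1) (uminus ` S0)"
      by (rule ball_null_isometry[OF S0n]) (simp add: dist_norm norm_minus_commute)
    then show "ball_null (k - 1) S" unfolding S_def by (rule ball_null_Un[OF S0n])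
    show "- y \<in> S" if "y \<in> S" for y using that by (auto simp: S_def)
    show "inj (frechet_derivative (?G \<circ> chart_inv c) (at (snd c p)))"
      if "c \<in> B" "p \<in> fst c" "?G p \<notin> S" for c p
    proof -
      have "?G p \<notin> S0" using that(3) by (simp add: S_def)
      then have "p \<in> R" using topspace_if[OF that(1,2)] by (auto simp: S0_def crit)
      from R_inj[OF this that(1,2)] show ?thesis by (simp add: N_def)
    qed
    show "\<exists>c\<in>B. p \<in> fst c \<and> Suc (k - 1) \<le> dim (range (frechet_derivative (?G \<circ> chart_inv c) (at (snd c p))))"
      if "p \<in> topspace M" for p
    proof (rule bexI[of _ "chart_at B p"], rule conjI)
      show "chart_at B p \<in> B" "p \<in> fst (chart_at B p)"
        using chart_at[OF oriented_atlas(1)[OF A M(5) x(1)] that] by auto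
      from order_trans[OF x(2) immersion_rank_le[OF A M(5) x(1) that]]
      show "Suc (k - 1) \<le> dim (range (frechet_derivative (?G \<circ> chart_inv (chart_at B p)) (at (snd (chart_at B p) p))))"
        using k by (simp add: differential_def)
    qed
  qed
  then show ?thesis by (rule hypersurface_homeomorphic_sphere)
qed

theorem theorem1:
  fixes M :: "'a topology"
    and A B :: "('a set \<times> ('a \<Rightarrow> real^'n::finite)) set"
  assumes "3 \<le> CARD('n)"
    and "smooth_manifold M A"
    and "topspace M \<noteq> {}"
    and "compact_space M"
    and "connected_space M"
    and "orientable M A"
    and "orientation M A B"
    and "\<exists>k\<in>{0..CARD('n)}. alpha M A B k < real k - real_of_int \<lfloor>real CARD('n) / 2\<rfloor>"
  shows "M homeomorphic_space top_of_set (sphere (0 :: real^('n option)) 1)"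
proof -
  obtain k where k: "k \<le> CARD('n)" "alpha M A B k < real k - real_of_int \<lfloor>real CARD('n) / 2\<rfloor>"
    using assms(8) by auto
  \<comment> \<open>since \<open>[n/2] \<ge> 1\<close>, the value \<open>n - 1\<close> assigned to an empty set of immersions is not below the bound\<close>
  have half: "1 \<le> \<lfloor>real CARD('n) / 2\<rfloor>" using assms(1) by (simp add: le_floor_iff)
  then have half': "1 \<le> real_of_int \<lfloor>real CARD('n) / 2\<rfloor>" by linarith
  have "immersions_rank_ge M A B k \<noteq> {}"
  proof
    assume "immersions_rank_ge M A B k = {}"
    then have "real CARD('n) - 1 < real k - real_of_int \<lfloor>real CARD('n) / 2\<rfloor>" using k(2) by (simp add: alpha_def)
    then show False using half' k(1) by linarith
  qed
  then have "(INF x \<in> immersions_rank_ge M A B k. immersion_dim M B x) < real k - real_of_int \<lfloor>real CARD('n) / 2\<rfloor>"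
    using k(2) by (simp add: alpha_def)
  then obtain x where x: "x \<in> immersions_rank_ge M A B k"
      "immersion_dim M B x < real k - real_of_int \<lfloor>real CARD('n) / 2\<rfloor>"
    using cInf_lessD[of "immersion_dim M B ` immersions_rank_ge M A B k"]
      \<open>immersions_rank_ge M A B k \<noteq> {}\<close> by auto
  have x': "smooth_immersion M A x" "k \<le> immersion_rank M B x" using x(1) by (auto simp: immersions_rank_ge_def)
  have dim: "immersion_dim M B x < real k - 1" using x(2) half' by linarith
  \<comment> \<open>the dimension is nonnegative, which forces \<open>k \<ge> 2\<close>\<close>
  have "gauss_map B x ` gauss_critical_points M B x \<subseteq> sphere 0 1"
  proof -
    interpret normal_field M B x "gauss_map B x"
      using assms(2,7) x'(1) by (intro gauss_map_normal_field[of M A]) (auto simp: smooth_manifold_def)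
    show ?thesis using unit by (auto simp: gauss_critical_points_def)
  qed
  then have "0 \<le> immersion_dim M B x"
    unfolding immersion_dim_def by (intro hausdorff_dim_nonneg) (rule bounded_subset[OF bounded_sphere])
  then have "2 \<le> k" using dim by linarith
  moreover have "2 \<le> CARD('n)" using assms(1) by simp
  ultimately show ?thesis
    using immersion_homeomorphic_sphere[OF _ assms(2-5,7) x' _ dim] by blast
qed

end
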